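(* Let $D$ be a distributive extensional filter model (DEFiM). Then $D$ is approximable if and only if $D$ is sensible for the $\lambda$-calculus with $D$-tests $\Lambda_{\tau(D)}$.
   Context: Filter models. A filter model is a triple $(D,\wedge,\to)$ where $(D,\wedge)$ is a meet-semilattice with top $\omega$ ($\alpha\ge_D\beta$ iff $\alpha\wedge\beta=\beta$) and $\to$ is a binary operation with: for every finite family $(\alpha_i,\beta_i)_i$ and all $\gamma,\delta$, $\gamma\to\delta\ge_D\bigwedge_i(\alpha_i\to\beta_i)$ iff $\delta\ge_D\bigwedge_{\{i\mid\gamma\le_D\alpha_i\}}\beta_i$ (empty meet $=\omega$). Extensional: a function $\mathrm{ext}_D$ gives each $\alpha$ a finite $\mathrm{ext}_D(\alpha)\subseteq D\times D$ with $\alpha=\bigwedge_{(\beta,\gamma)\in\mathrm{ext}_D(\alpha)}(\beta\to\gamma)$. Distributive: whenever $\alpha\ge_D\beta\wedge\gamma$ there are $\beta'\ge_D\beta,\gamma'\ge_D\gamma$ with $\alpha=\beta'\wedge\gamma'$. DEFiM = distributive extensional filter model with fixed $\mathrm{ext}_D$. Interpretation of $\lambda$-terms (free variables among $\vec x=x_1..x_n$), $[\![M]\!]^{\vec x}\subseteq D^n\times D$: $[\![x_i]\!]^{\vec x}=\{(\vec\alpha,\beta)\mid\beta\ge_D\alpha_i\}$; $[\![\lambda y.M]\!]^{\vec x}=\{(\vec\alpha,\bigwedge_i(\beta_i\to\gamma_i))\mid\forall i,(\vec\alpha\beta_i,\gamma_i)\in[\![M]\!]^{\vec xy}\}$; $[\![MN]\!]^{\vec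 x}=\{(\vec\alpha,\bigwedge_i\beta_i)\mid\exists(\gamma_i)_i,(\vec\alpha,\bigwedge_i(\gamma_i\to\beta_i))\in[\![M]\!]^{\vec x},(\vec\alpha,\bigwedge_i\gamma_i)\in[\![N]\!]^{\vec x}\}$; $[\![\Omega]\!]^{\vec x}=\{(\vec\alpha,\omega)\}$. Calculus $\Lambda_{\tau(D)}$: terms $M::=x\mid\lambda x.M\mid MN\mid\sum_{i\le n}\bar\tau_{\alpha_i}(Q_i)$, tests $Q::=\sum_{i\le n}Q_i\mid\prod_{i\le n}Q_i\mid\tau_\alpha(M)$ ($\alpha,\alpha_i\in D\setminus\{\omega\}$, $n\ge0$); sums/products are finite multisets, empty sum $\mathbf 0$, empty product $\epsilon$, $\bar\epsilon_\alpha:=\bar\tau_\alpha(\epsilon)$, $\tau_\omega(M):=\epsilon$, $\bar\epsilon_\omega:=\mathbf 0$. Rules: $(\lambda x.M)N\to M[N/x]$; $(\sum_i\bar\tau_{\alpha_i}(Q_i))N\to\sum_i\sum_{(\beta,\gamma)\in\mathrm{ext}_D(\alpha_i)}\bar\tau_\gamma(Q_i\cdot\tau_\beta(N))$; $\tau_\alpha(\lambda x.M)\to\prod_{(\beta,\gamma)\in\mathrm{ext}_D(\alpha)}\tau_\gamma(M[\bar\epsilon_\beta/x])$; $\tau_\alpha(\sum_{i\in I}\bar\tau_{\beta_i}(Q_i))\to\sum_{\{I'\subseteq I\mid\alpha\ge_D\bigwedge_{i\in I'}\beta_i\}}\prod_{i\in I'}Q_i$; $\prod_{i}\sum_{j\le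 k_i}Q_{i,j}\to\sum_{j_1,\dots,j_n}\prod_iQ_{i,j_i}$; $\bar\tau_\alpha(\sum_iQ_i)\to\sum_i\bar\tau_\alpha(Q_i)$. Head reduction $\to_h$: closure of these under $\lambda x.[\cdot]$; $[\cdot]N$ and $\tau_\alpha([\cdot])$ when the redex-containing term is an application; $\bar\tau_\alpha([\cdot])$ and $[\cdot]\cdot P$ when the reduced test is not a sum; $[\cdot]+N$ for terms and $[\cdot]+P$ for tests. May-head-normal forms: tests $\prod_i\tau_{\alpha_i}(x_iM_i^1\cdots M_i^{n_i})+Q$; terms $\lambda x_1..x_n.y\,M_1\cdots M_m$ or $\lambda x_1..x_n.\bar\tau_\alpha(Q)+N$ with $\alpha\neq\omega$ and $Q$ a head-normal test without sums. $\Downarrow$: head-reduces to a may-head-normal form; $\Uparrow$: not $\Downarrow$. Interpretation extended: $[\![\sum_{i\in J}\bar\tau_{\alpha_i}(Q_i)]\!]^{\vec x}=\{(\vec\beta,\gamma)\mid\exists I\subseteq J,\vec\beta\in\bigcap_{i\in I}[\![Q_i]\!]^{\vec x},\gamma\ge_D\bigwedge_{i\in I}\alpha_i\}$; $[\![\tau_\alpha(M)]\!]^{\vec x}=\{\vec\beta\mid(\vec\beta,\alpha)\in[\![M]\!]^{\vec x}\}$; products are intersections ($[\![\epsilon]\!]=D^{\vec x}$), sums of tests are unions ($[\![\mathbf 0]\!]=\emptyset$). $D$ is sensible for $\Lambda_{\tau(D)}$ if for all terms $M$ and tests $Q$: $M\Uparrow$ iff $[\![M]\!]^{\vec x}=\{(\vec\alpha,\omega)\mid\vec\alpha\}$,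 and $Q\Uparrow$ iff $[\![Q]\!]^{\vec x}=\emptyset$. Approximability: for a pure $\lambda$-term $M$, $\lfloor M\rfloor=\Omega$ if $M=\lambda\vec x.(\lambda y.M')NM_1\cdots M_m$, and $\lfloor M\rfloor=\lambda\vec x.y\lfloor M_1\rfloor\cdots\lfloor M_k\rfloor$ if $M=\lambda\vec x.y\,M_1\cdots M_k$; $\mathcal B(M)=\{\lfloor M'\rfloor\mid M\to_h^*M'\}$ (ordinary head $\beta$-reduction). $D$ is approximable if $[\![M]\!]^{\vec x}=\bigcup_{N\in\mathcal B(M)}[\![N]\!]^{\vec x}$ for every pure $\lambda$-term $M$.
   Formalization: D is assumed nontrivial (some α ≠ ω), as D={ω} is approximable but not sensible; in B(M), head reduction continues inside the arguments of a head normal form, since with root head reduction only, x(Iy) has just the approximant xΩ and no nontrivial D is approximable. *)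

theory Defs
  imports "HOL-Library.Multiset"
begin

section \<open>Filter models\<close>

text \<open>The carrier $D$ is the whole type \<open>'d\<close>; its order and its top element $\omega$ are those of
  the class \<open>bounded_semilattice_inf_top\<close>. Meets of finite families are idempotent, so finite
  families are represented by finite sets.\<close>

definition meet :: "'d::bounded_semilattice_inf_top set \<Rightarrow> 'd" where
  "meet A = Finite_Set.fold inf top A"

definition arrows :: "('d \<Rightarrow> 'd \<Rightarrow> 'd) \<Rightarrow> ('d \<times> 'd) set \<Rightarrow> 'd::bounded_semilattice_inf_top" where
  "arrows arr S = meet ((\<lambda>(\<beta>, \<gamma>). arr \<beta> \<gamma>) ` S)"

locale filter_model =
  fixes arr :: "'d::bounded_semilattice_inf_top \<Rightarrow> 'd \<Rightarrow> 'd"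
  assumes arr_ge_iff: "finite S \<Longrightarrow>
    arrows arr S \<le> arr \<gamma> \<delta> \<longleftrightarrow> meet (snd ` {(\<alpha>, \<beta>) \<in> S. \<gamma> \<le> \<alpha>}) \<le> \<delta>"

locale DEFiM = filter_model arr
  for arr :: "'d::bounded_semilattice_inf_top \<Rightarrow> 'd \<Rightarrow> 'd" +
  fixes ext :: "'d \<Rightarrow> ('d \<times> 'd) set"
  assumes finite_ext: "finite (ext \<alpha>)"
    and ext_eq: "\<alpha> = arrows arr (ext \<alpha>)"
    and distributive: "inf \<beta> \<gamma> \<le> \<alpha> \<Longrightarrow> \<exists>\<beta>' \<gamma>'. \<beta> \<le> \<beta>' \<and> \<gamma> \<le> \<gamma>' \<and> \<alpha> = inf \<beta>' \<gamma>'"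


section \<open>Syntax\<close>

text \<open>Variables are de Bruijn indices. \<open>BarSum {#(\<alpha>\<^sub>1, Q\<^sub>1), \<dots>#}\<close> is
  $\sum_i \bar\tau_{\alpha_i}(Q_i)$. \<open>Omega\<close> is the constant of approximants; it
  does not belong to the calculus with tests.\<close>

datatype 'd tm =
    Var nat
  | Lam "'d tm"
  | App "'d tm" "'d tm"
  | Omega
  | BarSum "('d \<times> 'd test) multiset"
and 'd test =
    TSum "'d test multiset"
  | TProd "'d test multiset"
  | Tau 'd "'d tm"

abbreviation lams :: "nat \<Rightarrow> 'd tm \<Rightarrow> 'd tm" where
  "lams n M \<equiv> (Lam ^^ n) M"

abbreviation apps :: "'d tm \<Rightarrow> 'd tm list \<Rightarrow> 'd tm" where
  "apps M Ns \<equiv> foldl App M Ns"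

fun is_app :: "'d tm \<Rightarrow> bool" where
  "is_app (App M N) = True"
| "is_app _ = False"

fun is_sum :: "'d test \<Rightarrow> bool" where
  "is_sum (TSum A) = True"
| "is_sum _ = False"

fun is_prod :: "'d test \<Rightarrow> bool" where
  "is_prod (TProd A) = True"
| "is_prod _ = False"

text \<open>Sums and products of tests are associative and commutative with neutral elements $\mathbf 0$
  and $\epsilon$. A test is therefore represented by its flattened form: no sum is directly
  below a sum, no product directly below a product, and a sum or a product of one test is that
  test. \<open>wf_tm\<close> and \<open>wf_test\<close> carve out these representatives, and require that the indices
  of $\tau$ and $\bar\tau$ differ from $\omega$; \<open>tsum\<close> and \<open>tprod\<close> are the flattening sum and
  product.\<close>

primrec wf_tm :: "'d::order_top tm \<Rightarrow> bool" and wf_test :: "'d test \<Rightarrow> bool" where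
  "wf_tm (Var i) = True"
| "wf_tm (Lam M) = wf_tm M"
| "wf_tm (App M N) = (wf_tm M \<and> wf_tm N)"
| "wf_tm Omega = False"
| "wf_tm (BarSum A) = (\<forall>(\<alpha>, w) \<in># image_mset (map_prod id wf_test) A. \<alpha> \<noteq> top \<and> w)"
| "wf_test (TSum A) =
     (size A \<noteq> 1 \<and> (\<forall>Q \<in># A. \<not> is_sum Q) \<and> (\<forall>w \<in># image_mset wf_test A. w))"
| "wf_test (TProd A) =
     (size A \<noteq> 1 \<and> (\<forall>Q \<in># A. \<not> is_prod Q) \<and> (\<forall>w \<in># image_mset wf_test A. w))"
| "wf_test (Tau \<alpha> M) = (\<alpha> \<noteq> top \<and> wf_tm M)"

fun summands :: "'d test \<Rightarrow> 'd test multiset" where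
  "summands (TSum A) = A"
| "summands Q = {#Q#}"

fun factors :: "'d test \<Rightarrow> 'd test multiset" where
  "factors (TProd A) = A"
| "factors Q = {#Q#}"

definition tsum :: "'d test multiset \<Rightarrow> 'd test" where
  "tsum A = (let B = \<Sum>Q\<in>#A. summands Q in if size B = 1 then (THE Q. B = {#Q#}) else TSum B)"

definition tprod :: "'d test multiset \<Rightarrow> 'd test" where
  "tprod A = (let B = \<Sum>Q\<in>#A. factors Q in if size B = 1 then (THE Q. B = {#Q#}) else TProd B)"

text \<open>$\tau_\alpha(M)$, $\bar\tau_\alpha(Q)$ (as a multiset of summands) and $\bar\epsilon_\alpha$
  for arbitrary $\alpha$, with $\tau_\omega(M) = \epsilon$ and $\bar\tau_\omega(Q) = \mathbf 0$.\<close>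

definition tau :: "'d::order_top \<Rightarrow> 'd tm \<Rightarrow> 'd test" where
  "tau \<alpha> M = (if \<alpha> = top then TProd {#} else Tau \<alpha> M)"

definition bar :: "'d::order_top \<Rightarrow> 'd test \<Rightarrow> ('d \<times> 'd test) multiset" where
  "bar \<alpha> Q = (if \<alpha> = top then {#} else {#(\<alpha>, Q)#})"

definition bar_eps :: "'d::order_top \<Rightarrow> 'd tm" where
  "bar_eps \<alpha> = BarSum (bar \<alpha> (TProd {#}))"

text \<open>\<open>scoped n\<close>: all free variables are among the first \<open>n\<close>.\<close>

primrec scoped :: "nat \<Rightarrow> 'd tm \<Rightarrow> bool" and scoped_test :: "nat \<Rightarrow> 'd test \<Rightarrow> bool" where
  "scoped n (Var i) = (i < n)"
| "scoped n (Lam M) = scoped (Suc n) M"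
| "scoped n (App M N) = (scoped n M \<and> scoped n N)"
| "scoped n Omega = True"
| "scoped n (BarSum A) = (\<forall>(\<alpha>, s) \<in># image_mset (map_prod id (scoped_test n)) A. s)"
| "scoped_test n (TSum A) = (\<forall>s \<in># image_mset (scoped_test n) A. s)"
| "scoped_test n (TProd A) = (\<forall>s \<in># image_mset (scoped_test n) A. s)"
| "scoped_test n (Tau \<alpha> M) = scoped n M"

primrec rename :: "(nat \<Rightarrow> nat) \<Rightarrow> 'd tm \<Rightarrow> 'd tm"
  and rename_test :: "(nat \<Rightarrow> nat) \<Rightarrow> 'd test \<Rightarrow> 'd test" where
  "rename r (Var i) = Var (r i)"
| "rename r (Lam M) = Lam (rename (case_nat 0 (Suc \<circ> r)) M)"
| "rename r (App M N) = App (rename r M) (rename r N)"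
| "rename r Omega = Omega"
| "rename r (BarSum A) = BarSum (image_mset (map_prod id (rename_test r)) A)"
| "rename_test r (TSum A) = TSum (image_mset (rename_test r) A)"
| "rename_test r (TProd A) = TProd (image_mset (rename_test r) A)"
| "rename_test r (Tau \<alpha> M) = Tau \<alpha> (rename r M)"

primrec subst :: "(nat \<Rightarrow> 'd tm) \<Rightarrow> 'd tm \<Rightarrow> 'd tm"
  and subst_test :: "(nat \<Rightarrow> 'd tm) \<Rightarrow> 'd test \<Rightarrow> 'd test" where
  "subst s (Var i) = s i"
| "subst s (Lam M) = Lam (subst (case_nat (Var 0) (rename Suc \<circ> s)) M)"
| "subst s (App M N) = App (subst s M) (subst s N)"
| "subst s Omega = Omega"
| "subst s (BarSum A) = BarSum (image_mset (map_prod id (subst_test s)) A)"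
| "subst_test s (TSum A) = TSum (image_mset (subst_test s) A)"
| "subst_test s (TProd A) = TProd (image_mset (subst_test s) A)"
| "subst_test s (Tau \<alpha> M) = Tau \<alpha> (subst s M)"

text \<open>\<open>subst0 N M\<close> is $M[N/x]$ for the variable $x$ with index $0$.\<close>

definition subst0 :: "'d tm \<Rightarrow> 'd tm \<Rightarrow> 'd tm" where
  "subst0 N M = subst (case_nat N Var) M"


section \<open>Head reduction with tests\<close>

text \<open>In rule \<open>tau_bar\<close> the sublists of the list \<open>xs\<close> enumerating the summands are the
  subfamilies $I' \subseteq I$; in rule \<open>distrib\<close> the elements of \<open>product_lists Qss\<close> are the
  choices $(Q_{1,j_1}, \dots, Q_{n,j_n})$.\<close>

inductive hred :: "('d::bounded_semilattice_inf_top \<Rightarrow> ('d \<times> 'd) set) \<Rightarrow> 'd tm \<Rightarrow> 'd tm \<Rightarrow> bool"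
  and hred_test :: "('d \<Rightarrow> ('d \<times> 'd) set) \<Rightarrow> 'd test \<Rightarrow> 'd test \<Rightarrow> bool"
  for ext :: "'d \<Rightarrow> ('d \<times> 'd) set" where
  beta: "hred ext (App (Lam M) N) (subst0 N M)"
| bar_app: "hred ext (App (BarSum A) N)
    (BarSum (\<Sum>(\<alpha>, Q)\<in>#A. \<Sum>(\<beta>, \<gamma>)\<in>#mset_set (ext \<alpha>). bar \<gamma> (tprod {#Q, tau \<beta> N#})))"
| tau_lam: "hred_test ext (Tau \<alpha> (Lam M))
    (tprod {#tau \<gamma> (subst0 (bar_eps \<beta>) M). (\<beta>, \<gamma>) \<in># mset_set (ext \<alpha>)#})"
| tau_bar: "hred_test ext (Tau \<alpha> (BarSum (mset xs)))
    (tsum (mset (map (\<lambda>ys. tprod (mset (map snd ys)))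
                     (filter (\<lambda>ys. meet (fst ` set ys) \<le> \<alpha>) (subseqs xs)))))"
| distrib: "\<forall>Qs \<in> set Qss. \<forall>Q \<in> set Qs. wf_test Q \<Longrightarrow>
    hred_test ext (tprod (mset (map (\<lambda>Qs. tsum (mset Qs)) Qss)))
      (tsum (mset (map (\<lambda>Qs. tprod (mset Qs)) (product_lists Qss))))"
| bar_sum: "\<forall>Q \<in># A. wf_test Q \<Longrightarrow>
    hred ext (BarSum {#(\<alpha>, tsum A)#}) (BarSum (image_mset (Pair \<alpha>) A))"
| ctx_lam: "hred ext M M' \<Longrightarrow> hred ext (Lam M) (Lam M')"
| ctx_app: "hred ext M M' \<Longrightarrow> is_app M \<Longrightarrow> hred ext (App M N) (App M' N)"
| ctx_tau: "hred ext M M' \<Longrightarrow> is_app M \<Longrightarrow> hred_test ext (Tau \<alpha> M) (Tau \<alpha> M')"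
| ctx_bar: "hred_test ext Q Q' \<Longrightarrow> \<not> is_sum Q \<Longrightarrow>
    hred ext (BarSum {#(\<alpha>, Q)#}) (BarSum {#(\<alpha>, Q')#})"
| ctx_prod: "hred_test ext Q Q' \<Longrightarrow> \<not> is_sum Q \<Longrightarrow> wf_test Q \<Longrightarrow> wf_test P \<Longrightarrow>
    hred_test ext (tprod {#Q, P#}) (tprod {#Q', P#})"
| ctx_plus: "hred ext (BarSum A) (BarSum A') \<Longrightarrow> hred ext (BarSum (A + B)) (BarSum (A' + B))"
| ctx_sum: "hred_test ext Q Q' \<Longrightarrow> wf_test Q \<Longrightarrow> wf_test P \<Longrightarrow>
    hred_test ext (tsum {#Q, P#}) (tsum {#Q', P#})"

definition head_normal_prod :: "'d test \<Rightarrow> bool" where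
  "head_normal_prod R \<longleftrightarrow>
    (\<exists>A. R = tprod A \<and> (\<forall>Q \<in># A. \<exists>\<alpha> i Ms. Q = Tau \<alpha> (apps (Var i) Ms)))"

definition mhnf_test :: "'d test \<Rightarrow> bool" where
  "mhnf_test R \<longleftrightarrow> (\<exists>P Q. head_normal_prod P \<and> R = tsum {#P, Q#})"

definition mhnf :: "'d::order_top tm \<Rightarrow> bool" where
  "mhnf M \<longleftrightarrow> (\<exists>n i Ms. M = lams n (apps (Var i) Ms)) \<or>
    (\<exists>n \<alpha> Q A. M = lams n (BarSum (add_mset (\<alpha>, Q) A)) \<and> \<alpha> \<noteq> top \<and> head_normal_prod Q)"

definition converges :: "('d::bounded_semilattice_inf_top \<Rightarrow> ('d \<times> 'd) set) \<Rightarrow> 'd tm \<Rightarrow> bool" where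
  "converges ext M \<longleftrightarrow> (\<exists>M'. (hred ext)\<^sup>*\<^sup>* M M' \<and> mhnf M')"

definition converges_test ::
  "('d::bounded_semilattice_inf_top \<Rightarrow> ('d \<times> 'd) set) \<Rightarrow> 'd test \<Rightarrow> bool" where
  "converges_test ext Q \<longleftrightarrow> (\<exists>Q'. (hred_test ext)\<^sup>*\<^sup>* Q Q' \<and> mhnf_test Q')"


section \<open>Interpretation\<close>

text \<open>\<open>interp arr n M\<close> is the interpretation of \<open>M\<close> in a context of \<open>n\<close> variables; position \<open>i\<close>
  of the list belongs to the variable with index \<open>i\<close>, so the variable bound by an abstraction comes
  first.\<close>

primrec interp :: "('d::bounded_semilattice_inf_top \<Rightarrow> 'd \<Rightarrow> 'd) \<Rightarrow> nat \<Rightarrow> 'd tm \<Rightarrow> ('d list \<times> 'd) set"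
  and interp_test :: "('d \<Rightarrow> 'd \<Rightarrow> 'd) \<Rightarrow> nat \<Rightarrow> 'd test \<Rightarrow> 'd list set" where
  "interp arr n (Var i) = {(as, \<beta>). length as = n \<and> i < n \<and> as ! i \<le> \<beta>}"
| "interp arr n (Lam M) = {(as, arrows arr S) | as S.
     length as = n \<and> finite S \<and> (\<forall>(\<beta>, \<gamma>) \<in> S. (\<beta> # as, \<gamma>) \<in> interp arr (Suc n) M)}"
| "interp arr n (App M N) = {(as, meet (snd ` S)) | as S.
     length as = n \<and> finite S \<and> (as, arrows arr S) \<in> interp arr n M
       \<and> (as, meet (fst ` S)) \<in> interp arr n N}"
| "interp arr n Omega = {(as, top) | as. length as = n}"
| "interp arr n (BarSum A) = {(as, \<gamma>). length as = n \<and>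
     (\<exists>B. B \<subseteq># image_mset (map_prod id (interp_test arr n)) A
       \<and> (\<forall>(\<alpha>, X) \<in># B. as \<in> X) \<and> meet (fst ` set_mset B) \<le> \<gamma>)}"
| "interp_test arr n (TSum A) = \<Union> (set_mset (image_mset (interp_test arr n) A))"
| "interp_test arr n (TProd A) =
     {as. length as = n \<and> (\<forall>X \<in># image_mset (interp_test arr n) A. as \<in> X)}"
| "interp_test arr n (Tau \<alpha> M) = {as. (as, \<alpha>) \<in> interp arr n M}"

definition sensible ::
  "('d::bounded_semilattice_inf_top \<Rightarrow> 'd \<Rightarrow> 'd) \<Rightarrow> ('d \<Rightarrow> ('d \<times> 'd) set) \<Rightarrow> bool" where
  "sensible arr ext \<longleftrightarrow>
    (\<forall>n M. wf_tm M \<longrightarrow> scoped n M \<longrightarrow>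
       (\<not> converges ext M \<longleftrightarrow> interp arr n M = {(as, top) | as. length as = n})) \<and>
    (\<forall>n Q. wf_test Q \<longrightarrow> scoped_test n Q \<longrightarrow>
       (\<not> converges_test ext Q \<longleftrightarrow> interp_test arr n Q = {}))"


section \<open>Approximability\<close>

primrec pure :: "'d tm \<Rightarrow> bool" where
  "pure (Var i) = True"
| "pure (Lam M) = pure M"
| "pure (App M N) = (pure M \<and> pure N)"
| "pure Omega = False"
| "pure (BarSum A) = False"

definition head_redex :: "'d tm \<Rightarrow> bool" where
  "head_redex M \<longleftrightarrow> (\<exists>n P N Ms. M = lams n (apps (App (Lam P) N) Ms))"

text \<open>\<open>approx M\<close> is $\lfloor M \rfloor$; its two defining equations are the lemmas
  \<open>approx_redex\<close> and \<open>approx_hnf\<close> below. The clause for \<open>BarSum\<close> is irrelevant: \<open>approx\<close>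
  is only used on pure terms.\<close>

primrec approx :: "'d tm \<Rightarrow> 'd tm" where
  "approx (Var i) = Var i"
| "approx (Lam M) = (if head_redex (Lam M) then Omega else Lam (approx M))"
| "approx (App M N) = (if head_redex (App M N) then Omega else App (approx M) (approx N))"
| "approx Omega = Omega"
| "approx (BarSum A) = Omega"

inductive head_beta :: "'d tm \<Rightarrow> 'd tm \<Rightarrow> bool" where
  "head_beta (App (Lam M) N) (subst0 N M)"
| "head_beta M M' \<Longrightarrow> head_beta (Lam M) (Lam M')"
| "head_beta M M' \<Longrightarrow> is_app M \<Longrightarrow> head_beta (App M N) (App M' N)"

text \<open>The set $\mathcal B(M)$ has to contain all finite approximants of the Boehm tree of $M$, so
  once a head normal form is reached, head reduction goes on in the arguments of the head variable.
  Reduction at the root alone would leave $x\,(I\,y)$ with the only approximant $x\,\Omega$;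
  lemma \<open>root_approximants_insufficient\<close> below shows that its interpretation is then too small in
  every nontrivial filter model.\<close>

inductive bohm_red :: "'d tm \<Rightarrow> 'd tm \<Rightarrow> bool" where
  "head_beta M M' \<Longrightarrow> bohm_red M M'"
| "bohm_red N N' \<Longrightarrow>
    bohm_red (lams n (apps (Var i) (Ms @ N # Ns))) (lams n (apps (Var i) (Ms @ N' # Ns)))"

definition approximants :: "'d tm \<Rightarrow> 'd tm set" where
  "approximants M = {approx M' | M'. bohm_red\<^sup>*\<^sup>* M M'}"

definition approximable :: "('d::bounded_semilattice_inf_top \<Rightarrow> 'd \<Rightarrow> 'd) \<Rightarrow> bool" where
  "approximable arr \<longleftrightarrow>
    (\<forall>n M. pure M \<longrightarrow> scoped n M \<longrightarrow>
       interp arr n M = (\<Union>N \<in> approximants M. interp arr n N))"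


section \<open>Elementary facts\<close>

lemma meet_empty [simp]: "meet {} = top"
  by (simp add: meet_def)

lemma meet_insert [simp]: "finite A \<Longrightarrow> meet (insert a A) = inf a (meet A)"
  unfolding meet_def using comp_fun_idem_on.fold_insert_idem[OF comp_fun_idem_inf[unfolded comp_fun_idem_def']] by simp

lemma le_meet_iff: "finite A \<Longrightarrow> b \<le> meet A \<longleftrightarrow> (\<forall>a \<in> A. b \<le> a)"
  by (induction A rule: finite_induct) auto

lemma approx_redex: "approx (lams n (apps (App (Lam P) N) Ms)) = Omega"
proof (cases n)
  case 0
  show ?thesis
  proof (cases Ms rule: rev_cases)
    case Nil
    have "head_redex (App (Lam P) N)"
      unfolding head_redex_def by (intro exI[of _ 0] exI[of _ P] exI[of _ N] exI[of _ "[]"]) simp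
    with 0 Nil show ?thesis by simp
  next
    case (snoc Ns L)
    have "head_redex (App (apps (App (Lam P) N) Ns) L)"
      unfolding head_redex_def by (intro exI[of _ 0] exI[of _ P] exI[of _ N] exI[of _ Ms]) (simp add: snoc)
    with 0 snoc show ?thesis by simp
  qed
next
  case (Suc k)
  have "head_redex (Lam (lams k (apps (App (Lam P) N) Ms)))"
    unfolding head_redex_def by (intro exI[of _ n] exI[of _ P] exI[of _ N] exI[of _ Ms]) (simp add: Suc)
  with Suc show ?thesis by simp
qed

lemma apps_redex_neq: "apps (App (Lam P) N) Ns \<noteq> apps (Var i) Ms"
proof (induction Ms arbitrary: Ns rule: rev_induct)
  case Nil
  show ?case by (cases Ns rule: rev_cases) auto
next
  case (snoc M Ms)
  have "Lam P \<noteq> apps (Var i) Ms" by (cases Ms rule: rev_cases) auto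
  with snoc show ?case by (cases Ns rule: rev_cases) auto
qed

lemma not_head_redex_hnf: "\<not> head_redex (lams n (apps (Var i) Ms))"
proof -
  have 1: "Lam L \<noteq> apps (Var i) Ms" for L :: "'a tm" by (cases Ms rule: rev_cases) auto
  have 2: "Lam L \<noteq> apps (App (Lam P) N) Ns" for L P N :: "'a tm" and Ns
    by (cases Ns rule: rev_cases) auto
  have "lams m (apps (App (Lam P) N) Ns) \<noteq> lams n (apps (Var i) Ms)" for m P N Ns
  proof (induction n arbitrary: m)
    case 0
    show ?case using apps_redex_neq[of P N Ns i Ms] 1 by (cases m) auto
  next
    case (Suc n)
    then show ?case using 2 by (cases m) (auto, metis)
  qed
  then show ?thesis unfolding head_redex_def by metis
qed

lemma approx_hnf: "approx (lams n (apps (Var i) Ms)) = lams n (apps (Var i) (map approx Ms))"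
proof (induction n)
  case 0
  show ?case
  proof (induction Ms rule: rev_induct)
    case (snoc M Ms)
    then show ?case using not_head_redex_hnf[of 0 i "Ms @ [M]"] by simp
  qed simp
next
  case (Suc n)
  then show ?case using not_head_redex_hnf[of "Suc n" i Ms] by simp
qed

lemma (in filter_model) root_approximants_insufficient:
  fixes \<alpha> :: 'd
  assumes "\<alpha> \<noteq> top"
  defines "M \<equiv> App (Var 0) (App (Lam (Var 0)) (Var 1))"
  shows "interp arr 2 M \<noteq> (\<Union>N \<in> {approx M' | M'. head_beta\<^sup>*\<^sup>* M M'}. interp arr 2 N)"
proof -
  let ?as = "[arr \<alpha> \<alpha>, \<alpha>]"
  let ?S = "{(\<alpha>, \<alpha>)}"
  have S: "arrows arr ?S = arr \<alpha> \<alpha>" "meet (fst ` ?S) = \<alpha>" "meet (snd ` ?S) = \<alpha>" "finite ?S"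
    by (simp_all add: arrows_def)
  have "(?as, arrows arr ?S) \<in> interp arr 2 (Lam (Var 0))"
    by (simp only: interp.simps mem_Collect_eq) (rule exI[of _ ?as], rule exI[of _ ?S], simp)
  then have "(?as, meet (snd ` ?S)) \<in> interp arr 2 (App (Lam (Var 0)) (Var 1))"
    unfolding interp.simps(3) mem_Collect_eq
    by (intro exI[of _ ?as] exI[of _ ?S]) (simp add: S(2))
  then have "(?as, meet (snd ` ?S)) \<in> interp arr 2 M"
    unfolding M_def interp.simps(3)[of _ _ "Var 0"] mem_Collect_eq S(2,3)
    by (intro exI[of _ ?as] exI[of _ ?S]) (simp add: S del: interp.simps(2,3))
  then have l: "(?as, \<alpha>) \<in> interp arr 2 M" by (simp add: S)
  have nf: "\<not> head_beta M M'" for M'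
    unfolding M_def by (auto elim: head_beta.cases)
  have "M' = M" if "head_beta\<^sup>*\<^sup>* M M'" for M'
    using that nf by (auto elim: converse_rtranclpE)
  moreover have "approx M = App (Var 0) Omega"
    using approx_hnf[of 0 0 "[App (Lam (Var 0)) (Var 1) :: 'd tm]"]
      approx_redex[of 0 "Var 0" "Var 1 :: 'd tm" "[]"]
    by (simp add: M_def del: approx.simps(3))
  moreover have "(?as, \<alpha>) \<notin> interp arr 2 (App (Var 0) Omega)"
  proof
    assume "(?as, \<alpha>) \<in> interp arr 2 (App (Var 0) Omega)"
    then obtain T where T: "finite T" "\<alpha> = meet (snd ` T)" "arr \<alpha> \<alpha> \<le> arrows arr T"
        "meet (fst ` T) = top"
      by auto
    have "d = top" if "(c, d) \<in> T" for c d
    proof -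
      have "top \<le> c"
        using T(1,4) that le_meet_iff[of "fst ` T" top] by force
      moreover have "arr \<alpha> \<alpha> \<le> arr c d"
        using T(1,3) that unfolding arrows_def by (force simp: le_meet_iff)
      ultimately have "arrows arr ?S \<le> arr top d" by (simp add: S top_unique)
      then have "meet (snd ` {(a, b) \<in> ?S. top \<le> a}) \<le> d" using arr_ge_iff[of ?S top d] by simp
      moreover have "{(a, b) \<in> ?S. top \<le> a} = {}" using assms(1) by (auto simp: top_unique)
      ultimately show ?thesis by (metis image_empty meet_empty top_unique)
    qed
    then have "\<forall>d \<in> snd ` T. top \<le> d" by force
    then have "top \<le> meet (snd ` T)" using le_meet_iff[of "snd ` T" top] T(1) by blast
    with T(2) assms(1) show False by (simp add: top_unique)
  qed
  ultimately show ?thesis using l by force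
qed

end

theory Submission
  imports Defs "HOL-Library.Extended_Nat"
begin

text \<open>Both properties are equivalent to the following one: every semantic typing of a pure term has a
  cut-free derivation, i.e. one that contracts head $\beta$-redexes and otherwise only types a head
  variable (or a sum of $\bar\tau$'s) applied to cut-free typed arguments. Cut-free typed pure terms
  are exactly those typed by an approximant.

  If $D$ is sensible and the closed term $M$ has type $\alpha \neq \omega$, then $\tau_\alpha(M)$
  converges to $\epsilon + Q$. Cut-free typing is closed under head expansion, so $M$ is cut-free
  typed; open terms are closed by abstractions.

  If $D$ is approximable, replace the sums, products, $\tau$ and $\bar\tau$ in a term with tests by
  fresh variables of suitable types, where a test succeeds if its code has a
  fixed type \<open>ok\<close> other than $\omega$.
  The resulting pure term keeps the types of the original one, is cut-free typed, and its derivation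
  translates back. A cut-free typed term or test converges, while a term or test in may-head-normal
  form has a nontrivial interpretation, which persists under head expansion.\<close>


section \<open>Interpretations as filters\<close>

text \<open>Expansion of a \<beta>-step costs nothing, since \<open>Tm_red\<close> contracts by
  definition. The only substitution that has to be undone is that of \<open>bar_eps \<beta>\<close>
  in \<open>tau_lam\<close>. Its types are those above \<beta>, as for a variable assumed with
  \<beta>, so it can be exchanged for an entry of the environment. The convergence proof makes the
  same exchange in the other direction.

  Two obstacles shape that convergence proof. \<open>tau_lam\<close> splits a type by its fixed
  decomposition \<open>ext\<close>, which is unrelated to the arrows in a derivation; and a sum in
  one factor turns a whole product into a sum.

  In the encoding the fresh variables stay free, so no rule for tests has to be simulated by
  \<beta>: only the types assumed for these variables matter. A sum of tests is coded like a sum of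
  bars that all have the type \<open>ok\<close>. Since everything has the type \<omega>, only a type
  other than \<omega> can signal success.\<close>

lemma finite_filter_pairs: "finite S \<Longrightarrow> finite {(a, b) \<in> S. P a b}"
  by (rule finite_subset[of _ S]) auto

text \<open>The meet of this set is the least type that the sum \<open>A\<close> has when
  \<open>P\<close> decides which summands count. Three notions of success are used for
  \<open>P\<close>: membership in the interpretation, cut-free typing, and
  \<open>good\<close>.\<close>

abbreviation succs :: "('d test \<Rightarrow> bool) \<Rightarrow> ('d \<times> 'd test) multiset \<Rightarrow> 'd set" where
  "succs P A \<equiv> {\<alpha>. \<exists>Q. (\<alpha>, Q) \<in># A \<and> P Q}"

lemma finite_succ: "finite (succs P A)"
  by (rule finite_subset[of _ "fst ` set_mset A"]) force+

lemma meet_lower: "finite A \<Longrightarrow> a \<in> A \<Longrightarrow> meet A \<le> a"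
  using le_meet_iff by blast

lemma meet_antimono: "finite A \<Longrightarrow> B \<subseteq> A \<Longrightarrow> meet A \<le> meet B"
  by (meson finite_subset le_meet_iff meet_lower subset_iff)

lemma meet_Un: "finite A \<Longrightarrow> finite B \<Longrightarrow> meet (A \<union> B) = inf (meet A) (meet B)"
  by (induction A rule: finite_induct) (auto simp: inf_assoc)

text \<open>These are the structural rules of intersection types: universal type, intersection, and
  subsumption joined with strengthening of the environment.\<close>

definition filter_valued :: "nat \<Rightarrow> ('d list \<times> 'd::bounded_semilattice_inf_top) set \<Rightarrow> bool" where
  "filter_valued n X \<longleftrightarrow> (\<forall>as \<alpha>. (as, \<alpha>) \<in> X \<longrightarrow> length as = n) \<and> (\<forall>as. length as = n \<longrightarrow> (as, top) \<in> X)
    \<and> (\<forall>as \<alpha> \<beta>. (as, \<alpha>) \<in> X \<longrightarrow> (as, \<beta>) \<in> X \<longrightarrow> (as, inf \<alpha> \<beta>) \<in> X)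
    \<and> (\<forall>as bs \<alpha> \<beta>. (as, \<alpha>) \<in> X \<longrightarrow> list_all2 (\<le>) bs as \<longrightarrow> \<alpha> \<le> \<beta> \<longrightarrow> (bs, \<beta>) \<in> X)"

definition down_closed :: "nat \<Rightarrow> 'd::bounded_semilattice_inf_top list set \<Rightarrow> bool" where
  "down_closed n X \<longleftrightarrow> (\<forall>as \<in> X. length as = n) \<and> (\<forall>as bs. as \<in> X \<longrightarrow> list_all2 (\<le>) bs as \<longrightarrow> bs \<in> X)"

lemma filter_meet:
  assumes "filter_valued n X" "length as = n" "finite A" "\<forall>a \<in> A. (as, a) \<in> X"
  shows "(as, meet A) \<in> X"
  using assms(3,4) by (induction A rule: finite_induct) (use assms(1,2) in \<open>auto simp: filter_valued_def\<close>)

lemma list_all2_le_refl: "list_all2 (\<le>) as (as :: 'd::order list)"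
  by (simp add: list_all2_refl)

lemma filter_up: "filter_valued n X \<Longrightarrow> (as, \<alpha>) \<in> X \<Longrightarrow> \<alpha> \<le> \<beta> \<Longrightarrow> (as, \<beta>) \<in> X"
  using list_all2_le_refl unfolding filter_valued_def by blast

lemma filter_mono: "filter_valued n X \<Longrightarrow> (as, \<alpha>) \<in> X \<Longrightarrow> list_all2 (\<le>) bs as \<Longrightarrow> \<alpha> \<le> \<beta> \<Longrightarrow> (bs, \<beta>) \<in> X"
  unfolding filter_valued_def by blast

lemma filter_top: "filter_valued n X \<Longrightarrow> length as = n \<Longrightarrow> (as, top) \<in> X"
  unfolding filter_valued_def by blast

lemma filter_le_meet:
  assumes "filter_valued n X" "length as = n" "finite A" "\<forall>a \<in> A. (as, a) \<in> X" "meet A \<le> \<beta>"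
  shows "(as, \<beta>) \<in> X"
  using filter_up[OF assms(1) filter_meet[OF assms(1-4)] assms(5)] .

lemma scoped_Bar [simp]: "scoped n (BarSum A) \<longleftrightarrow> (\<forall>(\<alpha>, Q) \<in># A. scoped_test n Q)"
  by auto

section \<open>Predicates that cannot see the flattening of sums and products\<close>

lemma tsum_cases:
  obtains Q where "(\<Sum>Q\<in>#A. summands Q) = {#Q#}" "tsum A = Q"
  | "size (\<Sum>Q\<in>#A. summands Q) \<noteq> 1" "tsum A = TSum (\<Sum>Q\<in>#A. summands Q)"
proof (cases "size (\<Sum>Q\<in>#A. summands Q) = 1")
  case True
  then obtain Q where "(\<Sum>Q\<in>#A. summands Q) = {#Q#}" by (metis size_1_singleton_mset)
  then show ?thesis using that(1)[of Q] by (simp add: tsum_def)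
next
  case False
  show ?thesis by (rule that(2)[OF False]) (simp only: tsum_def Let_def False if_False)
qed

lemma tprod_cases:
  obtains Q where "(\<Sum>Q\<in>#A. factors Q) = {#Q#}" "tprod A = Q"
  | "size (\<Sum>Q\<in>#A. factors Q) \<noteq> 1" "tprod A = TProd (\<Sum>Q\<in>#A. factors Q)"
proof (cases "size (\<Sum>Q\<in>#A. factors Q) = 1")
  case True
  then obtain Q where "(\<Sum>Q\<in>#A. factors Q) = {#Q#}" by (metis size_1_singleton_mset)
  then show ?thesis using that(1)[of Q] by (simp add: tprod_def)
next
  case False
  show ?thesis by (rule that(2)[OF False]) (simp only: tprod_def Let_def False if_False)
qed

text \<open>A predicate that reads \<open>TSum\<close> as a disjunction holds of any test iff it
  holds of one of its \<open>summands\<close>. So neither merging nested sums nor dropping a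
  one-element sum affects it.\<close>

lemma tsum_ex:
  assumes f: "\<And>A. f (TSum A) \<longleftrightarrow> (\<exists>Q \<in># A. f Q)"
  shows "f (tsum A) \<longleftrightarrow> (\<exists>Q \<in># A. f Q)"
proof -
  have s: "f Q \<longleftrightarrow> (\<exists>P \<in># summands Q. f P)" for Q
    by (cases Q) (auto simp: f)
  have "f (tsum A) \<longleftrightarrow> (\<exists>Q \<in># (\<Sum>Q\<in>#A. summands Q). f Q)"
    by (cases rule: tsum_cases[of A]) (auto simp: f)
  also have "\<dots> \<longleftrightarrow> (\<exists>Q \<in># A. \<exists>P \<in># summands Q. f P)" by auto
  finally show ?thesis by (simp only: s[symmetric])
qed

lemma tsum_all:
  assumes f: "\<And>A. f (TSum A) \<longleftrightarrow> (\<forall>Q \<in># A. f Q)"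
  shows "f (tsum A) \<longleftrightarrow> (\<forall>Q \<in># A. f Q)"
  using tsum_ex[of "\<lambda>Q. \<not> f Q" A] f by auto

lemma tprod_all:
  assumes f: "\<And>A. f (TProd A) \<longleftrightarrow> (\<forall>Q \<in># A. f Q)"
  shows "f (tprod A) \<longleftrightarrow> (\<forall>Q \<in># A. f Q)"
proof -
  have s: "f Q \<longleftrightarrow> (\<forall>P \<in># factors Q. f P)" for Q
    by (cases Q) (auto simp: f)
  have "f (tprod A) \<longleftrightarrow> (\<forall>Q \<in># (\<Sum>Q\<in>#A. factors Q). f Q)"
    by (cases rule: tprod_cases[of A]) (auto simp: f)
  also have "\<dots> \<longleftrightarrow> (\<forall>Q \<in># A. \<forall>P \<in># factors Q. f P)" by auto
  finally show ?thesis by (simp only: s[symmetric])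
qed

context filter_model
begin

abbreviation sem :: "nat \<Rightarrow> 'd tm \<Rightarrow> ('d list \<times> 'd) set" where
  "sem \<equiv> interp arr"

abbreviation sem_test :: "nat \<Rightarrow> 'd test \<Rightarrow> 'd list set" where
  "sem_test \<equiv> interp_test arr"

lemma le_arrows_iff: "finite S \<Longrightarrow> b \<le> arrows arr S \<longleftrightarrow> (\<forall>(\<beta>, \<gamma>) \<in> S. b \<le> arr \<beta> \<gamma>)"
  unfolding arrows_def by (subst le_meet_iff) auto

lemma arrows_empty [simp]: "arrows arr {} = top"
  by (simp add: arrows_def)

lemma arrows_insert [simp]: "finite S \<Longrightarrow> arrows arr (insert (\<beta>, \<gamma>) S) = inf (arr \<beta> \<gamma>) (arrows arr S)"
  by (simp add: arrows_def)

lemma arrows_Un: "finite S \<Longrightarrow> finite T \<Longrightarrow> arrows arr (S \<union> T) = inf (arrows arr S) (arrows arr T)"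
  by (simp add: arrows_def image_Un meet_Un)

lemma arrows_lower: "finite S \<Longrightarrow> (\<beta>, \<gamma>) \<in> S \<Longrightarrow> arrows arr S \<le> arr \<beta> \<gamma>"
  using le_arrows_iff by fastforce

lemma arr_mono: "\<gamma>' \<le> \<gamma> \<Longrightarrow> \<delta> \<le> \<delta>' \<Longrightarrow> arr \<gamma> \<delta> \<le> arr \<gamma>' \<delta>'"
proof -
  assume a: "\<gamma>' \<le> \<gamma>" "\<delta> \<le> \<delta>'"
  have "snd ` {(\<alpha>, \<beta>) \<in> {(\<gamma>, \<delta>)}. \<gamma>' \<le> \<alpha>} = {\<delta>}" using a by force
  then show ?thesis using arr_ge_iff[of "{(\<gamma>, \<delta>)}" \<gamma>' \<delta>'] a by simp
qed

lemma arr_top [simp]: "arr \<gamma> top = top"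
  using arr_ge_iff[of "{}" \<gamma> top] by (simp add: top_unique)

lemma arr_eq_top_iff [simp]: "arr \<gamma> \<delta> = top \<longleftrightarrow> \<delta> = top"
  using arr_ge_iff[of "{}" \<gamma> \<delta>] by (auto simp: top_unique)

lemma arrows_le_arr_meet: "finite S \<Longrightarrow> arrows arr S \<le> arr (meet (fst ` S)) (meet (snd ` S))"
proof -
  assume S: "finite S"
  have "{(\<alpha>, \<beta>) \<in> S. meet (fst ` S) \<le> \<alpha>} = S"
    using S by (auto intro!: meet_lower) force
  then show ?thesis using arr_ge_iff[OF S, of "meet (fst ` S)" "meet (snd ` S)"] by simp
qed

lemma arr_inf: "inf (arr \<gamma> \<delta>) (arr \<gamma>' \<delta>') \<le> arr (inf \<gamma> \<gamma>') (inf \<delta> \<delta>')"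
  using arrows_le_arr_meet[of "{(\<gamma>, \<delta>), (\<gamma>', \<delta>')}"] by simp

end

context DEFiM
begin

lemma ext_lower: "(\<beta>, \<gamma>) \<in> ext \<alpha> \<Longrightarrow> \<alpha> \<le> arr \<beta> \<gamma>"
  by (subst ext_eq) (rule arrows_lower[OF finite_ext])

lemma le_ext: "(\<forall>(\<beta>, \<gamma>) \<in> ext \<alpha>. \<delta> \<le> arr \<beta> \<gamma>) \<Longrightarrow> \<delta> \<le> \<alpha>"
  by (subst ext_eq) (simp add: le_arrows_iff finite_ext)

text \<open>This is how the fixed decomposition \<open>ext \<alpha>\<close> is reached from an
  arbitrary family \<open>S\<close> of arrows below \<alpha>: each of its arrows follows from the
  members of \<open>S\<close> with a large enough source.\<close>

lemma arrows_le_ext: "finite S \<Longrightarrow> arrows arr S \<le> \<alpha> \<Longrightarrow> (\<beta>, \<gamma>) \<in> ext \<alpha> \<Longrightarrow>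
   meet (snd ` {(\<beta>', \<gamma>') \<in> S. \<beta> \<le> \<beta>'}) \<le> \<gamma>"
  using arr_ge_iff[of S \<beta> \<gamma>] order_trans[OF _ ext_lower[of \<beta> \<gamma> \<alpha>]] by simp

text \<open>Of all admissible subfamilies the one of all successful summands is the best, because
  meets shrink when families grow. This removes the existential quantifier of the
  definition.\<close>

lemma interp_Bar_iff:
  "(as, \<gamma>) \<in> sem n (BarSum A) \<longleftrightarrow> length as = n \<and>
     meet (succs (\<lambda>Q. as \<in> sem_test n Q) A) \<le> \<gamma>" (is "_ \<longleftrightarrow> _ \<and> meet ?Z \<le> \<gamma>")
proof -
  let ?f = "map_prod id (sem_test n)"
  have fin: "finite ?Z"
    by (rule finite_subset[of _ "fst ` set_mset A"]) force+
  show ?thesis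
  proof (cases "length as = n")
    case True
    show ?thesis
    proof
      assume "(as, \<gamma>) \<in> sem n (BarSum A)"
      then obtain B where B: "B \<subseteq># image_mset ?f A" "\<forall>(\<alpha>, X) \<in># B. as \<in> X" "meet (fst ` set_mset B) \<le> \<gamma>"
        by auto
      have "fst ` set_mset B \<subseteq> ?Z"
      proof
        fix a assume "a \<in> fst ` set_mset B"
        then obtain X where X: "(a, X) \<in># B" by auto
        then have "(a, X) \<in># image_mset ?f A" using B(1) by (meson mset_subset_eqD)
        then show "a \<in> ?Z" using X B(2) by auto
      qed
      then show "length as = n \<and> meet ?Z \<le> \<gamma>" using True meet_antimono[OF fin] B(3) order_trans by blast
    next
      assume r: "length as = n \<and> meet ?Z \<le> \<gamma>"
      let ?B = "filter_mset (\<lambda>(\<alpha>, X). as \<in> X) (image_mset ?f A)"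
      have "fst ` set_mset ?B = ?Z" by force
      then show "(as, \<gamma>) \<in> sem n (BarSum A)"
        using r by (auto intro!: exI[of _ ?B])
    qed
  qed simp
qed

lemma interp_Lam_raw: "(as, \<delta>) \<in> sem n (Lam M) \<longleftrightarrow> length as = n \<and> (\<exists>S. finite S \<and> \<delta> = arrows arr S
     \<and> (\<forall>(\<beta>, \<gamma>) \<in> S. (\<beta> # as, \<gamma>) \<in> sem (Suc n) M))"
  by auto

text \<open>By \<open>arrows_le_arr_meet\<close> a finite family of arrows lies below the single
  arrow from the meet of the sources to the meet of the targets, so upward closure lets one arrow
  replace the family.\<close>

lemma interp_App_raw: "filter_valued n (sem n M) \<Longrightarrow>
   (as, \<delta>) \<in> sem n (App M N) \<longleftrightarrow> length as = n \<and>
     (\<exists>\<gamma>. (as, arr \<gamma> \<delta>) \<in> sem n M \<and> (as, \<gamma>) \<in> sem n N)" (is "_ \<Longrightarrow> ?l \<longleftrightarrow> ?r")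
proof
  assume M: "filter_valued n (sem n M)"
  { assume ?l
    then obtain S where "length as = n" "finite S" "\<delta> = meet (snd ` S)" "(as, arrows arr S) \<in> sem n M"
      "(as, meet (fst ` S)) \<in> sem n N" by auto
    then show ?r using filter_up[OF M _ arrows_le_arr_meet] by blast }
  assume ?r
  then obtain \<gamma> where "(as, arr \<gamma> \<delta>) \<in> sem n M" "(as, \<gamma>) \<in> sem n N" "length as = n" by blast
  then show ?l by (auto intro!: exI[of _ "{(\<gamma>, \<delta>)}"])
qed


lemma interp_length: "(as, \<alpha>) \<in> sem n M \<Longrightarrow> length as = n"
  and interp_test_length: "as \<in> sem_test n Q \<Longrightarrow> length as = n"
proof (induction M and Q arbitrary: n as \<alpha> and n as)
  case (TSum A)
  then show ?case by auto
next
  case (Tau \<alpha> M)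
  then show ?case by auto
qed auto

lemma interp_TSum_iff: "as \<in> sem_test n (TSum A) \<longleftrightarrow> (\<exists>Q \<in># A. as \<in> sem_test n Q)"
  by simp

lemma interp_TProd_iff: "as \<in> sem_test n (TProd A) \<longleftrightarrow> length as = n \<and> (\<forall>Q \<in># A. as \<in> sem_test n Q)"
  by simp

text \<open>Scoping cannot be dropped: a variable out of range has no type at all, not even
  \<omega>.\<close>

lemma filter_interp: "scoped n M \<Longrightarrow> filter_valued n (sem n M)"
  and down_closed_interp_test: "scoped_test n Q \<Longrightarrow> down_closed n (sem_test n Q)"
proof (induction M and Q arbitrary: n and n)
  case (Var i)
  have "bs ! i \<le> \<beta>" if "as ! i \<le> \<alpha>" "list_all2 (\<le>) bs as" "\<alpha> \<le> \<beta>" "i < length as" for as bs and \<alpha> \<beta> :: 'd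
    using that by (metis list_all2_conv_all_nth order_trans)
  then show ?case using Var unfolding filter_valued_def by (auto dest: list_all2_lengthD)
next
  case (Lam M)
  note IH = Lam.IH[of "Suc n"]
  have IH: "filter_valued (Suc n) (sem (Suc n) M)" using Lam by simp
  show ?case unfolding filter_valued_def
  proof (intro conjI allI impI)
    fix as \<alpha>
    show "(as, \<alpha>) \<in> sem n (Lam M) \<Longrightarrow> length as = n" by auto
    show "length as = n \<Longrightarrow> (as, top) \<in> sem n (Lam M)"
      unfolding interp_Lam_raw by (auto intro!: exI[of _ "{}"])
  next
    fix as \<alpha> \<beta>
    assume "(as, \<alpha>) \<in> sem n (Lam M)" "(as, \<beta>) \<in> sem n (Lam M)"
    then obtain S T where "length as = n" "finite S" "\<alpha> = arrows arr S"
       "\<forall>(\<beta>, \<gamma>) \<in> S. (\<beta> # as, \<gamma>) \<in> sem (Suc n) M"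
      "finite T" "\<beta> = arrows arr T" "\<forall>(\<beta>, \<gamma>) \<in> T. (\<beta> # as, \<gamma>) \<in> sem (Suc n) M"
      unfolding interp_Lam_raw by blast
    then show "(as, inf \<alpha> \<beta>) \<in> sem n (Lam M)"
      unfolding interp_Lam_raw by (intro conjI exI[of _ "S \<union> T"]) (auto simp: arrows_Un)
  next
    fix as bs \<alpha> \<beta>
    assume a: "(as, \<alpha>) \<in> sem n (Lam M)" "list_all2 (\<le>) bs as" "\<alpha> \<le> \<beta>"
    then obtain S where S: "length as = n" "finite S" "\<alpha> = arrows arr S"
       "\<forall>(\<beta>, \<gamma>) \<in> S. (\<beta> # as, \<gamma>) \<in> sem (Suc n) M"
      unfolding interp_Lam_raw by blast
    have l: "length bs = n" using a(2) S(1) by (auto dest: list_all2_lengthD)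
    \<comment> \<open>The interpretation of an abstraction contains only meets of arrows, so a
      larger type must itself be presented as one. Extensionality provides
      \<open>ext \<beta>\<close>, whose arrows are checked one by one.\<close>
    have "(\<beta>' # bs, \<gamma>') \<in> sem (Suc n) M" if "(\<beta>', \<gamma>') \<in> ext \<beta>" for \<beta>' \<gamma>'
    proof (rule filter_le_meet[OF IH])
      show "meet (snd ` {(\<beta>'', \<gamma>'') \<in> S. \<beta>' \<le> \<beta>''}) \<le> \<gamma>'"
        using arrows_le_ext[OF S(2) _ that] a(3) S(3) by blast
      show "finite (snd ` {(\<beta>'', \<gamma>'') \<in> S. \<beta>' \<le> \<beta>''})"
        using finite_filter_pairs[OF S(2)] by (rule finite_imageI)
      show "length (\<beta>' # bs) = Suc n" using l by simp
      have "(\<beta>' # bs, \<gamma>'') \<in> sem (Suc n) M" if "(\<beta>'', \<gamma>'') \<in> S" "\<beta>' \<le> \<beta>''" for \<beta>'' \<gamma>''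
      proof (rule filter_mono[OF IH])
        show "(\<beta>'' # as, \<gamma>'') \<in> sem (Suc n) M" using S(4) that(1) by blast
      qed (use that a(2) in simp_all)
      then show "\<forall>a \<in> snd ` {(\<beta>'', \<gamma>'') \<in> S. \<beta>' \<le> \<beta>''}. (\<beta>' # bs, a) \<in> sem (Suc n) M"
        by auto
    qed
    then have "\<forall>(\<beta>', \<gamma>') \<in> ext \<beta>. (\<beta>' # bs, \<gamma>') \<in> sem (Suc n) M" by blast
    then show "(bs, \<beta>) \<in> sem n (Lam M)"
      unfolding interp_Lam_raw using l finite_ext[of \<beta>] ext_eq[of \<beta>] by blast
  qed
next
  case (App M N)
  have M: "filter_valued n (sem n M)" and N: "filter_valued n (sem n N)" using App by simp_all
  show ?case unfolding filter_valued_def interp_App_raw[OF M]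
  proof (intro conjI allI impI; (elim conjE exE)?)
    fix as :: "'d list" assume "length as = n"
    then show "\<exists>\<gamma>. (as, arr \<gamma> top) \<in> sem n M \<and> (as, \<gamma>) \<in> sem n N"
      using filter_top[OF M] filter_top[OF N] by (auto intro: exI[of _ top])
  next
    fix as :: "'d list" and \<alpha> \<beta> \<gamma> \<delta>
    assume a: "(as, arr \<gamma> \<alpha>) \<in> sem n M" "(as, \<gamma>) \<in> sem n N"
      "(as, arr \<delta> \<beta>) \<in> sem n M" "(as, \<delta>) \<in> sem n N"
    have "(as, inf (arr \<gamma> \<alpha>) (arr \<delta> \<beta>)) \<in> sem n M" using M a unfolding filter_valued_def by blast
    then have "(as, arr (inf \<gamma> \<delta>) (inf \<alpha> \<beta>)) \<in> sem n M" using filter_up[OF M] arr_inf by blast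
    moreover have "(as, inf \<gamma> \<delta>) \<in> sem n N" using N a unfolding filter_valued_def by blast
    ultimately show "\<exists>\<gamma>. (as, arr \<gamma> (inf \<alpha> \<beta>)) \<in> sem n M \<and> (as, \<gamma>) \<in> sem n N" by blast
  next
    fix as bs :: "'d list" and \<alpha> \<beta> \<gamma>
    assume a: "(as, arr \<gamma> \<alpha>) \<in> sem n M" "(as, \<gamma>) \<in> sem n N" "list_all2 (\<le>) bs as" "\<alpha> \<le> \<beta>"
    have "(bs, arr \<gamma> \<beta>) \<in> sem n M" using filter_mono[OF M a(1,3)] arr_mono a(4) by blast
    moreover have "(bs, \<gamma>) \<in> sem n N" using filter_mono[OF N a(2,3)] by blast
    ultimately show "\<exists>\<gamma>. (bs, arr \<gamma> \<beta>) \<in> sem n M \<and> (bs, \<gamma>) \<in> sem n N" by blast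
  qed (auto dest: list_all2_lengthD)
next
  case Omega
  show ?case by (auto simp: filter_valued_def top_unique dest: list_all2_lengthD)
next
  case (BarSum A)
  have d: "down_closed n (sem_test n Q)" if "(\<alpha>, Q) \<in># A" for \<alpha> Q
    using BarSum.IH[OF that] BarSum.prems that by (auto simp del: scoped.simps)
  show ?case unfolding filter_valued_def interp_Bar_iff
  proof (intro conjI allI impI; (elim conjE)?)
    fix as bs \<alpha> \<beta>
    assume a: "length as = n" "meet (succs (\<lambda>Q. as \<in> sem_test n Q) A) \<le> \<alpha>"
      "list_all2 (\<le>) bs as" "\<alpha> \<le> \<beta>"
    have "finite (succs (\<lambda>Q. bs \<in> sem_test n Q) A)"
      by (rule finite_subset[of _ "fst ` set_mset A"]) force+
    moreover have "succs (\<lambda>Q. as \<in> sem_test n Q) A \<subseteq> succs (\<lambda>Q. bs \<in> sem_test n Q) A"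
    proof -
      have "bs \<in> sem_test n Q" if "(\<alpha>, Q) \<in># A" "as \<in> sem_test n Q" for \<alpha> Q
        using d[OF that(1)] that(2) a(3) unfolding down_closed_def by metis
      then show ?thesis by auto
    qed
    ultimately show "meet (succs (\<lambda>Q. bs \<in> sem_test n Q) A) \<le> \<beta>"
      by (rule order_trans[OF order_trans[OF meet_antimono a(2)] a(4)])
  qed (auto dest: list_all2_lengthD)
next
  case (TSum A)
  then have d: "down_closed n (sem_test n Q)" if "Q \<in># A" for Q using that by simp
  show ?case unfolding down_closed_def
  proof (intro conjI allI impI ballI)
    fix as bs assume "as \<in> sem_test n (TSum A)" "list_all2 (\<le>) bs as"
    then show "bs \<in> sem_test n (TSum A)" using d unfolding down_closed_def interp_TSum_iff by metis
  qed (rule interp_test_length)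
next
  case (TProd A)
  then have d: "down_closed n (sem_test n Q)" if "Q \<in># A" for Q using that by simp
  show ?case unfolding down_closed_def
  proof (intro conjI allI impI ballI)
    fix as bs assume "as \<in> sem_test n (TProd A)" "list_all2 (\<le>) bs as"
    then show "bs \<in> sem_test n (TProd A)" using d list_all2_lengthD
      unfolding down_closed_def interp_TProd_iff by metis
  qed (rule interp_test_length)
next
  case (Tau \<alpha> M)
  have f: "filter_valued n (sem n M)" using Tau by simp
  show ?case unfolding down_closed_def
  proof (intro conjI allI impI ballI)
    fix as bs assume "as \<in> sem_test n (Tau \<alpha> M)" "list_all2 (\<le>) bs as"
    then show "bs \<in> sem_test n (Tau \<alpha> M)" using filter_mono[OF f, of as \<alpha> bs \<alpha>] by simp
  qed (rule interp_test_length)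
qed

lemmas interp_up = filter_up[OF filter_interp]
lemmas interp_mono = filter_mono[OF filter_interp]
lemmas interp_top = filter_top[OF filter_interp]
lemmas interp_le_meet = filter_le_meet[OF filter_interp]

lemma interp_inf: "scoped n M \<Longrightarrow> (as, \<alpha>) \<in> sem n M \<Longrightarrow> (as, \<beta>) \<in> sem n M \<Longrightarrow>
    (as, inf \<alpha> \<beta>) \<in> sem n M"
  using filter_interp[of n M] unfolding filter_valued_def by metis

lemma interp_test_mono: "scoped_test n Q \<Longrightarrow> as \<in> sem_test n Q \<Longrightarrow> list_all2 (\<le>) bs as \<Longrightarrow> bs \<in> sem_test n Q"
  using down_closed_interp_test[of n Q] unfolding down_closed_def by metis

lemmas interp_App_iff = interp_App_raw[OF filter_interp]

lemma interp_LamI: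
  assumes "scoped (Suc n) M" "length as = n" "finite S" "arrows arr S \<le> \<delta>"
    "\<And>\<beta> \<gamma>. (\<beta>, \<gamma>) \<in> S \<Longrightarrow> (\<beta> # as, \<gamma>) \<in> sem (Suc n) M"
  shows "(as, \<delta>) \<in> sem n (Lam M)"
proof (rule interp_up[OF _ _ assms(4)])
  show "(as, arrows arr S) \<in> sem n (Lam M)" unfolding interp_Lam_raw using assms by blast
qed (use assms in simp)

end


section \<open>The interpretation grows along head expansion\<close>

lemma scoped_TSum [simp]: "scoped_test n (TSum A) \<longleftrightarrow> (\<forall>Q \<in># A. scoped_test n Q)"
  by auto

lemma scoped_TProd [simp]: "scoped_test n (TProd A) \<longleftrightarrow> (\<forall>Q \<in># A. scoped_test n Q)"
  by auto

declare scoped.simps(5) [simp del] scoped_test.simps(1,2) [simp del]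

lemma scoped_rename: "scoped m (M :: 'd tm) \<Longrightarrow> (\<And>i. i < m \<Longrightarrow> r i < n) \<Longrightarrow> scoped n (rename r M)"
  and scoped_rename_test: "scoped_test m (Q :: 'd test) \<Longrightarrow> (\<And>i. i < m \<Longrightarrow> r i < n) \<Longrightarrow> scoped_test n (rename_test r Q)"
proof (induction M and Q arbitrary: m n r and m n r)
  case (Lam M)
  have "scoped (Suc n) (rename (case_nat 0 (Suc \<circ> r)) M)"
    by (rule Lam.IH[of "Suc m"]) (use Lam.prems in \<open>auto split: nat.split\<close>)
  then show ?case by simp
qed (fastforce)+

lemma scoped_subst: "scoped m (M :: 'd tm) \<Longrightarrow> (\<And>i. i < m \<Longrightarrow> scoped n (s i)) \<Longrightarrow> scoped n (subst s M)"
  and scoped_subst_test: "scoped_test m (Q :: 'd test) \<Longrightarrow> (\<And>i. i < m \<Longrightarrow> scoped n (s i)) \<Longrightarrow> scoped_test n (subst_test s Q)"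
proof (induction M and Q arbitrary: m n s and m n s)
  case (Lam M)
  have "scoped (Suc n) (subst (case_nat (Var 0) (rename Suc \<circ> s)) M)"
    by (rule Lam.IH[of "Suc m"]) (use Lam.prems in \<open>auto split: nat.split intro!: scoped_rename[of n]\<close>)
  then show ?case by simp
qed (fastforce)+

lemma scoped_subst0: "scoped (Suc n) M \<Longrightarrow> scoped n N \<Longrightarrow> scoped n (subst0 N M)"
  unfolding subst0_def by (rule scoped_subst) (auto split: nat.split)

lemma scoped_tsum: "scoped_test n (tsum A) \<longleftrightarrow> (\<forall>Q \<in># A. scoped_test n Q)"
  by (rule tsum_all) (rule scoped_TSum)

lemma scoped_tprod: "scoped_test n (tprod A) \<longleftrightarrow> (\<forall>Q \<in># A. scoped_test n Q)"
  by (rule tprod_all) (rule scoped_TProd)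

lemma scoped_bar_eps [simp]: "scoped n (bar_eps \<alpha>)"
  by (auto simp: bar_eps_def bar_def)

lemma scoped_tau [simp]: "scoped n M \<Longrightarrow> scoped_test n (tau \<alpha> M)"
  by (auto simp: tau_def)

lemma mem_bar [simp]: "x \<in># bar \<gamma> Q \<longleftrightarrow> \<gamma> \<noteq> top \<and> x = (\<gamma>, Q)"
  by (simp add: bar_def)

lemma set_subseqs_subset: "ys \<in> set (subseqs xs) \<Longrightarrow> set ys \<subseteq> set xs"
  by (metis PowI imageI subseqs_powset Pow_iff)

lemma product_lists_mem: "Qs \<in> set (product_lists Qss) \<Longrightarrow> Q \<in> set Qs \<Longrightarrow> \<exists>Rs \<in> set Qss. Q \<in> set Rs"
proof -
  assume "Qs \<in> set (product_lists Qss)" "Q \<in> set Qs"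
  then obtain i where "i < length Qss" "Q = Qs ! i" "Qs ! i \<in> set (Qss ! i)"
    by (auto simp: product_lists_set list_all2_conv_all_nth in_set_conv_nth)
  then show ?thesis using nth_mem by blast
qed

lemma scoped_hred: "hred ext M M' \<Longrightarrow> scoped n M \<Longrightarrow> scoped n M'"
  and scoped_hred_test: "hred_test ext Q Q' \<Longrightarrow> scoped_test n Q \<Longrightarrow> scoped_test n Q'"
proof (induction arbitrary: n and n rule: hred_hred_test.inducts)
  case (tau_bar \<alpha> xs)
  have "scoped_test n Q" if "ys \<in> set (subseqs xs)" "(\<beta>, Q) \<in> set ys" for ys \<beta> Q
  proof -
    have "set ys \<subseteq> set xs" by (rule set_subseqs_subset[OF that(1)])
    then show ?thesis using that(2) tau_bar by fastforce
  qed
  then show ?case by (auto simp: scoped_tsum scoped_tprod)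
next
  case (distrib Qss)
  then show ?case using product_lists_mem by (fastforce simp: scoped_tsum scoped_tprod)
next
  case (bar_app A N)
  then show ?case by (fastforce simp: scoped_tprod split: prod.splits)
next
  case (ctx_plus A A' B)
  have "scoped n (BarSum A)" using ctx_plus.prems by auto
  then have "scoped n (BarSum A')" by (rule ctx_plus.IH)
  then show ?case using ctx_plus.prems by auto
qed (auto simp: scoped_subst0 scoped_tsum scoped_tprod)

lemma head_beta_hred: "head_beta M M' \<Longrightarrow> hred ext M M'"
  by (induction rule: head_beta.induct) (auto intro: hred_hred_test.intros)

lemma scoped_hreds: "(hred ext)\<^sup>*\<^sup>* M M' \<Longrightarrow> scoped n M \<Longrightarrow> scoped n M'"
  by (induction rule: rtranclp_induct) (auto intro: scoped_hred)

lemma scoped_hreds_test: "(hred_test ext)\<^sup>*\<^sup>* Q Q' \<Longrightarrow> scoped_test n Q \<Longrightarrow> scoped_test n Q'"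
  by (induction rule: rtranclp_induct) (auto intro: scoped_hred_test)

lemma list_all2_inf:
  fixes as bs :: "'d::semilattice_inf list"
  assumes "length as = length bs"
  shows "list_all2 (\<le>) (map2 inf as bs) as" "list_all2 (\<le>) (map2 inf as bs) bs"
  using assms by (auto simp: list_all2_conv_all_nth)

section \<open>Undoing renamings and substitutions in the interpretation\<close>

context DEFiM
begin

lemma interp_rename_inv:
  "(as, \<alpha>) \<in> sem n (rename r M) \<Longrightarrow> scoped m M \<Longrightarrow> length bs = m \<Longrightarrow>
     (\<And>i. i < m \<Longrightarrow> r i < n \<and> bs ! i \<le> as ! r i) \<Longrightarrow> (bs, \<alpha>) \<in> sem m M"
  "as \<in> sem_test n (rename_test r Q) \<Longrightarrow> scoped_test m Q \<Longrightarrow> length bs = m \<Longrightarrow>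
     (\<And>i. i < m \<Longrightarrow> r i < n \<and> bs ! i \<le> as ! r i) \<Longrightarrow> bs \<in> sem_test m Q"
proof (induction M and Q arbitrary: as \<alpha> bs n m r and as bs n m r)
  case (Var i)
  have "bs ! i \<le> as ! r i" using Var by simp
  also have "\<dots> \<le> \<alpha>" using Var.prems(1) by simp
  finally show ?case using Var by simp
next
  case (Lam M)
  from Lam.prems(1) obtain S where S: "length as = n" "finite S" "\<alpha> = arrows arr S"
    "\<And>\<beta> \<gamma>. (\<beta>, \<gamma>) \<in> S \<Longrightarrow> (\<beta> # as, \<gamma>) \<in> sem (Suc n) (rename (case_nat 0 (Suc \<circ> r)) M)"
    unfolding rename.simps interp_Lam_raw by blast
  show ?case
  proof (rule interp_LamI)
    fix \<beta> \<gamma> assume "(\<beta>, \<gamma>) \<in> S"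
    then show "(\<beta> # bs, \<gamma>) \<in> sem (Suc m) M"
      by (rule Lam.IH[OF S(4)]) (use Lam.prems in \<open>auto split: nat.split\<close>)
  qed (use Lam.prems S in auto)
next
  case (App M N)
  have "scoped n (rename r M)" using App.prems scoped_rename[of m M r n] by auto
  with App.prems obtain \<gamma> where "(as, arr \<gamma> \<alpha>) \<in> sem n (rename r M)" "(as, \<gamma>) \<in> sem n (rename r N)"
    by (auto simp: interp_App_iff simp del: interp.simps)
  then have "(bs, arr \<gamma> \<alpha>) \<in> sem m M" "(bs, \<gamma>) \<in> sem m N"
    using App.IH(1)[of as "arr \<gamma> \<alpha>" n r m bs] App.IH(2)[of as \<gamma> n r m bs] App.prems by auto
  then show ?case using App.prems by (auto simp: interp_App_iff simp del: interp.simps)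
next
  case (BarSum A)
  have fin: "finite (succs (\<lambda>Q. bs \<in> sem_test m Q) A)"
    by (rule finite_subset[of _ "fst ` set_mset A"]) force+
  have m: "bs \<in> sem_test m Q" if "(\<alpha>, Q) \<in># A" "as \<in> sem_test n (rename_test r Q)" for \<alpha> Q
    by (rule BarSum.IH[OF that(1) _ that(2)]) (use BarSum.prems that in auto)
  have "meet (succs (\<lambda>Q. bs \<in> sem_test m Q) A) \<le>
     meet (succs (\<lambda>Q. as \<in> sem_test n Q) (image_mset (map_prod id (rename_test r)) A))"
    by (rule meet_antimono[OF fin]) (use m in force)
  then show ?case using BarSum.prems unfolding rename.simps interp_Bar_iff using order_trans by blast
next
  case (TSum A)
  then obtain Q where Q: "Q \<in># A" "as \<in> sem_test n (rename_test r Q)"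
    by (auto simp: interp_TSum_iff simp del: interp_test.simps)
  have "bs \<in> sem_test m Q"
    by (rule TSum.IH[OF Q]) (use TSum.prems Q in auto)
  then show ?case using Q(1) interp_TSum_iff by blast
next
  case (TProd A)
  have "bs \<in> sem_test m Q" if Q: "Q \<in># A" for Q
    by (rule TProd.IH[OF Q, of as n r]) (use TProd.prems Q in \<open>auto simp: interp_TProd_iff simp del: interp_test.simps\<close>)
  then show ?case using TProd.prems(3) interp_TProd_iff by blast
qed auto

lemma interp_rename_Suc:
  assumes "(\<beta> # as, \<alpha>) \<in> sem (Suc n) (rename Suc M)" "scoped n M"
  shows "(as, \<alpha>) \<in> sem n M"
  by (rule interp_rename_inv(1)[OF assms]) (use interp_length[OF assms(1)] in auto)

definition env_for :: "nat \<Rightarrow> 'd list \<Rightarrow> (nat \<Rightarrow> 'd tm) \<Rightarrow> nat \<Rightarrow> 'd list \<Rightarrow> bool" where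
  "env_for n as s m bs \<longleftrightarrow> length bs = m \<and> (\<forall>i < m. (as, bs ! i) \<in> sem n (s i))"

text \<open>Finitely many environments for the same substitution are merged by their pointwise meet:
  the types of each \<open>s i\<close> form a filter, and \<open>P\<close> survives strengthening.
  This is needed wherever a term has several parts.\<close>

lemma env_for_common:
  assumes sc: "\<And>i. i < m \<Longrightarrow> scoped n (s i)" and l: "length as = n"
    and down: "\<And>x bs cs. P x bs \<Longrightarrow> list_all2 (\<le>) cs bs \<Longrightarrow> P x cs"
    and "finite F" "\<And>x. x \<in> F \<Longrightarrow> \<exists>bs. env_for n as s m bs \<and> P x bs"
  shows "\<exists>bs. env_for n as s m bs \<and> (\<forall>x \<in> F. P x bs)"
  using assms(4,5)
proof (induction F rule: finite_induct)
  case empty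
  have "env_for n as s m (replicate m top)" using sc l interp_top by (auto simp: env_for_def)
  then show ?case by blast
next
  case (insert x F)
  then obtain bs cs where bs: "env_for n as s m bs" "\<forall>x \<in> F. P x bs" and cs: "env_for n as s m cs" "P x cs"
    by (metis insertCI)
  have le: "list_all2 (\<le>) (map2 inf bs cs) bs" "list_all2 (\<le>) (map2 inf bs cs) cs"
    using list_all2_inf[of bs cs] bs(1) cs(1) by (auto simp: env_for_def)
  have "env_for n as s m (map2 inf bs cs)"
    using bs(1) cs(1) interp_inf[OF sc] by (auto simp: env_for_def)
  moreover have "P y (map2 inf bs cs)" if "y \<in> insert x F" for y
    using that down[OF cs(2) le(2)] down[OF bspec[OF bs(2)] le(1)] by blast
  ultimately show ?case by blast
qed

text \<open>Each occurrence of a variable may use its own type of the substituted term; the meet of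
  these finitely many types is again a type of that term and serves all occurrences at once.\<close>

lemma interp_subst_inv:
  "(as, \<alpha>) \<in> sem n (subst s M) \<Longrightarrow> scoped m M \<Longrightarrow> (\<And>i. i < m \<Longrightarrow> scoped n (s i)) \<Longrightarrow>
     \<exists>bs. env_for n as s m bs \<and> (bs, \<alpha>) \<in> sem m M"
  "as \<in> sem_test n (subst_test s Q) \<Longrightarrow> scoped_test m Q \<Longrightarrow> (\<And>i. i < m \<Longrightarrow> scoped n (s i)) \<Longrightarrow>
     \<exists>bs. env_for n as s m bs \<and> bs \<in> sem_test m Q"
proof (induction M and Q arbitrary: as \<alpha> n m s and as n m s)
  case (Var i)
  have "length as = n" using Var.prems(1) interp_length by blast
  then have "env_for n as s m ((replicate m top)[i := \<alpha>])"
    using Var interp_top by (auto simp: env_for_def nth_list_update)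
  then show ?case using Var.prems(2) by (intro exI[of _ "(replicate m top)[i := \<alpha>]"]) auto
next
  case (Lam M)
  let ?s = "case_nat (Var 0) (rename Suc \<circ> s)"
  from Lam.prems(1) obtain S where S: "length as = n" "finite S" "\<alpha> = arrows arr S"
    "\<And>\<beta> \<gamma>. (\<beta>, \<gamma>) \<in> S \<Longrightarrow> (\<beta> # as, \<gamma>) \<in> sem (Suc n) (subst ?s M)"
    unfolding subst.simps interp_Lam_raw by blast
  have scM: "scoped (Suc m) M" using Lam.prems by simp
  have "\<exists>bs. env_for n as s m bs \<and> (\<forall>x \<in> S. case x of (\<beta>, \<gamma>) \<Rightarrow> (\<beta> # bs, \<gamma>) \<in> sem (Suc m) M)"
  proof (rule env_for_common)
    fix x :: "'d \<times> 'd" and bs cs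
    assume "case x of (\<beta>, \<gamma>) \<Rightarrow> (\<beta> # bs, \<gamma>) \<in> sem (Suc m) M" "list_all2 (\<le>) cs bs"
    then show "case x of (\<beta>, \<gamma>) \<Rightarrow> (\<beta> # cs, \<gamma>) \<in> sem (Suc m) M"
      using interp_mono[OF scM] by (auto split: prod.splits)
  next
    fix x assume "x \<in> S"
    moreover obtain \<beta> \<gamma> where x: "x = (\<beta>, \<gamma>)" by force
    ultimately have a: "(\<beta> # as, \<gamma>) \<in> sem (Suc n) (subst ?s M)" using S(4) by blast
    have "\<exists>bs. env_for (Suc n) (\<beta> # as) ?s (Suc m) bs \<and> (bs, \<gamma>) \<in> sem (Suc m) M"
      by (rule Lam.IH[OF a]) (use Lam.prems in \<open>auto split: nat.split intro!: scoped_rename[of n]\<close>)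
    then obtain cs where cs: "env_for (Suc n) (\<beta> # as) ?s (Suc m) cs" "(cs, \<gamma>) \<in> sem (Suc m) M" by blast
    then obtain b bs where "cs = b # bs" by (cases cs) (auto simp: env_for_def)
    note bs = cs[unfolded this]
    have "env_for n as s m bs"
      unfolding env_for_def
    proof (intro conjI allI impI)
      fix i assume "i < m"
      then have "(\<beta> # as, (b # bs) ! Suc i) \<in> sem (Suc n) (?s (Suc i))"
        using bs(1)[unfolded env_for_def, THEN conjunct2, rule_format, of "Suc i"] by simp
      then show "(as, bs ! i) \<in> sem n (s i)"
        using interp_rename_Suc Lam.prems(3) \<open>i < m\<close> by simp
    qed (use bs(1) in \<open>simp add: env_for_def\<close>)
    \<comment> \<open>The entry for the bound variable is a type of \<open>Var 0\<close> assumed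
      with \<beta>, hence above \<beta>, and may be lowered to \<beta> so that the arrow of
      \<open>S\<close> is met exactly.\<close>
    moreover have "\<beta> \<le> b" using bs(1) unfolding env_for_def by (force dest: spec[of _ 0])
    then have "(\<beta> # bs, \<gamma>) \<in> sem (Suc m) M"
      using interp_mono[OF scM bs(2), of "\<beta> # bs" \<gamma>] by (simp add: list_all2_le_refl)
    ultimately show "\<exists>bs. env_for n as s m bs \<and> (case x of (\<beta>, \<gamma>) \<Rightarrow> (\<beta> # bs, \<gamma>) \<in> sem (Suc m) M)"
      using x by blast
  qed (use Lam.prems S in auto)
  then obtain bs where bs: "env_for n as s m bs" "\<And>\<beta> \<gamma>. (\<beta>, \<gamma>) \<in> S \<Longrightarrow> (\<beta> # bs, \<gamma>) \<in> sem (Suc m) M"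
    by blast
  have "(bs, \<alpha>) \<in> sem m (Lam M)"
    by (rule interp_LamI[OF scM _ S(2) _ bs(2)]) (use bs(1) S(3) in \<open>auto simp: env_for_def\<close>)
  then show ?case using bs(1) by blast
next
  case (App M N)
  have "scoped n (subst s M)" using App.prems scoped_subst[of m M n s] by auto
  with App.prems obtain \<gamma> where \<gamma>: "(as, arr \<gamma> \<alpha>) \<in> sem n (subst s M)" "(as, \<gamma>) \<in> sem n (subst s N)"
    and l: "length as = n"
    by (auto simp: interp_App_iff simp del: interp.simps)
  have sc: "scoped m M" "scoped m N" using App.prems by auto
  let ?P = "\<lambda>x bs. if x then (bs, arr \<gamma> \<alpha>) \<in> sem m M else (bs, \<gamma>) \<in> sem m N"
  have "\<exists>bs. env_for n as s m bs \<and> (\<forall>x \<in> {True, False}. ?P x bs)"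
  proof (rule env_for_common)
    fix x bs cs assume "?P x bs" "list_all2 (\<le>) cs bs"
    then show "?P x cs" using interp_mono[OF sc(1)] interp_mono[OF sc(2)] by (cases x) auto
  next
    fix x show "\<exists>bs. env_for n as s m bs \<and> ?P x bs"
      using App.IH(1)[OF \<gamma>(1) sc(1) App.prems(3)] App.IH(2)[OF \<gamma>(2) sc(2) App.prems(3)] by (cases x) auto
  qed (use App.prems l in auto)
  then obtain bs where bs: "env_for n as s m bs" "(bs, arr \<gamma> \<alpha>) \<in> sem m M" "(bs, \<gamma>) \<in> sem m N"
    by auto
  moreover have "length bs = m" using bs(1) by (simp add: env_for_def)
  ultimately show ?case using interp_App_iff[OF sc(1)] by blast
next
  case Omega
  then show ?case using env_for_common[of m n s as "\<lambda>_ _. True" "{}"] by (auto simp: env_for_def)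
next
  case (BarSum A)
  have sc: "scoped_test m Q" if "(\<alpha>, Q) \<in># A" for \<alpha> Q using BarSum.prems that by auto
  have l: "length as = n" using BarSum.prems(1) interp_length by blast
  let ?F = "{(\<alpha>, Q) \<in> set_mset A. as \<in> sem_test n (subst_test s Q)}"
  \<comment> \<open>Membership in \<open>A\<close> is part of the predicate because its downward
    closure is required for arbitrary \<open>x\<close>, while scoping is known only for summands of
    \<open>A\<close>.\<close>
  have "\<exists>bs. env_for n as s m bs \<and> (\<forall>x \<in> ?F. x \<in># A \<and> bs \<in> sem_test m (snd x))"
  proof (rule env_for_common)
    fix x bs cs assume "x \<in># A \<and> bs \<in> sem_test m (snd x)" "list_all2 (\<le>) cs bs"
    then show "x \<in># A \<and> cs \<in> sem_test m (snd x)"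
      using interp_test_mono[OF sc[of "fst x" "snd x"], of bs cs] by simp
  next
    fix x assume "x \<in> ?F"
    then obtain \<beta> Q where x: "x = (\<beta>, Q)" "(\<beta>, Q) \<in># A" "as \<in> sem_test n (subst_test s Q)" by blast
    have "\<exists>bs. env_for n as s m bs \<and> bs \<in> sem_test m Q"
      by (rule BarSum.IH[OF x(2) _ x(3)]) (use BarSum.prems sc x in auto)
    then show "\<exists>bs. env_for n as s m bs \<and> (x \<in># A \<and> bs \<in> sem_test m (snd x))" using x by auto
  next
    show "finite ?F" by (rule finite_filter_pairs) simp
  qed (use BarSum.prems l in auto)
  then obtain bs where bs: "env_for n as s m bs" "\<forall>x \<in> ?F. bs \<in> sem_test m (snd x)" by blast
  have bsQ: "bs \<in> sem_test m Q" if "(\<alpha>, Q) \<in># A" "as \<in> sem_test n (subst_test s Q)" for \<alpha> Q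
    using bs(2) that by force
  have fin: "finite (succs (\<lambda>Q. bs \<in> sem_test m Q) A)"
    by (rule finite_subset[of _ "fst ` set_mset A"]) force+
  have "meet (succs (\<lambda>Q. bs \<in> sem_test m Q) A) \<le>
     meet (succs (\<lambda>Q. as \<in> sem_test n Q) (image_mset (map_prod id (subst_test s)) A))"
    by (rule meet_antimono[OF fin]) (use bsQ in force)
  then have "(bs, \<alpha>) \<in> sem m (BarSum A)"
    using BarSum.prems(1) bs(1) order_trans unfolding subst.simps interp_Bar_iff env_for_def by blast
  then show ?case using bs(1) by blast
next
  case (TSum A)
  then obtain Q where Q: "Q \<in># A" "as \<in> sem_test n (subst_test s Q)"
    by (auto simp: interp_TSum_iff simp del: interp_test.simps)
  have "\<exists>bs. env_for n as s m bs \<and> bs \<in> sem_test m Q"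
    by (rule TSum.IH[OF Q]) (use TSum.prems Q in auto)
  then show ?case using Q(1) interp_TSum_iff by blast
next
  case (TProd A)
  have sc: "scoped_test m Q" if "Q \<in># A" for Q using TProd.prems that by auto
  have l: "length as = n" using TProd.prems(1) interp_test_length by blast
  have "\<exists>bs. env_for n as s m bs \<and> (\<forall>Q \<in> set_mset A. Q \<in># A \<and> bs \<in> sem_test m Q)"
  proof (rule env_for_common)
    fix Q bs cs assume "Q \<in># A \<and> bs \<in> sem_test m Q" "list_all2 (\<le>) cs bs"
    then show "Q \<in># A \<and> cs \<in> sem_test m Q" using interp_test_mono[OF sc[of Q], of bs cs] by simp
  next
    fix Q assume Q: "Q \<in># A"
    have "\<exists>bs. env_for n as s m bs \<and> bs \<in> sem_test m Q"
      by (rule TProd.IH[OF Q]) (use TProd.prems sc Q in \<open>auto simp: interp_TProd_iff simp del: interp_test.simps\<close>)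
    then show "\<exists>bs. env_for n as s m bs \<and> (Q \<in># A \<and> bs \<in> sem_test m Q)" using Q by blast
  qed (use TProd.prems l in auto)
  then show ?case unfolding interp_TProd_iff env_for_def by blast
next
  case (Tau \<alpha> M)
  have "(as, \<alpha>) \<in> sem n (subst s M)" "scoped m M" using Tau.prems(1,2) by simp_all
  from Tau.IH[OF this Tau.prems(3)] show ?case by simp
qed

text \<open>With \<open>U\<close> the types of the successful summands and \<open>V\<close> saying
  that the argument has a given type, the resulting arrow is the one by which a sum is applied to
  that argument.\<close>

lemma ext_arrows_meet:
  fixes V :: "'d \<Rightarrow> bool"
  assumes "finite U"
  defines "T \<equiv> {(\<beta>, \<gamma>). \<exists>\<alpha> \<in> U. (\<beta>, \<gamma>) \<in> ext \<alpha> \<and> V \<beta>}"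
  shows "finite T" "meet U \<le> arr (meet (fst ` T)) (meet (snd ` T))"
proof -
  show fin: "finite T"
    by (rule finite_subset[of _ "\<Union>\<alpha> \<in> U. ext \<alpha>"]) (use assms finite_ext in \<open>auto simp: T_def\<close>)
  have "meet U \<le> arrows arr T"
    unfolding le_arrows_iff[OF fin]
  proof (clarsimp simp: T_def)
    fix \<beta> \<gamma> \<alpha> assume "\<alpha> \<in> U" "(\<beta>, \<gamma>) \<in> ext \<alpha>"
    then show "meet U \<le> arr \<beta> \<gamma>" using meet_lower[OF assms(1)] ext_lower order_trans by metis
  qed
  also note arrows_le_arr_meet[OF fin]
  finally show "meet U \<le> arr (meet (fst ` T)) (meet (snd ` T))" .
qed

text \<open>The converse use of the decompositions: if a sum has an arrow type, the targets that
  \<open>bar_app\<close> produces from sources above \<gamma> already reach \<delta>.\<close>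

lemma meet_le_arr_ext:
  assumes "finite U" "meet U \<le> arr \<gamma> \<delta>"
  shows "finite {\<gamma>'. \<exists>\<alpha> \<in> U. \<exists>\<beta>'. (\<beta>', \<gamma>') \<in> ext \<alpha> \<and> \<gamma> \<le> \<beta>'}"
    "meet {\<gamma>'. \<exists>\<alpha> \<in> U. \<exists>\<beta>'. (\<beta>', \<gamma>') \<in> ext \<alpha> \<and> \<gamma> \<le> \<beta>'} \<le> \<delta>"
proof -
  let ?T = "\<Union>\<alpha> \<in> U. ext \<alpha>"
  have fin: "finite ?T" using assms finite_ext by auto
  have "arrows arr ?T \<le> \<alpha>" if "\<alpha> \<in> U" for \<alpha>
    by (rule le_ext) (use that arrows_lower[OF fin] in blast)
  then have "arrows arr ?T \<le> meet U" using le_meet_iff[OF assms(1)] by blast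
  then have "arrows arr ?T \<le> arr \<gamma> \<delta>" using assms(2) by (rule order_trans)
  moreover have "snd ` {(\<alpha>, \<beta>) \<in> ?T. \<gamma> \<le> \<alpha>} = {\<gamma>'. \<exists>\<alpha> \<in> U. \<exists>\<beta>'. (\<beta>', \<gamma>') \<in> ext \<alpha> \<and> \<gamma> \<le> \<beta>'}" by force
  ultimately show "meet {\<gamma>'. \<exists>\<alpha> \<in> U. \<exists>\<beta>'. (\<beta>', \<gamma>') \<in> ext \<alpha> \<and> \<gamma> \<le> \<beta>'} \<le> \<delta>"
    "finite {\<gamma>'. \<exists>\<alpha> \<in> U. \<exists>\<beta>'. (\<beta>', \<gamma>') \<in> ext \<alpha> \<and> \<gamma> \<le> \<beta>'}"
    using arr_ge_iff[OF fin, of \<gamma> \<delta>] finite_imageI[OF finite_filter_pairs[OF fin, of "\<lambda>a b. \<gamma> \<le> a"], of snd] by auto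
qed

lemma interp_subst0_inv:
  assumes "(as, \<alpha>) \<in> sem n (subst0 N M)" "scoped (Suc n) M" "scoped n N"
  shows "\<exists>\<beta>. (as, \<beta>) \<in> sem n N \<and> (\<beta> # as, \<alpha>) \<in> sem (Suc n) M"
proof -
  have "\<exists>bs. env_for n as (case_nat N Var) (Suc n) bs \<and> (bs, \<alpha>) \<in> sem (Suc n) M"
    by (rule interp_subst_inv(1)) (use assms in \<open>auto simp: subst0_def split: nat.split\<close>)
  then obtain cs where cs: "env_for n as (case_nat N Var) (Suc n) cs" "(cs, \<alpha>) \<in> sem (Suc n) M" by blast
  then obtain b bs where "cs = b # bs" by (cases cs) (auto simp: env_for_def)
  note bs = cs[unfolded this]
  note nth = bs(1)[unfolded env_for_def, THEN conjunct2, rule_format]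
  have "(as, b) \<in> sem n N" using nth[of 0] by simp
  moreover have "as ! i \<le> bs ! i" if "i < n" for i
    using nth[of "Suc i"] that by simp
  then have "list_all2 (\<le>) (b # as) (b # bs)"
    using bs(1) interp_length[OF assms(1)] by (auto simp: env_for_def list_all2_conv_all_nth less_Suc_eq_0_disj)
  then have "(b # as, \<alpha>) \<in> sem (Suc n) M" using interp_mono[OF assms(2) bs(2)] by blast
  ultimately show ?thesis by blast
qed

lemma interp_BarI:
  assumes "length as = n" "meet B \<le> \<gamma>" "\<And>\<alpha>. \<alpha> \<in> B \<Longrightarrow> \<exists>Q. (\<alpha>, Q) \<in># A \<and> as \<in> sem_test n Q"
  shows "(as, \<gamma>) \<in> sem n (BarSum A)"
proof -
  have "B \<subseteq> succs (\<lambda>Q. as \<in> sem_test n Q) A" using assms(3) by blast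
  from order_trans[OF meet_antimono[OF finite_succ this] assms(2)] assms(1)
  show ?thesis unfolding interp_Bar_iff by blast
qed

text \<open>Expansion is the direction needed for soundness of cut-free typing, because
  \<open>Tm_red\<close> passes from the contractum to the redex.\<close>

lemma interp_head_beta:
  "head_beta M M' \<Longrightarrow> scoped n M \<Longrightarrow> (as, \<alpha>) \<in> sem n M' \<Longrightarrow> (as, \<alpha>) \<in> sem n M"
proof (induction arbitrary: n as \<alpha> rule: head_beta.induct)
  case (1 M N)
  then obtain \<beta> where "(as, \<beta>) \<in> sem n N" "(\<beta> # as, \<alpha>) \<in> sem (Suc n) M"
    using interp_subst0_inv[of as \<alpha> n N M] by auto
  moreover from this have "(as, arr \<beta> \<alpha>) \<in> sem n (Lam M)"
    by (intro interp_LamI[where S = "{(\<beta>, \<alpha>)}"]) (use 1 interp_length in auto)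
  ultimately show ?case using 1 interp_length by (auto simp: interp_App_iff simp del: interp.simps)
next
  case (2 M M')
  have sc: "scoped (Suc n) M" using 2 by simp
  from 2(4) obtain S where S: "length as = n" "finite S" "\<alpha> = arrows arr S"
    "\<And>\<beta> \<gamma>. (\<beta>, \<gamma>) \<in> S \<Longrightarrow> (\<beta> # as, \<gamma>) \<in> sem (Suc n) M'"
    unfolding interp_Lam_raw by blast
  show ?case by (rule interp_LamI[OF sc S(1,2)]) (use S 2(2)[OF sc] in auto)
next
  case (3 M M' N)
  have sc: "scoped n M" "scoped n M'" using 3 scoped_hred[OF head_beta_hred[OF 3(1), of ext]] by auto
  show ?case using 3(5) 3(3)[OF sc(1)] unfolding interp_App_iff[OF sc(1)] interp_App_iff[OF sc(2)] by blast
qed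

end


section \<open>A cut-free type assignment\<close>

abbreviation up_ren :: "(nat \<Rightarrow> nat) \<Rightarrow> nat \<Rightarrow> nat" where
  "up_ren r \<equiv> case_nat 0 (Suc \<circ> r)"

abbreviation up_sub :: "(nat \<Rightarrow> 'd tm) \<Rightarrow> nat \<Rightarrow> 'd tm" where
  "up_sub s \<equiv> case_nat (Var 0) (rename Suc \<circ> s)"

lemma rename_rename:
  "rename r (rename q M) = rename (r \<circ> q) (M :: 'd tm)"
  "rename_test r (rename_test q Q) = rename_test (r \<circ> q) (Q :: 'd test)"
proof (induction M and Q arbitrary: r q and r q)
  case (Lam M)
  have "up_ren r \<circ> up_ren q = up_ren (r \<circ> q)" by (auto simp: fun_eq_iff split: nat.split)
  then show ?case by (simp only: rename.simps subst.simps Lam.IH)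
qed (auto simp: multiset.map_comp intro!: image_mset_cong)

lemma subst_rename:
  "subst s (rename r M) = subst (s \<circ> r) (M :: 'd tm)"
  "subst_test s (rename_test r Q) = subst_test (s \<circ> r) (Q :: 'd test)"
proof (induction M and Q arbitrary: r s and r s)
  case (Lam M)
  have "up_sub s \<circ> up_ren r = up_sub (s \<circ> r)" by (auto simp: fun_eq_iff split: nat.split)
  then show ?case by (simp only: rename.simps subst.simps Lam.IH)
qed (auto simp: multiset.map_comp intro!: image_mset_cong)

lemma rename_subst:
  "rename r (subst s M) = subst (rename r \<circ> s) (M :: 'd tm)"
  "rename_test r (subst_test s Q) = subst_test (rename r \<circ> s) (Q :: 'd test)"
proof (induction M and Q arbitrary: r s and r s)
  case (Lam M)
  have "rename (up_ren r) \<circ> up_sub s = up_sub (rename r \<circ> s)"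
    by (auto simp: fun_eq_iff rename_rename comp_def split: nat.split)
  then show ?case by (simp only: rename.simps subst.simps Lam.IH)
qed (auto simp: multiset.map_comp intro!: image_mset_cong)

lemma subst_subst:
  "subst t (subst s M) = subst (subst t \<circ> s) (M :: 'd tm)"
  "subst_test t (subst_test s Q) = subst_test (subst t \<circ> s) (Q :: 'd test)"
proof (induction M and Q arbitrary: t s and t s)
  case (Lam M)
  have "subst (up_sub t) \<circ> up_sub s = up_sub (subst t \<circ> s)"
    by (auto simp: fun_eq_iff rename_subst subst_rename comp_def split: nat.split)
  then show ?case by (simp only: rename.simps subst.simps Lam.IH)
qed (auto simp: multiset.map_comp intro!: image_mset_cong)

lemma subst_Var:
  "subst Var M = (M :: 'd tm)"
  "subst_test Var Q = (Q :: 'd test)"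
proof (induction M and Q)
  case (Lam M)
  have "up_sub Var = (Var :: nat \<Rightarrow> 'd tm)" by (auto simp: fun_eq_iff split: nat.split)
  then show ?case using Lam by simp
next
  case (BarSum A)
  have "map_prod id (subst_test Var) x = x" if "x \<in># A" for x
    using BarSum[of x] that by (cases x) auto
  then have "image_mset (map_prod id (subst_test Var)) A = image_mset id A" by (intro image_mset_cong) simp
  then show ?case by simp
next
  case (TSum A)
  then have "image_mset (subst_test Var) A = image_mset id A" by (intro image_mset_cong) simp
  then show ?case by simp
next
  case (TProd A)
  then have "image_mset (subst_test Var) A = image_mset id A" by (intro image_mset_cong) simp
  then show ?case by simp
qed auto

lemma subst0_up_sub: "subst0 N (subst (up_sub s) M) = subst (case_nat N s) M"
proof -
  have "subst (case_nat N Var) \<circ> up_sub s = case_nat N s"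
    by (auto simp: fun_eq_iff subst_rename comp_def subst_Var split: nat.split)
  then show ?thesis by (simp add: subst0_def subst_subst)
qed

lemma subst_subst0: "subst s (subst0 N M) = subst0 (subst s N) (subst (up_sub s) M)"
proof -
  have "subst s \<circ> case_nat N Var = case_nat (subst s N) s"
    by (auto simp: fun_eq_iff split: nat.split)
  then show ?thesis unfolding subst0_up_sub by (simp add: subst0_def subst_subst)
qed

lemma rename_bar_eps [simp]: "rename r (bar_eps \<beta>) = bar_eps \<beta>"
  by (simp add: bar_eps_def bar_def)

text \<open>A variable or a sum applied to arguments: no head \<beta>-step is possible, although an
  applied sum is still a redex of \<open>hred\<close>.\<close>

fun neutral :: "'d tm \<Rightarrow> bool" where
  "neutral (Var i) = True"
| "neutral (BarSum A) = True"
| "neutral (App M N) = neutral M"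
| "neutral _ = False"

inductive_cases head_beta_LamE: "head_beta (Lam M) M'"
inductive_cases head_beta_AppE: "head_beta (App M N) M'"

lemma neutral_not_head_beta: "neutral M \<Longrightarrow> \<not> head_beta M M'"
proof
  assume "head_beta M M'" "neutral M"
  then show False by (induction rule: head_beta.induct) simp_all
qed

text \<open>Because of this, two derivations that end in \<open>Tm_red\<close> type the same
  contractum and can be intersected.\<close>

lemma head_beta_det: "head_beta M M1 \<Longrightarrow> head_beta M M2 \<Longrightarrow> M1 = M2"
proof (induction arbitrary: M2 rule: head_beta.induct)
  case (1 M N)
  then show ?case by (rule head_beta_AppE) auto
next
  case (2 M M')
  from 2(3) show ?case 
  proof (rule head_beta_LamE)
    fix M''
    assume "M2 = Lam M''" "head_beta M M''"
    then show "Lam M' = M2" using 2(2)[of M''] by simp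
  qed
next
  case (3 M M' N)
  from 3(4) show ?case 
  proof (rule head_beta_AppE)
    fix M''
    assume "M2 = App M'' N" "head_beta M M''"
    then show "App M' N = M2" using 3(3)[of M''] by simp
  qed (use 3(2) in simp)
qed

context filter_model
begin

text \<open>The height bounds the nesting of abstractions in a derivation, with $\infty$ for no bound. Finite
  heights serve only in the convergence proof: head reduction decomposes $\alpha$ by \<open>ext \<alpha>\<close>
  instead of \<open>S\<close>, and the derivations of the parts of \<open>ext \<alpha>\<close> combine several
  subderivations, so that they are not smaller in any structural sense.\<close>

inductive Tm :: "enat \<Rightarrow> 'd list \<Rightarrow> 'd \<Rightarrow> 'd tm \<Rightarrow> bool"
  and Tn :: "enat \<Rightarrow> 'd list \<Rightarrow> 'd \<Rightarrow> 'd tm \<Rightarrow> bool"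
  and Tt :: "enat \<Rightarrow> 'd list \<Rightarrow> 'd test \<Rightarrow> bool" where
  Tm_top: "Tm h as top M"
| Tm_lam: "finite S \<Longrightarrow> arrows arr S \<le> \<alpha> \<Longrightarrow> (\<And>\<beta> \<gamma>. (\<beta>, \<gamma>) \<in> S \<Longrightarrow> Tm h (\<beta> # as) \<gamma> M) \<Longrightarrow> Tm (eSuc h) as \<alpha> (Lam M)"
| Tm_red: "head_beta M M' \<Longrightarrow> is_app M \<Longrightarrow> Tm h as \<alpha> M' \<Longrightarrow> Tm h as \<alpha> M"
| Tm_ne: "Tn h as \<alpha> M \<Longrightarrow> Tm h as \<alpha> M"
| Tn_var: "i < length as \<Longrightarrow> as ! i \<le> \<alpha> \<Longrightarrow> Tn h as \<alpha> (Var i)"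
| Tn_bar: "finite B \<Longrightarrow> B \<subseteq> set_mset A \<Longrightarrow> meet (fst ` B) \<le> \<alpha> \<Longrightarrow>
    (\<And>\<beta> Q. (\<beta>, Q) \<in> B \<Longrightarrow> Tt h as Q) \<Longrightarrow> Tn h as \<alpha> (BarSum A)"
| Tn_app: "Tn h as (arr \<gamma> \<delta>) M \<Longrightarrow> Tm h as \<gamma> N \<Longrightarrow> Tn h as \<delta> (App M N)"
| Tt_sum: "Q \<in># A \<Longrightarrow> Tt h as Q \<Longrightarrow> Tt h as (TSum A)"
| Tt_prod: "(\<And>Q. Q \<in># A \<Longrightarrow> Tt h as Q) \<Longrightarrow> Tt h as (TProd A)"
| Tt_tau: "Tm h as \<alpha> M \<Longrightarrow> Tt h as (Tau \<alpha> M)"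

inductive_cases Tn_VarE: "Tn h as \<alpha> (Var i)"
inductive_cases Tn_LamE: "Tn h as \<alpha> (Lam M)"
inductive_cases Tn_AppE: "Tn h as \<alpha> (App M N)"
inductive_cases Tn_BarE: "Tn h as \<alpha> (BarSum A)"
inductive_cases Tn_OmegaE: "Tn h as \<alpha> Omega"
inductive_cases Tt_SumE: "Tt h as (TSum A)"
inductive_cases Tt_ProdE: "Tt h as (TProd A)"
inductive_cases Tt_TauE: "Tt h as (Tau \<alpha> M)"

abbreviation cut_free :: "'d list \<Rightarrow> 'd \<Rightarrow> 'd tm \<Rightarrow> bool" where
  "cut_free \<equiv> Tm \<infinity>"

abbreviation cut_free_ne :: "'d list \<Rightarrow> 'd \<Rightarrow> 'd tm \<Rightarrow> bool" where
  "cut_free_ne \<equiv> Tn \<infinity>"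

abbreviation cut_free_test :: "'d list \<Rightarrow> 'd test \<Rightarrow> bool" where
  "cut_free_test \<equiv> Tt \<infinity>"

lemma Tn_neutral: "Tn h as \<alpha> M \<Longrightarrow> neutral M"
  by (induction M arbitrary: \<alpha> rule: neutral.induct)
    (auto elim: Tn_LamE Tn_AppE Tn_OmegaE)

lemma Tm_LamE:
  assumes "Tm (eSuc h) as \<alpha> (Lam M)"
  obtains S where "finite S" "arrows arr S \<le> \<alpha>" "\<And>\<beta> \<gamma>. (\<beta>, \<gamma>) \<in> S \<Longrightarrow> Tm h (\<beta> # as) \<gamma> M"
  using assms
proof (cases rule: Tm.cases)
  case Tm_top
  then show ?thesis using that[of "{}"] by simp
next
  case Tm_lam
  then show ?thesis using that by simp
next
  case Tm_ne
  then show ?thesis by (auto elim: Tn_LamE)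
qed auto

lemma Tm_Lam_infE:
  assumes "cut_free as \<alpha> (Lam M)"
  obtains S where "finite S" "arrows arr S \<le> \<alpha>" "\<And>\<beta> \<gamma>. (\<beta>, \<gamma>) \<in> S \<Longrightarrow> cut_free (\<beta> # as) \<gamma> M"
  using Tm_LamE[of \<infinity> as \<alpha> M] assms that by simp metis

lemmas Tm_Lam_infI = Tm_lam[where h = \<infinity>, simplified]

text \<open>The case of \<omega> stays separate: a variable outside the environment is neutral and
  has the type \<omega> by \<open>Tm_top\<close>, but \<open>Tn\<close> does not type it.\<close>

lemma Tm_neutral_iff:
  assumes "neutral M"
  shows "Tm h as \<alpha> M \<longleftrightarrow> \<alpha> = top \<or> Tn h as \<alpha> M"
proof
  assume "Tm h as \<alpha> M"
  then show "\<alpha> = top \<or> Tn h as \<alpha> M"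
    by (cases rule: Tm.cases) (use assms neutral_not_head_beta in auto)
qed (auto intro: Tm_top Tm_ne)

lemma Tn_bar_iff: "Tn h as \<gamma> (BarSum A) \<longleftrightarrow> meet (succs (Tt h as) A) \<le> \<gamma>"
proof
  assume "Tn h as \<gamma> (BarSum A)"
  then obtain B where B: "B \<subseteq> set_mset A" "meet (fst ` B) \<le> \<gamma>" "\<And>\<beta> Q. (\<beta>, Q) \<in> B \<Longrightarrow> Tt h as Q"
    by (rule Tn_BarE) blast
  have "fst ` B \<subseteq> succs (Tt h as) A" using B(1,3) by force
  from order_trans[OF meet_antimono[OF _ this] B(2)]
  show "meet (succs (Tt h as) A) \<le> \<gamma>" by (simp add: finite_succ)
next
  let ?B = "{(\<alpha>, Q) \<in> set_mset A. Tt h as Q}"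
  assume a: "meet (succs (Tt h as) A) \<le> \<gamma>"
  have "fst ` ?B = succs (Tt h as) A" by force
  with a show "Tn h as \<gamma> (BarSum A)"
    by (intro Tn_bar[of ?B]) (auto intro: finite_filter_pairs)
qed

lemma Tm_bar_iff: "Tm h as \<gamma> (BarSum A) \<longleftrightarrow> meet (succs (Tt h as) A) \<le> \<gamma>"
  by (auto simp: Tm_neutral_iff Tn_bar_iff)

lemma Tt_sum_iff: "Tt h as (TSum A) \<longleftrightarrow> (\<exists>Q \<in># A. Tt h as Q)"
  by (auto elim: Tt_SumE intro: Tt_sum)

lemma Tt_prod_iff: "Tt h as (TProd A) \<longleftrightarrow> (\<forall>Q \<in># A. Tt h as Q)"
  by (auto elim: Tt_ProdE intro: Tt_prod)

lemma Tt_tau_iff: "Tt h as (Tau \<alpha> M) \<longleftrightarrow> Tm h as \<alpha> M"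
  by (auto elim: Tt_TauE intro: Tt_tau)

lemma Tt_tau: "Tt h as (tau \<alpha> M) \<longleftrightarrow> Tm h as \<alpha> M"
  by (auto simp: tau_def Tt_tau_iff Tt_prod_iff Tm_top)

lemma Tt_tsum_iff: "Tt h as (tsum A) \<longleftrightarrow> (\<exists>Q \<in># A. Tt h as Q)"
  by (rule tsum_ex) (rule Tt_sum_iff)

lemma Tt_tprod_iff: "Tt h as (tprod A) \<longleftrightarrow> (\<forall>Q \<in># A. Tt h as Q)"
  by (rule tprod_all) (rule Tt_prod_iff)

lemma T_mono:
  "Tm h as \<alpha> M \<Longrightarrow> list_all2 (\<le>) bs as \<Longrightarrow> \<alpha> \<le> \<alpha>' \<Longrightarrow> Tm h bs \<alpha>' M"
  "Tn h as \<alpha> M \<Longrightarrow> list_all2 (\<le>) bs as \<Longrightarrow> \<alpha> \<le> \<alpha>' \<Longrightarrow> Tn h bs \<alpha>' M"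
  "Tt h as Q \<Longrightarrow> list_all2 (\<le>) bs as \<Longrightarrow> Tt h bs Q"
proof (induction arbitrary: bs \<alpha>' and bs \<alpha>' and bs rule: Tm_Tn_Tt.inducts)
  case (Tm_top h as M)
  then show ?case by (simp add: top_unique Tm_Tn_Tt.Tm_top)
next
  case (Tm_lam S \<alpha> h as M)
  show ?case by (rule Tm_Tn_Tt.Tm_lam[of S]) (use Tm_lam in \<open>auto intro: order_trans\<close>)
next
  case (Tn_var i as \<alpha> h)
  have "bs ! i \<le> as ! i" using Tn_var by (auto simp: list_all2_conv_all_nth)
  then show ?case using Tn_var by (auto intro!: Tm_Tn_Tt.Tn_var dest: list_all2_lengthD)
next
  case (Tn_bar B A \<alpha> h as)
  show ?case by (rule Tm_Tn_Tt.Tn_bar[of B]) (use Tn_bar in \<open>auto intro: order_trans\<close>)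
next
  case (Tn_app h as \<gamma> \<delta> M N)
  show ?case
    by (rule Tm_Tn_Tt.Tn_app[of _ _ \<gamma>, OF Tn_app.IH(2)[OF Tn_app.prems(1) arr_mono[OF order_refl Tn_app.prems(2)]]
          Tn_app.IH(4)[OF Tn_app.prems(1) order_refl]])
qed (blast intro: Tm_Tn_Tt.intros)+

lemmas Tm_up = T_mono(1)[OF _ list_all2_le_refl]
lemmas Tn_up = T_mono(2)[OF _ list_all2_le_refl]

lemma T_inf:
  "Tm h as \<alpha> M \<Longrightarrow> Tm h as \<beta> M \<Longrightarrow> Tm h as (inf \<alpha> \<beta>) M"
  "Tn h as \<alpha> M \<Longrightarrow> Tn h as \<beta> M \<Longrightarrow> Tn h as (inf \<alpha> \<beta>) M"
  "Tt h as Q \<Longrightarrow> True"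
proof (induction arbitrary: \<beta> and \<beta> and rule: Tm_Tn_Tt.inducts)
  case (Tm_lam S \<alpha> h as M)
  from Tm_lam.prems obtain T where T: "finite T" "arrows arr T \<le> \<beta>" "\<And>\<beta> \<gamma>. (\<beta>, \<gamma>) \<in> T \<Longrightarrow> Tm h (\<beta> # as) \<gamma> M"
    by (rule Tm_LamE) blast
  have "arrows arr (S \<union> T) \<le> inf \<alpha> \<beta>"
    unfolding arrows_Un[OF Tm_lam(1) T(1)] by (rule inf_mono[OF Tm_lam(2) T(2)])
  then show ?case by (rule Tm_Tn_Tt.Tm_lam[rotated]) (use Tm_lam T in auto)
next
  case (Tm_red M M' h as \<alpha>)
  have nn: "\<not> neutral M" using neutral_not_head_beta Tm_red.hyps(1) by blast
  from Tm_red.prems show ?case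
  proof (cases rule: Tm.cases)
    case Tm_top
    then show ?thesis using Tm_Tn_Tt.Tm_red[OF Tm_red.hyps(1,2) Tm_red.IH(1)] by simp
  next
    case (Tm_red M'')
    then have "Tm h as \<beta> M'" using head_beta_det Tm_red.hyps(1) by blast
    then show ?thesis using Tm_Tn_Tt.Tm_red[OF Tm_red.hyps(1,2) Tm_red.IH(2)] by blast
  qed (use Tm_red.hyps nn Tn_neutral in auto)
next
  case (Tm_ne h as \<alpha> M)
  have "\<beta> = top \<or> Tn h as \<beta> M" using Tm_neutral_iff[OF Tn_neutral] Tm_ne by blast
  then show ?case using Tm_ne.IH Tm_Tn_Tt.Tm_ne by auto
next
  case (Tn_var i as \<alpha> h)
  then show ?case by (auto elim!: Tn_VarE intro!: Tm_Tn_Tt.Tn_var)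
next
  case (Tn_bar B A \<alpha> h as)
  then have "Tn h as \<alpha> (BarSum A)" by (intro Tm_Tn_Tt.Tn_bar[of B]) auto
  then show ?case using Tn_bar.prems by (simp add: Tn_bar_iff)
next
  case (Tn_app h as \<gamma> \<delta> M N)
  from Tn_app.prems obtain \<gamma>' where b: "Tn h as (arr \<gamma>' \<beta>) M" "Tm h as \<gamma>' N" by (rule Tn_AppE)
  from Tn_app.IH(2)[OF b(1)] have "Tn h as (arr (inf \<gamma> \<gamma>') (inf \<delta> \<beta>)) M" by (rule Tn_up[OF _ arr_inf])
  from this Tn_app.IH(4)[OF b(2)] show ?case by (rule Tm_Tn_Tt.Tn_app)
qed auto

lemma Tm_meet: "finite A \<Longrightarrow> (\<And>a. a \<in> A \<Longrightarrow> Tm h as a M) \<Longrightarrow> Tm h as (meet A) M"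
  by (induction A rule: finite_induct) (auto intro: Tm_top T_inf(1))

text \<open>The arrow need not occur in the derivation. By the filter model axiom its target lies
  above the meet of those targets whose sources are above \<beta>, and the body has that meet as a
  type. The height still drops by one, although several subderivations are merged; the convergence
  proof rests on this.\<close>

lemma Tm_Lam_arr:
  assumes "Tm (eSuc h) as \<alpha> (Lam M)" "\<alpha> \<le> arr \<beta> \<gamma>"
  shows "Tm h (\<beta> # as) \<gamma> M"
proof -
  from assms(1) obtain S where S: "finite S" "arrows arr S \<le> \<alpha>" "\<And>\<beta> \<gamma>. (\<beta>, \<gamma>) \<in> S \<Longrightarrow> Tm h (\<beta> # as) \<gamma> M"
    by (rule Tm_LamE) blast
  have le: "meet (snd ` {(\<beta>', \<gamma>') \<in> S. \<beta> \<le> \<beta>'}) \<le> \<gamma>"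
    using arr_ge_iff[OF S(1), of \<beta> \<gamma>] order_trans[OF S(2) assms(2)] by blast
  have "Tm h (\<beta> # as) (meet (snd ` {(\<beta>', \<gamma>') \<in> S. \<beta> \<le> \<beta>'})) M"
  proof (rule Tm_meet)
    show "finite (snd ` {(\<beta>', \<gamma>') \<in> S. \<beta> \<le> \<beta>'})" using finite_filter_pairs[OF S(1)] by (rule finite_imageI)
    fix a assume "a \<in> snd ` {(\<beta>', \<gamma>') \<in> S. \<beta> \<le> \<beta>'}"
    then obtain \<beta>' where "(\<beta>', a) \<in> S" "\<beta> \<le> \<beta>'" by auto
    with T_mono(1)[OF S(3)[of \<beta>' a], of "\<beta> # as" a] show "Tm h (\<beta> # as) a M" by (simp add: list_all2_le_refl)
  qed
  then show ?thesis using le by (rule Tm_up)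
qed

text \<open>These are exactly the types that \<open>Tn_var\<close> gives to a variable assumed with
  \<beta>, so the constant and the assumption are interchangeable.\<close>

lemma Tn_bar_eps: "Tn h as \<gamma> (bar_eps \<beta>) \<longleftrightarrow> \<beta> \<le> \<gamma>"
proof -
  have "succs (Tt h as) (bar \<beta> (TProd {#})) = (if \<beta> = top then {} else {\<beta>})"
    by (auto simp: Tt_prod_iff)
  then show ?thesis unfolding bar_eps_def Tn_bar_iff by auto
qed

end

context DEFiM
begin

lemma T_sound:
  "Tm h as \<alpha> M \<Longrightarrow> scoped (length as) M \<Longrightarrow> (as, \<alpha>) \<in> sem (length as) M"
  "Tn h as \<alpha> M \<Longrightarrow> scoped (length as) M \<Longrightarrow> (as, \<alpha>) \<in> sem (length as) M"
  "Tt h as Q \<Longrightarrow> scoped_test (length as) Q \<Longrightarrow> as \<in> sem_test (length as) Q"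
proof (induction rule: Tm_Tn_Tt.inducts)
  case (Tm_top h as M)
  then show ?case using interp_top by blast
next
  case (Tm_lam S \<alpha> h as M)
  show ?case by (rule interp_LamI[OF _ _ Tm_lam(1,2)]) (use Tm_lam in auto)
next
  case (Tm_red M M' h as \<alpha>)
  have "scoped (length as) M'" by (rule scoped_hred[OF head_beta_hred[OF Tm_red.hyps(1)] Tm_red.prems])
  from interp_head_beta[OF Tm_red.hyps(1) Tm_red.prems Tm_red.IH(2)[OF this]] show ?case .
next
  case (Tn_bar B A \<alpha> h as)
  show ?case
    by (rule interp_BarI[OF refl Tn_bar.hyps(3)]) (use Tn_bar in force)
next
  case (Tn_app h as \<gamma> \<delta> M N)
  have sc: "scoped (length as) M" "scoped (length as) N" using Tn_app.prems by auto
  show ?case unfolding interp_App_iff[OF sc(1)] using Tn_app.IH(2)[OF sc(1)] Tn_app.IH(4)[OF sc(2)] by blast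
next
  case (Tt_sum Q A h as)
  then show ?case by auto
next
  case (Tt_prod A h as)
  then show ?case unfolding interp_TProd_iff by auto
qed auto

end


section \<open>Cut-free typing is closed under head expansion\<close>

text \<open>Such substitutions introduce neither abstractions nor applications, so head
  \<beta>-steps can be transported along them in both directions.\<close>

definition eps_renaming :: "(nat \<Rightarrow> 'd::order_top tm) \<Rightarrow> bool" where
  "eps_renaming s \<longleftrightarrow> (\<forall>i. (\<exists>j. s i = Var j) \<or> (\<exists>b. s i = bar_eps b))"

lemma eps_renaming_up: "eps_renaming s \<Longrightarrow> eps_renaming (up_sub s)"
  unfolding eps_renaming_def by (auto split: nat.split) (metis rename.simps(1) rename_bar_eps)

lemma eps_renaming_cases:
  assumes "eps_renaming s"
  obtains j where "s i = Var j" | b where "s i = bar_eps b"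
  using assms unfolding eps_renaming_def by blast

lemma subst_eq_Lam: "eps_renaming s \<Longrightarrow> subst s M = Lam P \<Longrightarrow> \<exists>P'. M = Lam P' \<and> P = subst (up_sub s) P'"
proof (cases M)
  case (Var i)
  assume "eps_renaming s" "subst s M = Lam P"
  then show ?thesis using Var by (cases rule: eps_renaming_cases[of s i]) (auto simp: bar_eps_def)
qed auto

lemma subst_eq_App: "eps_renaming s \<Longrightarrow> subst s M = App P N \<Longrightarrow> \<exists>P' N'. M = App P' N' \<and> P = subst s P' \<and> N = subst s N'"
proof (cases M)
  case (Var i)
  assume "eps_renaming s" "subst s M = App P N"
  then show ?thesis using Var by (cases rule: eps_renaming_cases[of s i]) (auto simp: bar_eps_def)
qed auto

lemma subst_eq_Var: "subst s M = Var j \<Longrightarrow> \<exists>i. M = Var i \<and> s i = Var j"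
  by (cases M) auto

lemma subst_eq_Bar: "eps_renaming s \<Longrightarrow> subst s M = BarSum A \<Longrightarrow>
    (\<exists>A'. M = BarSum A' \<and> A = image_mset (map_prod id (subst_test s)) A') \<or> (\<exists>i b. M = Var i \<and> s i = bar_eps b \<and> BarSum A = bar_eps b)"
proof (cases M)
  case (Var i)
  assume "eps_renaming s" "subst s M = BarSum A"
  then show ?thesis using Var
  proof (cases rule: eps_renaming_cases[of s i])
    case (2 b)
    then have "BarSum A = bar_eps b" using Var \<open>subst s M = BarSum A\<close> by simp
    then show ?thesis using 2 Var by blast
  qed (simp add: Var)
qed auto

lemma is_app_subst: "eps_renaming s \<Longrightarrow> is_app (subst s M) = is_app M"
proof (cases M)
  case (Var i)
  assume "eps_renaming s"
  then show ?thesis using Var by (cases rule: eps_renaming_cases[of s i]) (auto simp: bar_eps_def)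
qed auto

lemma head_beta_subst: "head_beta M M' \<Longrightarrow> eps_renaming s \<Longrightarrow> head_beta (subst s M) (subst s M')"
proof (induction arbitrary: s rule: head_beta.induct)
  case (1 M N)
  show ?case unfolding subst_subst0 by (auto intro: head_beta.intros)
next
  case (2 M M')
  then show ?case by (auto intro: head_beta.intros eps_renaming_up)
next
  case (3 M M' N)
  then show ?case using is_app_subst by (auto intro!: head_beta.intros)
qed

lemma head_beta_subst_inv:
  assumes "head_beta (subst s M) M'" "eps_renaming s"
  shows "\<exists>M0. head_beta M M0 \<and> M' = subst s M0"
proof -
  have "head_beta L M' \<Longrightarrow> L = subst s M \<Longrightarrow> eps_renaming s \<Longrightarrow> \<exists>M0. head_beta M M0 \<and> M' = subst s M0" for L
  proof (induction arbitrary: M s rule: head_beta.induct)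
    case (1 P N)
    from subst_eq_App[OF 1(2) 1(1)[symmetric]] obtain L N' where L: "M = App L N'" "Lam P = subst s L" "N = subst s N'" by blast
    from subst_eq_Lam[OF 1(2) L(2)[symmetric]] obtain P' where "L = Lam P'" "P = subst (up_sub s) P'" by blast
    with L show ?case by (auto simp: subst_subst0 intro!: exI[of _ "subst0 N' P'"] head_beta.intros)
  next
    case (2 P P')
    from subst_eq_Lam[OF 2(4) 2(3)[symmetric]] obtain L where L: "M = Lam L" "P = subst (up_sub s) L" by blast
    from 2(2)[OF L(2) eps_renaming_up[OF 2(4)]] obtain L' where "head_beta L L'" "P' = subst (up_sub s) L'" by blast
    with L show ?case by (intro exI[of _ "Lam L'"]) (auto intro: head_beta.intros)
  next
    case (3 P P' N)
    from subst_eq_App[OF 3(5) 3(4)[symmetric]] obtain L N' where L: "M = App L N'" "P = subst s L" "N = subst s N'" by blast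
    from 3(3)[OF L(2) 3(5)] obtain L' where "head_beta L L'" "P' = subst s L'" by blast
    moreover have "is_app L" using 3(2) L(2) is_app_subst[OF 3(5)] by simp
    ultimately show ?case using L by (intro exI[of _ "App L' N'"]) (auto intro: head_beta.intros)
  qed
  with assms show ?thesis by blast
qed

context filter_model
begin

text \<open>\<open>as\<close> types the substituted term and \<open>bs\<close> is to type the
  original one. A variable outside \<open>as\<close> imposes nothing, since no cut-free derivation
  can use it; a constant \<open>bar_eps b\<close> must be backed by an assumption below
  \<open>b\<close>.\<close>

definition eps_matching :: "'d list \<Rightarrow> 'd list \<Rightarrow> (nat \<Rightarrow> 'd tm) \<Rightarrow> bool" where
  "eps_matching as bs s \<longleftrightarrow> (\<forall>i. (\<exists>j. s i = Var j \<and> (j < length as \<longrightarrow> i < length bs \<and> bs ! i \<le> as ! j))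
     \<or> (\<exists>b. s i = bar_eps b \<and> i < length bs \<and> bs ! i \<le> b))"

lemma eps_matching_eps_renaming: "eps_matching as bs s \<Longrightarrow> eps_renaming s"
  unfolding eps_matching_def eps_renaming_def by blast

lemma eps_matching_up: "eps_matching as bs s \<Longrightarrow> eps_matching (\<beta> # as) (\<beta> # bs) (up_sub s)"
  unfolding eps_matching_def
proof
  fix i
  assume a: "\<forall>i. (\<exists>j. s i = Var j \<and> (j < length as \<longrightarrow> i < length bs \<and> bs ! i \<le> as ! j))
     \<or> (\<exists>b. s i = bar_eps b \<and> i < length bs \<and> bs ! i \<le> b)"
  show "(\<exists>j. up_sub s i = Var j \<and> (j < length (\<beta> # as) \<longrightarrow> i < length (\<beta> # bs) \<and> (\<beta> # bs) ! i \<le> (\<beta> # as) ! j))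
     \<or> (\<exists>b. up_sub s i = bar_eps b \<and> i < length (\<beta> # bs) \<and> (\<beta> # bs) ! i \<le> b)"
  proof (cases i)
    case (Suc k)
    then show ?thesis using spec[OF a, of k] by auto
  qed auto
qed

text \<open>The derivation is copied rule by rule, since the substitution hides no redex and no
  application. Only a leaf changes: where a constant \<open>bar_eps b\<close> that replaced a
  variable was typed by \<open>Tn_bar\<close>, the variable is typed by
  \<open>Tn_var\<close>.\<close>

lemma T_subst_inv:
  "Tm h as \<alpha> L \<Longrightarrow> L = subst s M \<Longrightarrow> eps_matching as bs s \<Longrightarrow> Tm h bs \<alpha> M"
  "Tn h as \<alpha> L \<Longrightarrow> L = subst s M \<Longrightarrow> eps_matching as bs s \<Longrightarrow> Tn h bs \<alpha> M"
  "Tt h as R \<Longrightarrow> R = subst_test s Q \<Longrightarrow> eps_matching as bs s \<Longrightarrow> Tt h bs Q"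
proof (induction arbitrary: s M bs and s M bs and s Q bs rule: Tm_Tn_Tt.inducts)
  case (Tm_top h as M)
  show ?case by (rule Tm_Tn_Tt.Tm_top)
next
  case (Tm_lam S \<alpha> h as P)
  from subst_eq_Lam[OF eps_matching_eps_renaming Tm_lam.prems(1)[symmetric]] Tm_lam.prems(2)
  obtain P' where P': "M = Lam P'" "P = subst (up_sub s) P'" by blast
  have "Tm h (\<beta> # bs) \<gamma> P'" if "(\<beta>, \<gamma>) \<in> S" for \<beta> \<gamma>
    by (rule Tm_lam(4)[OF that P'(2)]) (rule eps_matching_up[OF Tm_lam.prems(2)])
  then show ?case unfolding P' by (rule Tm_Tn_Tt.Tm_lam[OF Tm_lam(1,2)])
next
  case (Tm_red L L' h as \<alpha>)
  note v = eps_matching_eps_renaming[OF Tm_red.prems(2)]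
  obtain M' where M': "head_beta M M'" "L' = subst s M'"
    using head_beta_subst_inv[OF Tm_red.hyps(1)[unfolded Tm_red.prems(1)] v] by blast
  have "is_app M" using Tm_red.hyps(2) is_app_subst[OF v] Tm_red.prems(1) by simp
  from Tm_Tn_Tt.Tm_red[OF M'(1) this Tm_red.IH(2)[OF M'(2) Tm_red.prems(2)]] show ?case .
next
  case (Tm_ne h as \<alpha> L)
  show ?case by (rule Tm_Tn_Tt.Tm_ne[OF Tm_ne.IH(2)[OF Tm_ne.prems]])
next
  case (Tn_var j as \<alpha> h)
  from subst_eq_Var[OF Tn_var.prems(1)[symmetric]] obtain i where i: "M = Var i" "s i = Var j" by blast
  then have "i < length bs \<and> bs ! i \<le> as ! j"
    using spec[OF Tn_var.prems(2)[unfolded eps_matching_def], of i] Tn_var(1) by (auto simp: bar_eps_def)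
  then show ?case unfolding i using Tn_var(2) by (auto intro: Tm_Tn_Tt.Tn_var)
next
  case (Tn_bar B A \<alpha> h as)
  note v = eps_matching_eps_renaming[OF Tn_bar.prems(2)]
  have le: "meet (succs (Tt h as) A) \<le> \<alpha>"
    using Tm_Tn_Tt.Tn_bar[of B A \<alpha> h as] Tn_bar(1-4) unfolding Tn_bar_iff by blast
  from subst_eq_Bar[OF v Tn_bar.prems(1)[symmetric]] show ?case
  proof (elim disjE exE conjE)
    fix A' assume A': "M = BarSum A'" "A = image_mset (map_prod id (subst_test s)) A'"
    have "\<beta> \<in> succs (Tt h bs) A'" if b: "\<beta> \<in> fst ` B" for \<beta>
    proof -
      from b obtain R where R: "(\<beta>, R) \<in> B" by auto
      then have "(\<beta>, R) \<in># A" using Tn_bar(2) by blast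
      then obtain Q where Q: "(\<beta>, Q) \<in># A'" "R = subst_test s Q" unfolding A' by auto
      from Tn_bar(5)[OF R Q(2) Tn_bar.prems(2)] Q(1) show ?thesis by blast
    qed
    then have "fst ` B \<subseteq> succs (Tt h bs) A'" by blast
    from order_trans[OF meet_antimono[OF finite_succ this] Tn_bar(3)]
    show ?case unfolding A' Tn_bar_iff .
  next
    fix i b assume i: "M = Var i" "s i = bar_eps b" "BarSum A = bar_eps b"
    have "Tn h as \<alpha> (BarSum A)" unfolding Tn_bar_iff by (rule le)
    then have "b \<le> \<alpha>" unfolding i(3) Tn_bar_eps .
    moreover have "i < length bs \<and> bs ! i \<le> b"
      using spec[OF Tn_bar.prems(2)[unfolded eps_matching_def], of i] i(2) by (auto simp: bar_eps_def bar_def split: if_splits)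
    ultimately show ?case unfolding i by (auto intro: Tm_Tn_Tt.Tn_var)
  qed
next
  case (Tn_app h as \<gamma> \<delta> P N)
  from subst_eq_App[OF eps_matching_eps_renaming Tn_app.prems(1)[symmetric]] Tn_app.prems(2)
  obtain P' N' where M: "M = App P' N'" "P = subst s P'" "N = subst s N'" by blast
  show ?case unfolding M(1)
    by (rule Tm_Tn_Tt.Tn_app[OF Tn_app.IH(2)[OF M(2) Tn_app.prems(2)] Tn_app.IH(4)[OF M(3) Tn_app.prems(2)]])
next
  case (Tt_sum R A h as)
  then obtain A' where A': "Q = TSum A'" "A = image_mset (subst_test s) A'" by (cases Q) auto
  then obtain Q' where Q': "Q' \<in># A'" "R = subst_test s Q'" using Tt_sum(1) by auto
  show ?case unfolding A'(1) by (rule Tm_Tn_Tt.Tt_sum[OF Q'(1) Tt_sum.IH(2)[OF Q'(2) Tt_sum.prems(2)]])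
next
  case (Tt_prod A h as)
  then obtain A' where A': "Q = TProd A'" "A = image_mset (subst_test s) A'" by (cases Q) auto
  have "Tt h bs Q'" if Q': "Q' \<in># A'" for Q'
    by (rule Tt_prod.IH(2)[OF _ refl Tt_prod.prems(2)]) (use A'(2) Q' in simp)
  then show ?case unfolding A'(1) by (rule Tm_Tn_Tt.Tt_prod)
next
  case (Tt_tau h as \<alpha> L)
  then obtain M where M: "Q = Tau \<alpha> M" "L = subst s M" by (cases Q) auto
  show ?case unfolding M(1) by (rule Tm_Tn_Tt.Tt_tau[OF Tt_tau.IH(2)[OF M(2) Tt_tau.prems(2)]])
qed

lemma Tm_subst0_bar_eps:
  assumes "Tm h as \<gamma> (subst0 (bar_eps \<beta>) M)"
  shows "Tm h (\<beta> # as) \<gamma> M"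
proof (rule T_subst_inv(1)[OF assms])
  show "subst0 (bar_eps \<beta>) M = subst (case_nat (bar_eps \<beta>) Var) M" by (simp add: subst0_def)
  show "eps_matching as (\<beta> # as) (case_nat (bar_eps \<beta>) Var)"
    unfolding eps_matching_def by (auto split: nat.split)
qed

end

context DEFiM
begin

text \<open>A summand of the reduct succeeds only if it comes from an arrow of a successful summand
  of \<open>A\<close> whose source is a type of \<open>N\<close>. All these arrows together form one
  arrow, and its source is a type of \<open>N\<close> by closure under meets.\<close>

lemma Tn_bar_app:
  assumes "cut_free_ne as \<delta> (BarSum (\<Sum>(\<alpha>, Q)\<in>#A. \<Sum>(\<beta>, \<gamma>)\<in>#mset_set (ext \<alpha>). bar \<gamma> (tprod {#Q, tau \<beta> N#})))"
    (is "cut_free_ne as \<delta> (BarSum ?X)")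
  shows "cut_free_ne as \<delta> (App (BarSum A) N)"
proof -
  let ?U = "succs (cut_free_test as) A"
  let ?T = "{(\<beta>, \<gamma>). \<exists>\<alpha> \<in> ?U. (\<beta>, \<gamma>) \<in> ext \<alpha> \<and> cut_free as \<beta> N}"
  note T = ext_arrows_meet[of ?U "\<lambda>\<beta>. cut_free as \<beta> N", OF finite_succ]
  have le: "meet (succs (cut_free_test as) ?X) \<le> \<delta>" using assms by (simp only: Tn_bar_iff)
  have "cut_free as (meet (fst ` ?T)) N" by (rule Tm_meet) (use T(1) in auto)
  moreover have "meet (snd ` ?T) \<le> \<delta>"
  proof (rule order_trans[OF meet_antimono le])
    show "succs (cut_free_test as) ?X \<subseteq> snd ` ?T"
    proof
      fix \<gamma> assume "\<gamma> \<in> succs (cut_free_test as) ?X"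
      then obtain \<alpha>' Q \<beta> where "(\<alpha>', Q) \<in># A" "(\<beta>, \<gamma>) \<in> ext \<alpha>'" "cut_free_test as (tprod {#Q, tau \<beta> N#})"
        by (auto simp: finite_ext)
      then show "\<gamma> \<in> snd ` ?T" by (force simp: Tt_tprod_iff Tt_tau)
    qed
  qed (use T(1) in simp)
  from order_trans[OF T(2) arr_mono[OF order_refl this]]
  have "cut_free_ne as (arr (meet (fst ` ?T)) \<delta>) (BarSum A)" unfolding Tn_bar_iff .
  ultimately show ?thesis by (rule Tn_app[rotated])
qed

text \<open>Expanding \<open>Tm\<close> alone would not survive \<open>ctx_app\<close>, because an
  application is typed through \<open>Tn\<close> of its function. Hence the second claim: a step of
  an application is either a \<beta>-step, absorbed by \<open>Tm_red\<close>, or it stays among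
  neutral terms and expands \<open>Tn\<close> as well.\<close>

lemma T_hred:
  "hred ext M M' \<Longrightarrow> (\<forall>as \<alpha>. cut_free as \<alpha> M' \<longrightarrow> cut_free as \<alpha> M) \<and>
     (is_app M \<longrightarrow> head_beta M M' \<or> neutral M \<and> neutral M' \<and> (\<forall>as \<alpha>. cut_free_ne as \<alpha> M' \<longrightarrow> cut_free_ne as \<alpha> M))"
  "hred_test ext Q Q' \<Longrightarrow> \<forall>as. cut_free_test as Q' \<longrightarrow> cut_free_test as Q"
proof (induction rule: hred_hred_test.inducts)
  case (beta M N)
  have "head_beta (App (Lam M) N) (subst0 N M)" by (rule head_beta.intros)
  then show ?case using Tm_red by force
next
  case (bar_app A N)
  then show ?case using Tn_bar_app by (auto simp: Tm_neutral_iff)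
next
  case (tau_lam \<alpha> M)
  show ?case
  proof (intro allI impI)
    fix as assume a: "cut_free_test as (tprod {#tau \<gamma> (subst0 (bar_eps \<beta>) M). (\<beta>, \<gamma>) \<in># mset_set (ext \<alpha>)#})"
    have "cut_free (\<beta> # as) \<gamma> M" if "(\<beta>, \<gamma>) \<in> ext \<alpha>" for \<beta> \<gamma>
      by (rule Tm_subst0_bar_eps) (use a that in \<open>auto simp: Tt_tprod_iff Tt_tau finite_ext\<close>)
    then show "cut_free_test as (Tau \<alpha> (Lam M))"
      unfolding Tt_tau_iff by (rule Tm_Lam_infI[OF finite_ext eq_refl[OF ext_eq[symmetric]]])
  qed
next
  case (tau_bar \<alpha> xs)
  show ?case
  proof (intro allI impI)
    fix as
    assume "cut_free_test as (tsum (mset (map (\<lambda>ys. tprod (mset (map snd ys))) (filter (\<lambda>ys. meet (fst ` set ys) \<le> \<alpha>) (subseqs xs)))))"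
    then obtain ys where ys: "ys \<in> set (subseqs xs)" "meet (fst ` set ys) \<le> \<alpha>" "\<forall>Q \<in> snd ` set ys. cut_free_test as Q"
      by (auto simp: Tt_tsum_iff Tt_tprod_iff)
    have "set ys \<subseteq> set xs" by (rule set_subseqs_subset[OF ys(1)])
    then have "cut_free_ne as \<alpha> (BarSum (mset xs))" by (intro Tn_bar[of "set ys"]) (use ys in force)+
    then show "cut_free_test as (Tau \<alpha> (BarSum (mset xs)))" unfolding Tt_tau_iff by (rule Tm_ne)
  qed
next
  case (distrib Qss)
  show ?case
  proof (intro allI impI)
    fix as assume "cut_free_test as (tsum (mset (map (\<lambda>Qs. tprod (mset Qs)) (product_lists Qss))))"
    then obtain Qs where Qs: "Qs \<in> set (product_lists Qss)" "\<forall>Q \<in> set Qs. cut_free_test as Q"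
      by (auto simp: Tt_tsum_iff Tt_tprod_iff)
    have "\<exists>Q \<in> set Rs. Q \<in> set Qs" if "Rs \<in> set Qss" for Rs
      using Qs(1) that by (auto simp: product_lists_set list_all2_conv_all_nth in_set_conv_nth)
    then have "cut_free_test as (tsum (mset Rs))" if "Rs \<in> set Qss" for Rs
      using that Qs(2) unfolding Tt_tsum_iff set_mset_mset by blast
    then show "cut_free_test as (tprod (mset (map (\<lambda>Qs. tsum (mset Qs)) Qss)))" unfolding Tt_tprod_iff by auto
  qed
next
  case (bar_sum A \<alpha>)
  have "succs (cut_free_test as) {#(\<alpha>, tsum A)#} = succs (cut_free_test as) (image_mset (Pair \<alpha>) A)" for as
    by (auto simp: Tt_tsum_iff)
  then show ?case by (simp add: Tm_bar_iff)
next
  case (ctx_lam M M')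
  show ?case
  proof (intro conjI allI impI)
    fix as \<alpha> assume "cut_free as \<alpha> (Lam M')"
    then obtain S where "finite S" "arrows arr S \<le> \<alpha>" "\<And>\<beta> \<gamma>. (\<beta>, \<gamma>) \<in> S \<Longrightarrow> cut_free (\<beta> # as) \<gamma> M'"
      by (rule Tm_Lam_infE) blast
    then show "cut_free as \<alpha> (Lam M)" using ctx_lam.IH by (intro Tm_Lam_infI[of S]) auto
  qed simp
next
  case (ctx_app M M' N)
  have "head_beta M M' \<or> neutral M \<and> neutral M' \<and> (\<forall>as \<alpha>. cut_free_ne as \<alpha> M' \<longrightarrow> cut_free_ne as \<alpha> M)"
    using ctx_app by blast
  then show ?case
  proof (elim disjE conjE)
    assume "head_beta M M'"
    then have "head_beta (App M N) (App M' N)" using ctx_app by (auto intro: head_beta.intros)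
    then show ?thesis using Tm_red by force
  next
    assume a: "neutral M" "neutral M'" "\<forall>as \<alpha>. cut_free_ne as \<alpha> M' \<longrightarrow> cut_free_ne as \<alpha> M"
    then have "cut_free_ne as \<alpha> (App M N)" if "cut_free_ne as \<alpha> (App M' N)" for as \<alpha>
      using that by (auto elim!: Tn_AppE intro: Tn_app)
    then show ?thesis using a by (auto simp: Tm_neutral_iff)
  qed
next
  case (ctx_tau M M' \<alpha>)
  then show ?case by (simp add: Tt_tau_iff)
next
  case (ctx_bar Q Q' \<alpha>)
  have "succs (cut_free_test as) {#(\<alpha>, Q')#} \<subseteq> succs (cut_free_test as) {#(\<alpha>, Q)#}" for as
    using ctx_bar.IH by auto
  from meet_antimono[OF finite_succ this] show ?case unfolding Tm_bar_iff by (auto intro: order_trans)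
next
  case (ctx_prod Q Q' P)
  then show ?case by (simp add: Tt_tprod_iff)
next
  case (ctx_plus A A' B)
  have u: "succs (cut_free_test as) (A + B) =
    succs (cut_free_test as) A \<union> succs (cut_free_test as) B" for A B as
    by auto
  \<comment> \<open>Expansion for all types amounts to one inequality between meets, and that is
    stable under adding the summands \<open>B\<close> on both sides.\<close>
  have le: "meet (succs (cut_free_test as) A) \<le> meet (succs (cut_free_test as) A')" for as
    using ctx_plus.IH unfolding Tm_bar_iff by blast
  show ?case
    unfolding Tm_bar_iff u meet_Un[OF finite_succ finite_succ]
    using order_trans[OF inf_mono[OF le order_refl]] by (simp del: inf.bounded_iff)
next
  case (ctx_sum Q Q' P)
  then show ?case by (auto simp: Tt_tsum_iff)
qed

lemma T_hreds: "(hred ext)\<^sup>*\<^sup>* M M' \<Longrightarrow> cut_free as \<alpha> M' \<Longrightarrow> cut_free as \<alpha> M"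
proof (induction rule: rtranclp_induct)
  case (step M' M'')
  then show ?case using T_hred(1)[OF step(2)] by simp
qed

lemma T_hreds_test: "(hred_test ext)\<^sup>*\<^sup>* Q Q' \<Longrightarrow> cut_free_test as Q' \<Longrightarrow> cut_free_test as Q"
proof (induction rule: rtranclp_induct)
  case (step Q' Q'')
  then show ?case using T_hred(2)[OF step(2)] by simp
qed

end


section \<open>Pure terms: cut-free typing and approximants\<close>

fun vhead :: "'d tm \<Rightarrow> bool" where
  "vhead (Var i) = True"
| "vhead (App M N) = vhead M"
| "vhead _ = False"

lemma vhead_neutral: "vhead M \<Longrightarrow> neutral M"
  by (induction M rule: vhead.induct) auto

lemma pure_apps: "pure (apps M Ns) \<longleftrightarrow> pure M \<and> (\<forall>N \<in> set Ns. pure N)"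
  by (induction Ns arbitrary: M) auto

lemma scoped_apps: "scoped n (apps M Ns) \<longleftrightarrow> scoped n M \<and> (\<forall>N \<in> set Ns. scoped n N)"
  by (induction Ns arbitrary: M) auto

lemma pure_lams: "pure (lams n M) \<longleftrightarrow> pure M"
  by (induction n) auto

lemma scoped_lams: "scoped m (lams n M) \<longleftrightarrow> scoped (n + m) M"
  by (induction n arbitrary: m) auto

lemma vhead_apps: "vhead (apps M Ns) = vhead M"
  by (induction Ns arbitrary: M) auto

lemma neutral_apps: "neutral (apps M Ns) = neutral M"
  by (induction Ns arbitrary: M) auto

lemma vhead_ex: "vhead M \<Longrightarrow> \<exists>i Ms. M = apps (Var i) Ms"
proof (induction M rule: vhead.induct)
  case (1 i)
  show ?case by (intro exI[of _ i] exI[of _ "[]"]) simp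
next
  case (2 M N)
  then obtain i Ms where "M = apps (Var i) Ms" by auto
  then show ?case by (intro exI[of _ i] exI[of _ "Ms @ [N]"]) simp
qed auto

lemma not_vhead_ex: "pure M \<Longrightarrow> \<not> vhead M \<Longrightarrow> \<exists>P Ms. M = apps (Lam P) Ms"
proof (induction M)
  case (Lam P)
  show ?case by (intro exI[of _ P] exI[of _ "[]"]) simp
next
  case (App M N)
  then obtain P Ms where "M = apps (Lam P) Ms" by auto
  then show ?case by (intro exI[of _ P] exI[of _ "Ms @ [N]"]) simp
qed auto

lemma head_redex_App: "pure M \<Longrightarrow> head_redex (App M N) \<longleftrightarrow> \<not> vhead M"
proof
  assume "head_redex (App M N)"
  then show "\<not> vhead M"
    using not_head_redex_hnf[of 0] vhead_ex[of "App M N"] by fastforce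
next
  assume "pure M" "\<not> vhead M"
  then obtain P Ms where M: "M = apps (Lam P) Ms" using not_vhead_ex by blast
  obtain L Ls where L: "Ms @ [N] = L # Ls" by (cases "Ms @ [N]") auto
  have "App M N = apps (Lam P) (Ms @ [N])" using M by simp
  also have "\<dots> = apps (App (Lam P) L) Ls" unfolding L by simp
  finally show "head_redex (App M N)" unfolding head_redex_def by (intro exI[of _ 0]) auto
qed

lemma head_redex_Lam: "head_redex (Lam M) \<longleftrightarrow> head_redex M"
proof
  have no: "Lam M \<noteq> apps (App P N) Ms" for P N Ms by (cases Ms rule: rev_cases) auto
  assume "head_redex (Lam M)"
  then obtain n P N Ms where e: "Lam M = lams n (apps (App (Lam P) N) Ms)" unfolding head_redex_def by blast
  then show "head_redex M" using no by (cases n) (auto simp: head_redex_def)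
next
  assume "head_redex M"
  then obtain n P N Ms where "M = lams n (apps (App (Lam P) N) Ms)" unfolding head_redex_def by blast
  then show "head_redex (Lam M)" unfolding head_redex_def by (intro exI[of _ "Suc n"]) auto
qed

lemma approx_head_redex: "head_redex M \<Longrightarrow> approx M = Omega"
  unfolding head_redex_def using approx_redex by blast

lemma approx_App: "pure M \<Longrightarrow> approx (App M N) = (if vhead M then App (approx M) (approx N) else Omega)"
  by (simp add: head_redex_App)

lemma approx_Lam: "approx (Lam M) = (if head_redex M then Omega else Lam (approx M))"
  by (simp add: head_redex_Lam)

declare approx.simps(2,3) [simp del]

lemma scoped_approx: "scoped n M \<Longrightarrow> scoped n (approx M)"
  by (induction M arbitrary: n) (auto simp: approx.simps(2,3))

lemma pure_rename: "pure M \<Longrightarrow> pure (rename r M)"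
  by (induction M arbitrary: r) auto

lemma pure_subst: "pure M \<Longrightarrow> (\<And>i. pure (s i)) \<Longrightarrow> pure (subst s M)"
proof (induction M arbitrary: s)
  case (Lam M)
  have "pure (subst (up_sub s) M)"
    by (rule Lam.IH) (use Lam.prems in \<open>auto simp: pure_rename split: nat.split\<close>)
  then show ?case by simp
qed auto

lemma pure_head_beta: "head_beta M M' \<Longrightarrow> pure M \<Longrightarrow> pure M'"
proof (induction rule: head_beta.induct)
  case (1 M N)
  then show ?case unfolding subst0_def by (intro pure_subst) (auto split: nat.split)
qed auto

lemma pure_wf: "pure M \<Longrightarrow> wf_tm M"
  by (induction M) auto

lemma ex_head_beta: "pure M \<Longrightarrow> \<not> vhead M \<Longrightarrow> \<exists>M'. head_beta (App M N) M'"
proof (induction M arbitrary: N)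
  case (Lam M)
  then show ?case by (auto intro: head_beta.intros)
next
  case (App M1 M2)
  then obtain M' where "head_beta (App M1 M2) M'" by fastforce
  then have "head_beta (App (App M1 M2) N) (App M' N)" by (auto intro: head_beta.intros)
  then show ?case by blast
qed auto

text \<open>Parallel reduction of all outermost redexes. Being a function, it yields a common approximant for
  the finitely many subderivations at an abstraction without any appeal to confluence.\<close>

primrec pstep :: "'d tm \<Rightarrow> 'd tm" where
  "pstep (Var i) = Var i"
| "pstep (Lam M) = Lam (pstep M)"
| "pstep (App M N) = (if vhead M then App (pstep M) (pstep N) else (SOME M'. head_beta (App M N) M'))"
| "pstep Omega = Omega"
| "pstep (BarSum A) = BarSum A"

lemma pstep_redex: "pure M \<Longrightarrow> \<not> vhead M \<Longrightarrow> head_beta (App M N) (pstep (App M N))"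
  using ex_head_beta[of M N] by (simp add: someI_ex)

lemma pstep_vhead: "vhead M \<Longrightarrow> vhead (pstep M)"
  by (induction M rule: vhead.induct) auto

lemma pstep_pure: "pure M \<Longrightarrow> pure (pstep M)"
proof (induction M)
  case (App M N)
  then show ?case using pure_head_beta[OF pstep_redex[of M N]] by (cases "vhead M") (auto simp del: pstep.simps(3), simp)
qed auto

lemma pstep_scoped: "pure M \<Longrightarrow> scoped n (M :: 'd::bounded_semilattice_inf_top tm) \<Longrightarrow> scoped n (pstep M)"
proof (induction M arbitrary: n)
  case (App M N)
  show ?case
  proof (cases "vhead M")
    case False
    then have "head_beta (App M N) (pstep (App M N))" using App.prems by (intro pstep_redex) auto
    from scoped_hred[OF head_beta_hred[OF this, of undefined] App.prems(2)] show ?thesis .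
  qed (use App in auto)
qed auto

section \<open>Boehm reduction under abstractions and in arguments\<close>

lemma bohm_red_Lam:
  assumes "bohm_red M M'"
  shows "bohm_red (Lam M) (Lam M')"
  using assms
proof (cases rule: bohm_red.cases)
  case (2 N N' n i Ms Ns)
  show ?thesis using bohm_red.intros(2)[OF 2(3), of "Suc n" i Ms Ns] 2(1,2) by simp
qed (auto intro: bohm_red.intros head_beta.intros)

lemma bohm_red_App_left: "vhead M \<Longrightarrow> bohm_red M M' \<Longrightarrow> bohm_red (App M L) (App M' L) \<and> vhead M'"
proof -
  assume v: "vhead M" and "bohm_red M M'"
  from this(2) show ?thesis
  proof (cases rule: bohm_red.cases)
    case 1
    then show ?thesis using neutral_not_head_beta[OF vhead_neutral[OF v]] by blast
  next
    case (2 N N' n i Ms Ns)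
    have "n = 0" using v 2(1) by (cases n) auto
    then show ?thesis using bohm_red.intros(2)[OF 2(3), of 0 i Ms "Ns @ [L]"] 2(1,2) by (simp add: vhead_apps)
  qed
qed

lemma bohm_red_App_right: "vhead M \<Longrightarrow> bohm_red N N' \<Longrightarrow> bohm_red (App M N) (App M N')"
  using bohm_red.intros(2)[of N N' 0 _ _ "[]"] vhead_ex by fastforce

lemma bohm_reds_Lam: "bohm_red\<^sup>*\<^sup>* M M' \<Longrightarrow> bohm_red\<^sup>*\<^sup>* (Lam M) (Lam M')"
  by (induction rule: rtranclp_induct) (auto intro: rtranclp.rtrancl_into_rtrancl bohm_red_Lam)

lemma bohm_reds_App:
  assumes "vhead M" "bohm_red\<^sup>*\<^sup>* M M'" "bohm_red\<^sup>*\<^sup>* N N'"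
  shows "bohm_red\<^sup>*\<^sup>* (App M N) (App M' N')"
proof -
  have l: "bohm_red\<^sup>*\<^sup>* (App M N) (App M' N) \<and> vhead M'" using assms(2)
  proof (induction rule: rtranclp_induct)
    case (step M' M'')
    then show ?case using bohm_red_App_left[of M' M'' N] by (auto intro: rtranclp.rtrancl_into_rtrancl)
  qed (use assms(1) in simp)
  have "bohm_red\<^sup>*\<^sup>* (App M' N) (App M' N')" using assms(3)
  proof (induction rule: rtranclp_induct)
    case (step N' N'')
    then show ?case using bohm_red_App_right[of M' N' N''] l by (auto intro: rtranclp.rtrancl_into_rtrancl)
  qed simp
  then show ?thesis using l by (meson rtranclp_trans)
qed

lemma bohm_reds_pstep: "pure M \<Longrightarrow> bohm_red\<^sup>*\<^sup>* M (pstep M)"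
proof (induction M)
  case (Lam M)
  then show ?case by (simp add: bohm_reds_Lam)
next
  case (App M N)
  show ?case
  proof (cases "vhead M")
    case True
    then show ?thesis using App by (simp add: bohm_reds_App)
  next
    case False
    then have "head_beta (App M N) (pstep (App M N))" using App.prems by (intro pstep_redex) auto
    then show ?thesis by (intro r_into_rtranclp bohm_red.intros(1))
  qed
qed auto

lemma psteps_pure: "pure M \<Longrightarrow> pure ((pstep ^^ k) M)"
  by (induction k) (auto simp: pstep_pure)

lemma psteps_scoped: "pure M \<Longrightarrow> scoped n (M :: 'd::bounded_semilattice_inf_top tm) \<Longrightarrow> scoped n ((pstep ^^ k) M)"
  by (induction k) (auto simp: pstep_scoped psteps_pure)

lemma bohm_reds_psteps: "pure M \<Longrightarrow> bohm_red\<^sup>*\<^sup>* M ((pstep ^^ k) M)"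
  by (induction k) (auto intro: rtranclp_trans bohm_reds_pstep psteps_pure)

lemma psteps_Lam: "(pstep ^^ k) (Lam M) = Lam ((pstep ^^ k) M)"
  by (induction k) auto

lemma psteps_App: "vhead M \<Longrightarrow> (pstep ^^ k) (App M N) = App ((pstep ^^ k) M) ((pstep ^^ k) N)
    \<and> vhead ((pstep ^^ k) M)"
  by (induction k) (auto simp: pstep_vhead)

context DEFiM
begin

text \<open>In an approximant every redex has become \<open>Omega\<close>, which has only the type
  \<omega>. So its semantic typing contains no cut and can be read as a cut-free derivation for
  \<open>M\<close> itself.\<close>

lemma approx_Tm: "(as, \<alpha>) \<in> sem n (approx M) \<Longrightarrow> pure M \<Longrightarrow> scoped n M \<Longrightarrow>
   cut_free as \<alpha> M \<and> (vhead M \<longrightarrow> cut_free_ne as \<alpha> M)"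
proof (induction M arbitrary: as \<alpha> n)
  case (Var i)
  then have "cut_free_ne as \<alpha> (Var i)" by (auto intro: Tn_var)
  then show ?case by (auto intro: Tm_ne)
next
  case (Lam M)
  show ?case
  proof (cases "head_redex M")
    case True
    then show ?thesis using Lam.prems(1) by (auto simp: approx_Lam intro: Tm_top)
  next
    case False
    with Lam.prems(1) obtain S where S: "finite S" "\<alpha> = arrows arr S"
      "\<And>\<beta> \<gamma>. (\<beta>, \<gamma>) \<in> S \<Longrightarrow> (\<beta> # as, \<gamma>) \<in> sem (Suc n) (approx M)"
      unfolding approx_Lam interp_Lam_raw by (auto simp del: interp.simps simp: interp_Lam_raw)
    have "cut_free as \<alpha> (Lam M)"
    proof (rule Tm_Lam_infI[OF S(1) eq_refl[OF S(2)[symmetric]]])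
      fix \<beta> \<gamma> assume "(\<beta>, \<gamma>) \<in> S"
      from Lam.IH[OF S(3)[OF this]] Lam.prems show "cut_free (\<beta> # as) \<gamma> M" by simp
    qed
    then show ?thesis by simp
  qed
next
  case (App M N)
  have sc: "scoped n (approx M)" "scoped n (approx N)" using App.prems scoped_approx by auto
  show ?case
  proof (cases "vhead M")
    case True
    then obtain \<gamma> where \<gamma>: "(as, arr \<gamma> \<alpha>) \<in> sem n (approx M)" "(as, \<gamma>) \<in> sem n (approx N)"
      using App.prems by (auto simp: approx_App interp_App_iff[OF sc(1)] simp del: interp.simps)
    have "cut_free_ne as (arr \<gamma> \<alpha>) M" "cut_free as \<gamma> N"
      using App.IH(1)[OF \<gamma>(1)] App.IH(2)[OF \<gamma>(2)] App.prems True by auto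
    then have "cut_free_ne as \<alpha> (App M N)" by (rule Tn_app)
    then show ?thesis by (auto intro: Tm_ne)
  next
    case False
    then show ?thesis using App.prems by (auto simp: approx_App intro: Tm_top)
  qed
qed auto

lemma Tm_lams: "(\<And>as \<alpha>. cut_free as \<alpha> M' \<Longrightarrow> cut_free as \<alpha> M) \<Longrightarrow> cut_free as \<alpha> (lams n M') \<Longrightarrow> cut_free as \<alpha> (lams n M)"
proof (induction n arbitrary: as \<alpha>)
  case (Suc n)
  have "cut_free as \<alpha> (Lam (lams n M'))" using Suc.prems(2) by simp
  then obtain S where S: "finite S" "arrows arr S \<le> \<alpha>" "\<And>\<beta> \<gamma>. (\<beta>, \<gamma>) \<in> S \<Longrightarrow> cut_free (\<beta> # as) \<gamma> (lams n M')"
    by (rule Tm_Lam_infE) blast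
  have "cut_free as \<alpha> (Lam (lams n M))"
    by (rule Tm_Lam_infI[OF S(1,2)]) (rule Suc.IH[OF Suc.prems(1) S(3)])
  then show ?case by simp
qed simp

lemma Tn_apps: "(\<And>as \<alpha>. cut_free_ne as \<alpha> M' \<Longrightarrow> cut_free_ne as \<alpha> M) \<Longrightarrow> cut_free_ne as \<alpha> (apps M' Ns) \<Longrightarrow> cut_free_ne as \<alpha> (apps M Ns)"
proof (induction Ns arbitrary: \<alpha> rule: rev_induct)
  case (snoc N Ns)
  from snoc.prems(2) have "cut_free_ne as \<alpha> (App (apps M' Ns) N)" by simp
  then obtain \<gamma> where "cut_free_ne as (arr \<gamma> \<alpha>) (apps M' Ns)" "cut_free as \<gamma> N" by (rule Tn_AppE)
  then have "cut_free_ne as \<alpha> (App (apps M Ns) N)" using snoc.IH[OF snoc.prems(1)] by (blast intro: Tn_app)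
  then show ?case by simp
qed simp

lemma Tm_bohm_red: "bohm_red M M' \<Longrightarrow> cut_free as \<alpha> M' \<Longrightarrow> cut_free as \<alpha> M"
proof (induction arbitrary: as \<alpha> rule: bohm_red.induct)
  case (1 M M')
  then show ?case using T_hred(1)[OF head_beta_hred] by blast
next
  case (2 N N' n i Ms Ns)
  have a: "cut_free_ne as \<alpha> (App (apps (Var i) Ms) N)" if "cut_free_ne as \<alpha> (App (apps (Var i) Ms) N')" for as \<alpha>
    using that 2(2) by (auto elim!: Tn_AppE intro: Tn_app)
  have "cut_free as \<alpha> (apps (Var i) (Ms @ N # Ns))" if "cut_free as \<alpha> (apps (Var i) (Ms @ N' # Ns))" for as \<alpha>
    using that Tn_apps[OF a, where Ns = Ns] by (auto simp: Tm_neutral_iff neutral_apps)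
  from Tm_lams[OF this 2(3)] show ?case .
qed

lemma Tm_bohm_reds: "bohm_red\<^sup>*\<^sup>* M M' \<Longrightarrow> cut_free as \<alpha> M' \<Longrightarrow> cut_free as \<alpha> M"
  by (induction rule: rtranclp_induct) (auto intro: Tm_bohm_red)

lemma pure_scoped_bohm_red: "bohm_red (M :: 'd tm) M' \<Longrightarrow> (pure M \<longrightarrow> pure M') \<and> (\<forall>n. scoped n M \<longrightarrow> scoped n M')"
proof (induction rule: bohm_red.induct)
  case (1 M M')
  then show ?case using pure_head_beta[OF 1] scoped_hred[OF head_beta_hred[OF 1, of ext]] by simp
next
  case (2 N N' n i Ms Ns)
  then show ?case by (auto simp: pure_apps scoped_apps pure_lams scoped_lams)
qed

lemma pure_scoped_bohm_reds: "bohm_red\<^sup>*\<^sup>* (M :: 'd tm) M' \<Longrightarrow> pure M \<Longrightarrow> scoped n M \<Longrightarrow> pure M' \<and> scoped n M'"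
proof (induction rule: rtranclp_induct)
  case (step M' M'')
  then show ?case using pure_scoped_bohm_red[OF step(2)] by simp
qed simp

lemma approximants_Tm:
  assumes "N \<in> approximants M" "(as, \<alpha>) \<in> sem n N" "pure M" "scoped n M"
  shows "cut_free as \<alpha> M"
proof -
  from assms(1) obtain M' where M': "N = approx M'" "bohm_red\<^sup>*\<^sup>* M M'" unfolding approximants_def by blast
  with approx_Tm assms(2) pure_scoped_bohm_reds[OF M'(2) assms(3,4)] have "cut_free as \<alpha> M'" by blast
  then show ?thesis by (rule Tm_bohm_reds[OF M'(2)])
qed

text \<open>\<open>approx\<close> replaces the whole abstraction by \<open>Omega\<close> when the
  body is a redex. Nothing is lost, since an arrow with target \<omega> equals \<omega>.\<close>

lemma interp_Lam_approx:
  assumes "scoped (Suc n) M" "(as, \<alpha>) \<in> sem n (Lam (approx M))"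
  shows "(as, \<alpha>) \<in> sem n (approx (Lam M))"
proof (cases "head_redex M")
  case True
  from assms(2)[unfolded interp_Lam_raw approx_head_redex[OF True]]
  obtain S where S: "length as = n" "finite S" "\<alpha> = arrows arr S" "\<forall>(\<beta>, \<gamma>) \<in> S. \<gamma> = top" by auto
  have "top \<le> arrows arr S" unfolding le_arrows_iff[OF S(2)] using S(4) by auto
  then show ?thesis using S True by (simp add: approx_Lam top_unique)
next
  case False
  then show ?thesis using assms by (simp add: approx_Lam)
qed

text \<open>\<open>pstep\<close> leaves head variables and abstractions in place and changes only
  what the approximant shows as \<open>Omega\<close>, so types are kept.\<close>

lemma interp_approx_pstep: "(as, \<alpha>) \<in> sem n (approx M) \<Longrightarrow> pure M \<Longrightarrow> scoped n M \<Longrightarrow>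
   (as, \<alpha>) \<in> sem n (approx (pstep M))"
proof (induction M arbitrary: as \<alpha> n)
  case (Lam M)
  have sc: "scoped (Suc n) M" "scoped (Suc n) (pstep M)" using Lam.prems pstep_scoped by auto
  show ?case
  proof (cases "head_redex M")
    case True
    then have "\<alpha> = top" "length as = n" using Lam.prems(1) by (auto simp: approx_Lam)
    then show ?thesis using interp_top scoped_approx pstep_scoped[OF Lam.prems(2,3)] by metis
  next
    case False
    with Lam.prems(1) obtain S where S: "length as = n" "finite S" "\<alpha> = arrows arr S"
      "\<And>\<beta> \<gamma>. (\<beta>, \<gamma>) \<in> S \<Longrightarrow> (\<beta> # as, \<gamma>) \<in> sem (Suc n) (approx M)"
      unfolding approx_Lam by (auto simp del: interp.simps simp: interp_Lam_raw)
    have "(as, \<alpha>) \<in> sem n (Lam (approx (pstep M)))"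
      by (rule interp_LamI[OF scoped_approx[OF sc(2)] S(1,2)]) (use S(3,4) Lam sc in auto)
    then show ?thesis using interp_Lam_approx[OF sc(2)] by simp
  qed
next
  case (App M N)
  have sc: "scoped n M" "scoped n N" "scoped n (pstep M)" using App.prems pstep_scoped by auto
  note sc' = scoped_approx[OF sc(1)] scoped_approx[OF sc(3)]
  show ?case
  proof (cases "vhead M")
    case True
    have e: "approx (pstep (App M N)) = App (approx (pstep M)) (approx (pstep N))"
      using True App.prems(2) approx_App[OF pstep_pure[of M], of "pstep N"] pstep_vhead[of M] by simp
    from True obtain \<gamma> where \<gamma>: "length as = n" "(as, arr \<gamma> \<alpha>) \<in> sem n (approx M)" "(as, \<gamma>) \<in> sem n (approx N)"
      using App.prems by (auto simp: approx_App interp_App_iff[OF sc'(1)] simp del: interp.simps)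
    have "(as, arr \<gamma> \<alpha>) \<in> sem n (approx (pstep M))" "(as, \<gamma>) \<in> sem n (approx (pstep N))"
      using App.IH(1)[OF \<gamma>(2)] App.IH(2)[OF \<gamma>(3)] App.prems by auto
    then show ?thesis unfolding e interp_App_iff[OF sc'(2)] using \<gamma>(1) by blast
  next
    case False
    then have "\<alpha> = top" "length as = n" using App.prems by (auto simp: approx_App)
    then show ?thesis using interp_top scoped_approx pstep_scoped[OF App.prems(2,3)] by metis
  qed
qed auto

lemma interp_approx_psteps:
  assumes "(as, \<alpha>) \<in> sem n (approx ((pstep ^^ k) M))" "pure M" "scoped n M" "k \<le> l"
  shows "(as, \<alpha>) \<in> sem n (approx ((pstep ^^ l) M))"
  using assms(4)
proof (induction rule: dec_induct)
  case (step m)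
  then show ?case using interp_approx_pstep psteps_pure[OF assms(2)] psteps_scoped[OF assms(2,3)] by simp
qed (use assms in simp)

text \<open>The rule \<open>Tm_red\<close> costs one further \<open>pstep\<close>. Where
  subderivations meet, the largest of the finitely many step counts serves all of them, by
  \<open>interp_approx_psteps\<close>.\<close>

lemma Tm_approx:
  "Tm h as \<alpha> M \<Longrightarrow> pure M \<Longrightarrow> scoped (length as) M \<Longrightarrow> \<exists>k. (as, \<alpha>) \<in> sem (length as) (approx ((pstep ^^ k) M))"
  "Tn h as \<alpha> M \<Longrightarrow> pure M \<Longrightarrow> scoped (length as) M \<Longrightarrow> \<exists>k. (as, \<alpha>) \<in> sem (length as) (approx ((pstep ^^ k) M)) \<and> vhead M"
  "Tt h as Q \<Longrightarrow> True"
proof (induction rule: Tm_Tn_Tt.inducts)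
  case (Tm_top h as M)
  then show ?case using interp_top[OF scoped_approx refl, of as M] by (intro exI[of _ 0]) simp
next
  case (Tm_lam S \<alpha> h as M)
  have p: "pure M" "scoped (Suc (length as)) M" using Tm_lam.prems by auto
  have "\<forall>x \<in> S. \<exists>k. (fst x # as, snd x) \<in> sem (Suc (length as)) (approx ((pstep ^^ k) M))"
    using Tm_lam(4) p by fastforce
  then obtain f where f: "\<And>x. x \<in> S \<Longrightarrow> (fst x # as, snd x) \<in> sem (Suc (length as)) (approx ((pstep ^^ f x) M))"
    by metis
  define k where "k = Max (f ` S)"
  have "(\<beta> # as, \<gamma>) \<in> sem (Suc (length as)) (approx ((pstep ^^ k) M))" if "(\<beta>, \<gamma>) \<in> S" for \<beta> \<gamma>
    by (rule interp_approx_psteps[OF _ p]) (use f[OF that] that Tm_lam(1) in \<open>auto simp: k_def\<close>)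
  then have "(as, \<alpha>) \<in> sem (length as) (Lam (approx ((pstep ^^ k) M)))"
    by (intro interp_LamI[OF _ refl Tm_lam(1,2)] scoped_approx psteps_scoped p) auto
  then have "(as, \<alpha>) \<in> sem (length as) (approx ((pstep ^^ k) (Lam M)))"
    unfolding psteps_Lam by (rule interp_Lam_approx[OF psteps_scoped[OF p]])
  then show ?case by blast
next
  case (Tm_red M M' h as \<alpha>)
  note h = head_beta_hred[OF Tm_red.hyps(1)]
  obtain k where k: "(as, \<alpha>) \<in> sem (length as) (approx ((pstep ^^ k) M'))"
    using Tm_red.IH(2) pure_head_beta[OF Tm_red.hyps(1) Tm_red.prems(1)] scoped_hred[OF h Tm_red.prems(2)] by blast
  \<comment> \<open>The step that \<open>pstep\<close> picks by \<open>SOME\<close> is the one in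
    the derivation, because head reduction is deterministic.\<close>
  have "pstep M = M'"
  proof (cases M)
    case (App L N)
    have "\<not> vhead L"
      using Tm_red.hyps(1) neutral_not_head_beta[OF vhead_neutral, of M] App by auto
    then show ?thesis
      using head_beta_det[OF Tm_red.hyps(1)] pstep_redex[of L N] App Tm_red.prems(1) by auto
  qed (use Tm_red.hyps(2) in auto)
  then have "(as, \<alpha>) \<in> sem (length as) (approx ((pstep ^^ Suc k) M))"
    using k by (simp add: funpow_swap1)
  then show ?case by blast
next
  case (Tm_ne h as \<alpha> M)
  then show ?case by blast
next
  case (Tn_var i as \<alpha> h)
  then show ?case by (intro exI[of _ 0]) auto
next
  case (Tn_app h as \<gamma> \<delta> M N)
  have p: "pure M" "scoped (length as) M" "pure N" "scoped (length as) N" using Tn_app.prems by auto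
  from Tn_app.IH(2)[OF p(1,2)] Tn_app.IH(4)[OF p(3,4)] obtain k l
    where k: "(as, arr \<gamma> \<delta>) \<in> sem (length as) (approx ((pstep ^^ k) M))" "vhead M"
      and l: "(as, \<gamma>) \<in> sem (length as) (approx ((pstep ^^ l) N))" by blast
  let ?m = "max k l"
  have "(as, arr \<gamma> \<delta>) \<in> sem (length as) (approx ((pstep ^^ ?m) M))"
    by (rule interp_approx_psteps[OF k(1) p(1,2)]) simp
  moreover have "(as, \<gamma>) \<in> sem (length as) (approx ((pstep ^^ ?m) N))"
    by (rule interp_approx_psteps[OF l p(3,4)]) simp
  moreover have "approx ((pstep ^^ ?m) (App M N)) = App (approx ((pstep ^^ ?m) M)) (approx ((pstep ^^ ?m) N))"
    using psteps_App[OF k(2), of ?m N] approx_App[OF psteps_pure[OF p(1)], of ?m] by simp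
  ultimately have "(as, \<delta>) \<in> sem (length as) (approx ((pstep ^^ ?m) (App M N)))"
    using interp_App_iff[OF scoped_approx[OF psteps_scoped[OF p(1,2)]]] by metis
  then show ?case using k(2) by auto
qed auto

lemma approximable_iff_Tm:
  "approximable arr \<longleftrightarrow> (\<forall>n M as \<alpha>. pure M \<longrightarrow> scoped n M \<longrightarrow> (as, \<alpha>) \<in> sem n M \<longrightarrow> cut_free as \<alpha> M)"
proof
  assume a: "approximable arr"
  show "\<forall>n M as \<alpha>. pure M \<longrightarrow> scoped n M \<longrightarrow> (as, \<alpha>) \<in> sem n M \<longrightarrow> cut_free as \<alpha> M"
  proof (intro allI impI)
    fix n and M :: "'d tm" and as \<alpha> assume p: "pure M" "scoped n M" "(as, \<alpha>) \<in> sem n M"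
    then obtain N where "N \<in> approximants M" "(as, \<alpha>) \<in> sem n N"
      using a unfolding approximable_def by blast
    then show "cut_free as \<alpha> M" using p approximants_Tm by blast
  qed
next
  assume a: "\<forall>n M as \<alpha>. pure M \<longrightarrow> scoped n M \<longrightarrow> (as, \<alpha>) \<in> sem n M \<longrightarrow> cut_free as \<alpha> M"
  show "approximable arr" unfolding approximable_def
  proof (intro allI impI set_eqI)
    fix n and M :: "'d tm" and x :: "'d list \<times> 'd" assume p: "pure M" "scoped n M"
    obtain as \<alpha> where x: "x = (as, \<alpha>)" by force
    show "x \<in> sem n M \<longleftrightarrow> x \<in> (\<Union>N \<in> approximants M. sem n N)"
    proof
      assume "x \<in> sem n M"
      then have "cut_free as \<alpha> M" "length as = n" using a p x interp_length by blast+
      with Tm_approx(1) p obtain k where k: "(as, \<alpha>) \<in> sem n (approx ((pstep ^^ k) M))" by blast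
      moreover have "approx ((pstep ^^ k) M) \<in> approximants M"
        unfolding approximants_def using bohm_reds_psteps[OF p(1)] by blast
      ultimately show "x \<in> (\<Union>N \<in> approximants M. sem n N)" using x by blast
    next
      assume "x \<in> (\<Union>N \<in> approximants M. sem n N)"
      then obtain N where N: "N \<in> approximants M" "(as, \<alpha>) \<in> sem n N" using x by blast
      from approximants_Tm[OF N p] interp_length[OF N(2)] p(2) T_sound(1)[of \<infinity> as \<alpha> M] show "x \<in> sem n M"
        unfolding x by simp
    qed
  qed
qed

lemma sensible_Tm:
  assumes "sensible arr ext"
  shows "pure M \<Longrightarrow> scoped (length as) M \<Longrightarrow> (as, \<alpha>) \<in> sem (length as) M \<Longrightarrow> cut_free as \<alpha> M"
proof (induction as arbitrary: M \<alpha>)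
  case Nil
  show ?case
  proof (cases "\<alpha> = top")
    case False
    let ?Q = "Tau \<alpha> M"
    have "wf_test ?Q" "scoped_test 0 ?Q" using False pure_wf Nil by auto
    moreover have "[] \<in> sem_test 0 ?Q" using Nil by simp
    ultimately have "converges_test ext ?Q" using assms unfolding sensible_def by blast
    then obtain P R where r: "(hred_test ext)\<^sup>*\<^sup>* ?Q (tsum {#P, R#})" "head_normal_prod P"
      unfolding converges_test_def mhnf_test_def by blast
    from r(2) obtain A where A: "P = tprod A" "\<forall>Q \<in># A. \<exists>\<alpha> i Ms. Q = Tau \<alpha> (apps (Var i) Ms)"
      unfolding head_normal_prod_def by blast
    \<comment> \<open>A closed term has no head variable, so the head-normal product has no factors
      and is cut-free typed outright.\<close>
    have ns: "\<not> scoped 0 (apps (Var i) Ms)" for i and Ms :: "'d tm list"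
      by (induction Ms rule: rev_induct) auto
    have "scoped_test 0 (tsum {#P, R#})" using scoped_hreds_test[OF r(1)] \<open>scoped_test 0 ?Q\<close> by blast
    then have "\<forall>Q \<in># A. scoped_test 0 Q" by (simp add: scoped_tsum A(1) scoped_tprod)
    then have "\<forall>Q \<in># A. False" using A(2) ns by fastforce
    then have "cut_free_test [] (tsum {#P, R#})" by (simp add: Tt_tsum_iff A(1) Tt_tprod_iff)
    then have "cut_free_test [] ?Q" by (rule T_hreds_test[OF r(1)])
    then show ?thesis by (simp add: Tt_tau_iff)
  qed (auto intro: Tm_top)
next
  case (Cons \<beta> as)
  have "(as, arr \<beta> \<alpha>) \<in> sem (length as) (Lam M)"
    by (rule interp_LamI[where S = "{(\<beta>, \<alpha>)}"]) (use Cons.prems in auto)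
  then have "cut_free as (arr \<beta> \<alpha>) (Lam M)" using Cons by auto
  then show ?case by (intro Tm_Lam_arr[of \<infinity> as "arr \<beta> \<alpha>"]) simp_all
qed

end


section \<open>Convergence of tests\<close>

lemma wf_BarSum [simp]: "wf_tm (BarSum A) \<longleftrightarrow> (\<forall>(\<alpha>, Q) \<in># A. \<alpha> \<noteq> top \<and> wf_test Q)"
  by auto

lemma wf_TSum [simp]: "wf_test (TSum A) \<longleftrightarrow> size A \<noteq> 1 \<and> (\<forall>Q \<in># A. \<not> is_sum Q \<and> wf_test Q)"
  by auto

lemma wf_TProd [simp]: "wf_test (TProd A) \<longleftrightarrow> size A \<noteq> 1 \<and> (\<forall>Q \<in># A. \<not> is_prod Q \<and> wf_test Q)"
  by auto

declare wf_tm.simps(5) [simp del] wf_test.simps(1,2) [simp del]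

lemma is_sum_subst [simp]: "is_sum (subst_test s Q) = is_sum Q" "is_prod (subst_test s Q) = is_prod Q"
  by (cases Q; simp)+

lemma is_sum_rename [simp]: "is_sum (rename_test r Q) = is_sum Q" "is_prod (rename_test r Q) = is_prod Q"
  by (cases Q; simp)+

lemma wf_rename:
  "wf_tm M \<Longrightarrow> wf_tm (rename r (M :: 'd::order_top tm))"
  "wf_test Q \<Longrightarrow> wf_test (rename_test r (Q :: 'd test))"
proof (induction M and Q arbitrary: r and r)
  case (BarSum A)
  then show ?case by fastforce
qed auto

lemma wf_subst:
  "wf_tm M \<Longrightarrow> (\<And>i. wf_tm (s i)) \<Longrightarrow> wf_tm (subst s (M :: 'd::order_top tm))"
  "wf_test Q \<Longrightarrow> (\<And>i. wf_tm (s i)) \<Longrightarrow> wf_test (subst_test s (Q :: 'd test))"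
proof (induction M and Q arbitrary: s and s)
  case (Lam M)
  have "wf_tm (subst (up_sub s) M)"
    by (rule Lam.IH) (use Lam.prems in \<open>auto simp: wf_rename split: nat.split\<close>)
  then show ?case by simp
next
  case (BarSum A)
  then show ?case by fastforce
qed auto

lemma wf_bar_eps [simp]: "wf_tm (bar_eps \<beta>)"
  by (auto simp: bar_eps_def bar_def)

lemma wf_tau [simp]: "wf_tm M \<Longrightarrow> wf_test (tau \<alpha> M)"
  by (auto simp: tau_def)

lemma wf_head_beta: "head_beta M M' \<Longrightarrow> wf_tm M \<Longrightarrow> wf_tm M'"
proof (induction rule: head_beta.induct)
  case (1 M N)
  then show ?case unfolding subst0_def by (intro wf_subst) (auto split: nat.split)
qed auto

lemma summands_wf: "wf_test Q \<Longrightarrow> P \<in># summands Q \<Longrightarrow> wf_test P \<and> \<not> is_sum P"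
  by (cases Q) auto

lemma factors_wf: "wf_test Q \<Longrightarrow> P \<in># factors Q \<Longrightarrow> wf_test P \<and> \<not> is_prod P"
  by (cases Q) auto

lemma wf_tsum: "(\<And>Q. Q \<in># A \<Longrightarrow> wf_test Q) \<Longrightarrow> wf_test (tsum A)"
proof -
  assume a: "\<And>Q. Q \<in># A \<Longrightarrow> wf_test Q"
  then have b: "wf_test P \<and> \<not> is_sum P" if "P \<in># (\<Sum>Q\<in>#A. summands Q)" for P
    using that summands_wf by fastforce
  show ?thesis by (cases rule: tsum_cases[of A]) (use b in auto)
qed

lemma wf_tprod: "(\<And>Q. Q \<in># A \<Longrightarrow> wf_test Q) \<Longrightarrow> wf_test (tprod A)"
proof -
  assume a: "\<And>Q. Q \<in># A \<Longrightarrow> wf_test Q"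
  then have b: "wf_test P \<and> \<not> is_prod P" if "P \<in># (\<Sum>Q\<in>#A. factors Q)" for P
    using that factors_wf by fastforce
  show ?thesis by (cases rule: tprod_cases[of A]) (use b in auto)
qed

lemma summands_not_sum: "\<not> is_sum Q \<Longrightarrow> summands Q = {#Q#}"
  by (cases Q) auto

lemma factors_not_prod: "\<not> is_prod Q \<Longrightarrow> factors Q = {#Q#}"
  by (cases Q) auto

lemma summands_tsum: "(\<And>Q. Q \<in># A \<Longrightarrow> wf_test Q) \<Longrightarrow> summands (tsum A) = (\<Sum>Q\<in>#A. summands Q)"
proof (cases rule: tsum_cases[of A])
  case (1 Q)
  assume a: "\<And>Q. Q \<in># A \<Longrightarrow> wf_test Q"
  have "Q \<in># (\<Sum>Q\<in>#A. summands Q)" using 1(1) by simp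
  then have "\<not> is_sum Q" using summands_wf a by auto
  then show ?thesis using 1 by (simp add: summands_not_sum)
qed auto

lemma factors_tprod: "(\<And>Q. Q \<in># A \<Longrightarrow> wf_test Q \<or> \<not> is_prod Q) \<Longrightarrow> factors (tprod A) = (\<Sum>Q\<in>#A. factors Q)"
proof (cases rule: tprod_cases[of A])
  case (1 Q)
  assume a: "\<And>Q. Q \<in># A \<Longrightarrow> wf_test Q \<or> \<not> is_prod Q"
  have "Q \<in># (\<Sum>Q\<in>#A. factors Q)" using 1(1) by simp
  then obtain P where P: "P \<in># A" "Q \<in># factors P" by auto
  then have "\<not> is_prod Q" using factors_wf[of P Q] a[OF P(1)] by (auto simp: factors_not_prod)
  then show ?thesis using 1 by (simp add: factors_not_prod)
qed auto

lemma tsum_cong: "(\<Sum>Q\<in>#A. summands Q) = (\<Sum>Q\<in>#B. summands Q) \<Longrightarrow> tsum A = tsum B"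
  unfolding tsum_def by simp

lemma tprod_cong: "(\<Sum>Q\<in>#A. factors Q) = (\<Sum>Q\<in>#B. factors Q) \<Longrightarrow> tprod A = tprod B"
  unfolding tprod_def by simp

lemma tsum_single: "wf_test Q \<Longrightarrow> tsum {#Q#} = Q"
  by (cases Q) (auto simp: tsum_def)

lemma tprod_single: "wf_test Q \<Longrightarrow> tprod {#Q#} = Q"
  by (cases Q) (auto simp: tprod_def)

lemma tsum_zero: "wf_test Q \<Longrightarrow> tsum {#Q, TSum {#}#} = Q"
  using tsum_cong[of "{#Q, TSum {#}#}" "{#Q#}"] tsum_single by simp

lemma tprod_eps: "wf_test Q \<Longrightarrow> tprod {#Q, TProd {#}#} = Q"
  using tprod_cong[of "{#Q, TProd {#}#}" "{#Q#}"] tprod_single by simp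

lemma tsum_TSum: "wf_test (TSum A) \<Longrightarrow> tsum A = TSum A"
proof -
  assume w: "wf_test (TSum A)"
  then have "(\<Sum>Q\<in>#A. summands Q) = (\<Sum>Q\<in>#A. {#Q#})"
    by (intro arg_cong[where f = sum_mset] image_mset_cong) (simp add: summands_not_sum)
  then show ?thesis using w by (simp add: tsum_def)
qed

lemma tprod_TProd: "wf_test (TProd A) \<Longrightarrow> tprod A = TProd A"
proof -
  assume w: "wf_test (TProd A)"
  then have "(\<Sum>Q\<in>#A. factors Q) = (\<Sum>Q\<in>#A. {#Q#})"
    by (intro arg_cong[where f = sum_mset] image_mset_cong) (simp add: factors_not_prod)
  then show ?thesis using w by (simp add: tprod_def)
qed

text \<open>Flattening returns a bare sum only when that sum is the single factor. This isolates the
  degenerate products, to which neither \<open>ctx_prod\<close> nor \<open>distrib\<close> is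
  applied below.\<close>

lemma is_sum_tprod:
  assumes "is_sum (tprod {#Q, P#})" "wf_test Q" "wf_test P"
  shows "P = TProd {#} \<and> is_sum Q \<or> Q = TProd {#} \<and> is_sum P"
proof -
  have empty: "R = TProd {#}" if "factors R = {#}" for R :: "'a test" using that by (cases R) auto
  have single: "R = R'" if "factors R = {#R'#}" "wf_test R" for R R' :: "'a test" using that by (cases R) auto
  from assms(1) have f: "factors Q + factors P = {#tprod {#Q, P#}#}"
    by (cases rule: tprod_cases[of "{#Q, P#}"]) auto
  then consider "factors Q = {#}" "factors P = {#tprod {#Q, P#}#}" | "factors P = {#}" "factors Q = {#tprod {#Q, P#}#}"
    by (metis union_is_single)
  then show ?thesis using empty single assms by cases metis+
qed

lemma head_normal_prod_tprod:
  fixes H :: "'d::order_top test"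
  assumes "head_normal_prod H" "head_normal_prod H'"
  shows "head_normal_prod (tprod {#H, H'#})"
proof -
  from assms obtain A B where A: "H = tprod A" "\<forall>Q \<in># A. \<exists>\<alpha> i Ms. Q = Tau \<alpha> (apps (Var i) Ms)"
    and B: "H' = tprod B" "\<forall>Q \<in># B. \<exists>\<alpha> i Ms. Q = Tau \<alpha> (apps (Var i) Ms)"
    unfolding head_normal_prod_def by blast
  have "factors H = (\<Sum>Q\<in>#A. factors Q)" unfolding A(1) by (rule factors_tprod) (use A(2) in auto)
  moreover have "factors H' = (\<Sum>Q\<in>#B. factors Q)" unfolding B(1) by (rule factors_tprod) (use B(2) in auto)
  ultimately have "tprod {#H, H'#} = tprod (A + B)" by (intro tprod_cong) simp
  then show ?thesis unfolding head_normal_prod_def using A(2) B(2) by (intro exI[of _ "A + B"]) auto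
qed

lemma head_normal_eps: "head_normal_prod (TProd {#})"
  unfolding head_normal_prod_def by (intro exI[of _ "{#}"]) (simp add: tprod_def)

lemma head_normal_Tau: "vhead M \<Longrightarrow> head_normal_prod (Tau \<alpha> M)"
  unfolding head_normal_prod_def using vhead_ex[of M] by (intro exI[of _ "{#Tau \<alpha> M#}"]) (auto simp: tprod_def)

text \<open>Only \<open>resolvable_sum\<close> looks below a sum: $\bar\tau_\alpha$ has no reduction below a sum, but splits
  it by \<open>bar_sum\<close>.\<close>

inductive resolvable :: "('d::bounded_semilattice_inf_top \<Rightarrow> ('d \<times> 'd) set) \<Rightarrow> 'd test \<Rightarrow> bool" for ext where
  resolvable_head: "head_normal_prod H \<Longrightarrow> wf_test H \<Longrightarrow> resolvable ext H"
| resolvable_step: "hred_test ext Q Q' \<Longrightarrow> \<not> is_sum Q \<Longrightarrow> wf_test Q \<Longrightarrow> resolvable ext Q' \<Longrightarrow> resolvable ext Q"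
| resolvable_sum: "Q \<in># A \<Longrightarrow> resolvable ext Q \<Longrightarrow> (\<And>P. P \<in># A \<Longrightarrow> wf_test P) \<Longrightarrow> resolvable ext (tsum A)"

text \<open>Distribution turns a product into a sum as soon as one factor is a sum, so the factors cannot be
  reduced independently. Hence \<open>good\<close> quantifies over the remaining factors \<open>P\<close>, in
  continuation-passing style; this makes it closed under products.\<close>

definition good :: "('d::bounded_semilattice_inf_top \<Rightarrow> ('d \<times> 'd) set) \<Rightarrow> 'd test \<Rightarrow> bool" where
  "good ext Q \<longleftrightarrow> wf_test Q \<and> (\<forall>P. wf_test P \<longrightarrow>
     (\<forall>H. head_normal_prod H \<longrightarrow> wf_test H \<longrightarrow> resolvable ext (tprod {#H, P#})) \<longrightarrow> resolvable ext (tprod {#Q, P#}))"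

lemma goodI:
  assumes "wf_test Q"
    "\<And>P. wf_test P \<Longrightarrow> (\<And>H. head_normal_prod H \<Longrightarrow> wf_test H \<Longrightarrow> resolvable ext (tprod {#H, P#})) \<Longrightarrow> resolvable ext (tprod {#Q, P#})"
  shows "good ext Q"
  using assms unfolding good_def by simp

lemma goodD:
  assumes "good ext Q" "wf_test P" "\<And>H. head_normal_prod H \<Longrightarrow> wf_test H \<Longrightarrow> resolvable ext (tprod {#H, P#})"
  shows "resolvable ext (tprod {#Q, P#})"
  using assms unfolding good_def by simp

lemma good_wf: "good ext Q \<Longrightarrow> wf_test Q"
  unfolding good_def by simp

lemma good_head: "head_normal_prod H \<Longrightarrow> wf_test H \<Longrightarrow> good ext H"
  unfolding good_def by simp

lemma good_eps: "good ext (TProd {#})"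
  by (rule good_head[OF head_normal_eps]) simp

lemma good_step:
  assumes "hred_test ext Q Q'" "\<not> is_sum Q" "wf_test Q" "good ext Q'"
  shows "good ext Q"
proof (rule goodI[OF assms(3)])
  fix P assume P: "wf_test P" "\<And>H. head_normal_prod H \<Longrightarrow> wf_test H \<Longrightarrow> resolvable ext (tprod {#H, P#})"
  show "resolvable ext (tprod {#Q, P#})"
  proof (cases "is_sum (tprod {#Q, P#})")
    case True
    \<comment> \<open>Here \<open>P\<close> is itself a sum, and the assumption on \<open>P\<close>
      with the empty head-normal product gives the claim without any reduction.\<close>
    then have "Q = TProd {#}" using is_sum_tprod[OF True assms(3) P(1)] assms(2) by blast
    then show ?thesis using P(2)[OF head_normal_eps] by simp
  next
    case False
    have "wf_test (tprod {#Q, P#})" by (rule wf_tprod) (use assms P in auto)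
    moreover have "resolvable ext (tprod {#Q', P#})" by (rule goodD[OF assms(4) P])
    ultimately show ?thesis using resolvable_step[OF ctx_prod[OF assms(1-3) P(1)] False] by blast
  qed
qed

text \<open>Distributing the remaining factors over the sum yields a sum with the member
  \<open>Q\<close> times \<open>P\<close>; one resolvable member is enough, whatever the others
  do.\<close>

lemma good_tsum:
  assumes "Q \<in># A" "good ext Q" "\<And>P. P \<in># A \<Longrightarrow> wf_test P"
  shows "good ext (tsum A)"
proof (rule goodI[OF wf_tsum[OF assms(3)]])
  fix P assume P: "wf_test P" "\<And>H. head_normal_prod H \<Longrightarrow> wf_test H \<Longrightarrow> resolvable ext (tprod {#H, P#})"
  have WQ: "resolvable ext (tprod {#Q, P#})" by (rule goodD[OF assms(2) P])
  have wf: "wf_test (tsum A)" by (rule wf_tsum[OF assms(3)])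
  have wf': "wf_test (tprod {#tsum A, P#})" by (rule wf_tprod) (use wf P(1) in auto)
  show "resolvable ext (tprod {#tsum A, P#})"
  proof (cases "is_sum (tprod {#tsum A, P#})")
    case True
    from is_sum_tprod[OF this wf P(1)] show ?thesis
    proof (elim disjE conjE)
      assume e: "P = TProd {#}"
      have "resolvable ext Q" using WQ tprod_eps[OF good_wf[OF assms(2)]] e by simp
      then have "resolvable ext (tsum A)" by (rule resolvable_sum[OF assms(1) _ assms(3)])
      then show ?thesis using tprod_eps[OF wf] e by simp
    next
      assume "tsum A = TProd {#}"
      then show ?thesis using P(2)[OF head_normal_eps] by simp
    qed
  next
    case False
    obtain xs where xs: "A = mset xs" by (metis ex_mset)
    have pl: "product_lists [xs, [P]] = map (\<lambda>x. [x, P]) xs" by (induction xs) auto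
    \<comment> \<open>\<open>P\<close> is taken as a one-element sum, so it stays whole under
      \<open>distrib\<close> even if it is a sum.\<close>
    have "hred_test ext (tprod (mset (map (\<lambda>Qs. tsum (mset Qs)) [xs, [P]])))
      (tsum (mset (map (\<lambda>Qs. tprod (mset Qs)) (product_lists [xs, [P]]))))"
      by (rule distrib) (use assms(3) P xs in auto)
    then have "hred_test ext (tprod {#tsum A, P#}) (tsum {#tprod {#x, P#}. x \<in># A#})"
      unfolding pl by (simp add: xs tsum_single[OF P(1)] comp_def)
    moreover have "resolvable ext (tsum {#tprod {#x, P#}. x \<in># A#})"
      by (rule resolvable_sum[OF _ WQ]) (use assms P in \<open>auto intro!: wf_tprod\<close>)
    ultimately show ?thesis using resolvable_step False wf' by blast
  qed
qed

text \<open>Composition of continuations: \<open>Q\<close> is run with the other factors and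
  \<open>P\<close> as its remainder. Once \<open>Q\<close> has become some head-normal
  \<open>H\<close>, the other factors are run with \<open>H\<close> and \<open>P\<close> as theirs.
  The results \<open>H\<close> and \<open>H'\<close> multiply to a head-normal product, for which
  \<open>P\<close> was assumed to work.\<close>

lemma good_tprod: "(\<And>Q. Q \<in># A \<Longrightarrow> good ext Q) \<Longrightarrow> good ext (tprod A)"
proof (induction A)
  case empty
  then show ?case using good_eps by (simp add: tprod_def)
next
  case (add Q A)
  have wf: "wf_test Q" "wf_test (tprod A)" "\<And>P. P \<in># A \<Longrightarrow> wf_test P" "good ext Q"
    using add.prems good_wf by (auto intro!: wf_tprod)
  have fA: "factors (tprod A) = (\<Sum>Q\<in>#A. factors Q)" by (rule factors_tprod) (use wf in blast)
  have fQA: "factors (tprod (add_mset Q A)) = (\<Sum>Q\<in>#add_mset Q A. factors Q)"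
    by (rule factors_tprod) (use wf in auto)
  have f2: "factors (tprod {#R, P#}) = factors R + factors P" if "wf_test R" "wf_test P" for R P
    using factors_tprod[of "{#R, P#}"] that by auto
  have w2: "wf_test (tprod {#R, P#})" if "wf_test R" "wf_test P" for R P
    by (rule wf_tprod) (use that in auto)
  show ?case
  proof (rule goodI)
    show "wf_test (tprod (add_mset Q A))" by (rule wf_tprod) (use wf in auto)
    fix P assume P: "wf_test P" "\<And>H. head_normal_prod H \<Longrightarrow> wf_test H \<Longrightarrow> resolvable ext (tprod {#H, P#})"
    have "resolvable ext (tprod {#Q, tprod {#tprod A, P#}#})"
    proof (rule goodD[OF wf(4)])
      show "wf_test (tprod {#tprod A, P#})" using wf P by (intro w2)
      fix H :: "'a test" assume H: "head_normal_prod H" "wf_test H"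
      have "resolvable ext (tprod {#tprod A, tprod {#H, P#}#})"
      proof (rule goodD[OF add.IH])
        show "wf_test (tprod {#H, P#})" using H P by (intro w2)
        fix H' :: "'a test" assume H': "head_normal_prod H'" "wf_test H'"
        have "tprod {#H', tprod {#H, P#}#} = tprod {#tprod {#H, H'#}, P#}"
          by (rule tprod_cong) (simp add: f2 H H' P)
        then show "resolvable ext (tprod {#H', tprod {#H, P#}#})"
          using P(2)[OF head_normal_prod_tprod[OF H(1) H'(1)] w2[OF H(2) H'(2)]] by simp
      qed (use add.prems in simp)
      moreover have "tprod {#tprod A, tprod {#H, P#}#} = tprod {#H, tprod {#tprod A, P#}#}"
        by (rule tprod_cong) (simp add: f2 H P wf)
      ultimately show "resolvable ext (tprod {#H, tprod {#tprod A, P#}#})" by simp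
    qed
    moreover have "tprod {#Q, tprod {#tprod A, P#}#} = tprod {#tprod (add_mset Q A), P#}"
      by (rule tprod_cong) (simp add: f2 P wf fA fQA)
    ultimately show "resolvable ext (tprod {#tprod (add_mset Q A), P#})" by simp
  qed
qed

lemma good_resolvable: "good ext Q \<Longrightarrow> resolvable ext Q"
proof -
  assume g: "good ext Q"
  have "resolvable ext (tprod {#Q, TProd {#}#})"
  proof (rule goodD[OF g])
    fix H :: "'a test" assume "head_normal_prod H" "wf_test H"
    then show "resolvable ext (tprod {#H, TProd {#}#})" unfolding tprod_eps[OF \<open>wf_test H\<close>] by (rule resolvable_head)
  qed simp
  then show ?thesis using tprod_eps[OF good_wf[OF g]] by simp
qed

text \<open>The extra summand \<open>P\<close> is the induction loading: at
  \<open>resolvable_sum\<close> all members except the resolvable one are moved into it.\<close>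

lemma resolvable_converges_tsum: "resolvable ext Q \<Longrightarrow> wf_test P \<Longrightarrow> converges_test ext (tsum {#Q, P#})"
proof (induction arbitrary: P rule: resolvable.induct)
  case (resolvable_head H)
  then show ?case unfolding converges_test_def mhnf_test_def by blast
next
  case (resolvable_step Q Q')
  from ctx_sum[OF resolvable_step(1,3,6)] resolvable_step.IH[OF resolvable_step.prems] show ?case
    unfolding converges_test_def by (meson converse_rtranclp_into_rtranclp)
next
  case (resolvable_sum Q A)
  obtain B where B: "A = add_mset Q B" using resolvable_sum(1) by (metis mset_add)
  then have wf: "wf_test R" if "R \<in># A + {#P#}" for R using that resolvable_sum by auto
  have "summands (tsum A) = (\<Sum>Q\<in>#A. summands Q)" by (rule summands_tsum) (use wf in simp)
  moreover have "summands (tsum (add_mset P B)) = (\<Sum>Q\<in>#add_mset P B. summands Q)"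
    by (rule summands_tsum) (use wf B in auto)
  ultimately have "tsum {#tsum A, P#} = tsum {#Q, tsum (add_mset P B)#}" by (intro tsum_cong) (simp add: B)
  moreover have "wf_test (tsum (add_mset P B))" by (rule wf_tsum) (use wf B in auto)
  ultimately show ?case using resolvable_sum.IH by simp
qed

lemma resolvable_wf: "resolvable ext Q \<Longrightarrow> wf_test Q"
  by (induction rule: resolvable.induct) (auto intro: wf_tsum)

lemma resolvable_converges_test: "resolvable ext Q \<Longrightarrow> converges_test ext Q"
  using resolvable_converges_tsum[of ext Q "TSum {#}"] by (simp add: tsum_zero resolvable_wf)

lemma resolvable_converges_bar: "resolvable ext Q \<Longrightarrow> \<exists>Q' A'. (hred ext)\<^sup>*\<^sup>* (BarSum (add_mset (\<alpha>, Q) A)) (BarSum (add_mset (\<alpha>, Q') A')) \<and> head_normal_prod Q'"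
proof (induction arbitrary: A rule: resolvable.induct)
  case (resolvable_head H)
  then show ?case by blast
next
  case (resolvable_step Q Q')
  have "hred ext (BarSum ({#(\<alpha>, Q)#} + A)) (BarSum ({#(\<alpha>, Q')#} + A))"
    by (intro ctx_plus ctx_bar resolvable_step)
  then have "hred ext (BarSum (add_mset (\<alpha>, Q) A)) (BarSum (add_mset (\<alpha>, Q') A))" by simp
  then show ?case using resolvable_step.IH[of A] by (meson converse_rtranclp_into_rtranclp)
next
  case (resolvable_sum Q B)
  have "hred ext (BarSum ({#(\<alpha>, tsum B)#} + A)) (BarSum (image_mset (Pair \<alpha>) B + A))"
    by (intro ctx_plus bar_sum ballI) (use resolvable_sum in blast)
  moreover obtain C where "B = add_mset Q C" using resolvable_sum(1) by (metis mset_add)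
  ultimately have "hred ext (BarSum (add_mset (\<alpha>, tsum B) A)) (BarSum (add_mset (\<alpha>, Q) (image_mset (Pair \<alpha>) C + A)))"
    by simp
  then show ?case using resolvable_sum.IH[of "image_mset (Pair \<alpha>) C + A"] by (meson converse_rtranclp_into_rtranclp)
qed


section \<open>Cut-free typed terms and tests converge\<close>

lemma filter_in_subseqs: "filter P xs \<in> set (subseqs xs)"
  by (induction xs) (auto simp: Let_def)

text \<open>Steps that remain steps in function position and under \<tau>: \<open>ctx_app\<close>
  and \<open>ctx_tau\<close> both ask for an application. Well-formedness is carried along because
  \<open>good_step\<close> demands it at each step.\<close>

definition spine_red :: "('d::bounded_semilattice_inf_top \<Rightarrow> ('d \<times> 'd) set) \<Rightarrow> 'd tm \<Rightarrow> 'd tm \<Rightarrow> bool" where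
  "spine_red ext M M' \<longleftrightarrow> hred ext M M' \<and> is_app M \<and> wf_tm M"

lemma spine_red_App: "(spine_red ext)\<^sup>*\<^sup>* M M' \<Longrightarrow> wf_tm N \<Longrightarrow> (spine_red ext)\<^sup>*\<^sup>* (App M N) (App M' N)"
proof (induction rule: rtranclp_induct)
  case (step M' M'')
  then have "spine_red ext (App M' N) (App M'' N)" unfolding spine_red_def by (auto intro: ctx_app)
  with step show ?case by (auto intro: rtranclp.rtrancl_into_rtrancl)
qed simp

lemma spine_red_hreds: "(spine_red ext)\<^sup>*\<^sup>* M M' \<Longrightarrow> (hred ext)\<^sup>*\<^sup>* M M'"
  by (rule mono_rtranclp[rule_format]) (auto simp: spine_red_def)

context filter_model
begin

lemma T_height_mono:
  "Tm h as \<alpha> M \<Longrightarrow> h \<le> h' \<Longrightarrow> Tm h' as \<alpha> M"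
  "Tn h as \<alpha> M \<Longrightarrow> h \<le> h' \<Longrightarrow> Tn h' as \<alpha> M"
  "Tt h as Q \<Longrightarrow> h \<le> h' \<Longrightarrow> Tt h' as Q"
proof (induction arbitrary: h' and h' and h' rule: Tm_Tn_Tt.inducts)
  case (Tm_lam S \<alpha> h as M)
  obtain k where k: "h' = eSuc k"
  proof (cases h')
    case (enat n)
    \<comment> \<open>The subtraction is exact, since a height above a successor is not
      zero.\<close>
    then show ?thesis using that[of "enat (n - 1)"] Tm_lam.prems
      by (cases n) (auto simp: eSuc_enat zero_enat_def[symmetric])
  qed (use that[of \<infinity>] in simp)
  then have "h \<le> k" using Tm_lam.prems by simp
  then show ?case unfolding k by (intro Tm_Tn_Tt.Tm_lam[OF Tm_lam(1,2)] Tm_lam(4))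
next
  case (Tm_red M M' h as \<alpha>)
  then show ?case by (auto intro: Tm_Tn_Tt.Tm_red)
next
  case (Tn_bar B A \<alpha> h as)
  show ?case by (rule Tm_Tn_Tt.Tn_bar[of B]) (use Tn_bar in auto)
qed (auto intro: Tm_Tn_Tt.intros)

text \<open>Derivations are well-founded and every rule has finitely many premises:
  \<open>S\<close>, \<open>B\<close> and multisets are finite, so maxima of heights exist.\<close>

lemma T_finite_height:
  "Tm h as \<alpha> M \<Longrightarrow> \<exists>k :: nat. Tm (enat k) as \<alpha> M"
  "Tn h as \<alpha> M \<Longrightarrow> \<exists>k :: nat. Tn (enat k) as \<alpha> M"
  "Tt h as Q \<Longrightarrow> \<exists>k :: nat. Tt (enat k) as Q"
proof (induction rule: Tm_Tn_Tt.inducts)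
  case (Tm_lam S \<alpha> h as M)
  have "\<forall>x \<in> S. \<exists>k :: nat. Tm (enat k) (fst x # as) (snd x) M" using Tm_lam(4) by simp
  then obtain f where f: "\<And>x. x \<in> S \<Longrightarrow> Tm (enat (f x)) (fst x # as) (snd x) M" by metis
  have "Tm (enat (Max (f ` S))) (\<beta> # as) \<gamma> M" if "(\<beta>, \<gamma>) \<in> S" for \<beta> \<gamma>
    using T_height_mono(1)[OF f[OF that]] that Tm_lam(1) by simp
  from Tm_Tn_Tt.Tm_lam[OF Tm_lam(1,2) this] show ?case by (auto simp: eSuc_enat)
next
  case (Tm_red M M' h as \<alpha>)
  then show ?case by (blast intro: Tm_Tn_Tt.Tm_red)
next
  case (Tn_bar B A \<alpha> h as)
  have "\<forall>x \<in> B. \<exists>k :: nat. Tt (enat k) as (snd x)" using Tn_bar(5) by auto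
  then obtain f where f: "\<And>x. x \<in> B \<Longrightarrow> Tt (enat (f x)) as (snd x)" by metis
  have "Tt (enat (Max (f ` B))) as Q" if "(\<beta>, Q) \<in> B" for \<beta> Q
    using T_height_mono(3)[OF f[OF that]] that Tn_bar(1) by simp
  then show ?case by (intro exI Tm_Tn_Tt.Tn_bar[OF Tn_bar(1,2,3)])
next
  case (Tn_app h as \<gamma> \<delta> M N)
  then obtain k l where kl: "Tn (enat k) as (arr \<gamma> \<delta>) M" "Tm (enat l) as \<gamma> N" by blast
  have "Tn (enat (max k l)) as (arr \<gamma> \<delta>) M" by (rule T_height_mono(2)[OF kl(1)]) simp
  moreover have "Tm (enat (max k l)) as \<gamma> N" by (rule T_height_mono(1)[OF kl(2)]) simp
  ultimately show ?case by (blast intro: Tm_Tn_Tt.Tn_app)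
next
  case (Tt_prod A h as)
  have "\<forall>Q \<in> set_mset A. \<exists>k :: nat. Tt (enat k) as Q" using Tt_prod(2) by simp
  then obtain f where f: "\<And>Q. Q \<in># A \<Longrightarrow> Tt (enat (f Q)) as Q" by metis
  have "Tt (enat (Max (f ` set_mset A))) as Q" if "Q \<in># A" for Q
    using T_height_mono(3)[OF f[OF that]] that by simp
  from Tm_Tn_Tt.Tt_prod[OF this] show ?case by blast
qed (blast intro: Tm_Tn_Tt.intros)+

text \<open>The counterpart of \<open>eps_matching\<close> for running a derivation: an assumption
  is filled by a constant that is at least as strong. A variable put for a variable needs no
  condition, since a variable in head position is already head-normal whatever its type.\<close>

definition eps_bounded :: "'d list \<Rightarrow> (nat \<Rightarrow> 'd tm) \<Rightarrow> bool" where
  "eps_bounded as s \<longleftrightarrow> (\<forall>i. (\<exists>j. s i = Var j) \<or> (\<exists>b. s i = bar_eps b \<and> (i < length as \<longrightarrow> b \<le> as ! i)))"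

lemma eps_bounded_eps_renaming: "eps_bounded as s \<Longrightarrow> eps_renaming s"
  unfolding eps_bounded_def eps_renaming_def by blast

lemma eps_bounded_wf: "eps_bounded as s \<Longrightarrow> wf_tm (s i)"
  unfolding eps_bounded_def by (metis wf_bar_eps wf_tm.simps(1))

lemma eps_bounded_Cons: "eps_bounded as s \<Longrightarrow> eps_bounded (\<beta> # as) (case_nat (bar_eps \<beta>) s)"
  unfolding eps_bounded_def by (auto split: nat.split)

end

context DEFiM
begin

text \<open>The reducibility predicate for neutral terms: either the head is a variable, or the
  spine reduces to a sum whose good summands account for the type \<beta>.\<close>

definition spine_conv :: "'d \<Rightarrow> 'd tm \<Rightarrow> bool" where
  "spine_conv \<beta> M \<longleftrightarrow> vhead M \<or> (\<exists>A. (spine_red ext)\<^sup>*\<^sup>* M (BarSum A) \<and> wf_tm (BarSum A)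
     \<and> meet (succs (good ext) A) \<le> \<beta>)"

text \<open>\<open>tau_bar\<close> ranges over all subfamilies with a small enough meet. The family
  of all good summands is one of them; its product is good by \<open>good_tprod\<close>, and one
  good member makes the sum good.\<close>

lemma good_Tau_Bar:
  assumes "wf_tm (BarSum A)" "meet (succs (good ext) A) \<le> \<alpha>" "\<alpha> \<noteq> top"
  shows "good ext (Tau \<alpha> (BarSum A))"
proof -
  obtain xs where xs: "A = mset xs" by (metis ex_mset)
  let ?F = "\<lambda>ys. tprod (mset (map snd ys))"
  let ?ys = "filter (\<lambda>(\<alpha>, Q). good ext Q) xs"
  let ?L = "mset (map ?F (filter (\<lambda>ys. meet (fst ` set ys) \<le> \<alpha>) (subseqs xs)))"
  have "fst ` set ?ys = succs (good ext) A" unfolding xs by force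
  then have "?ys \<in> set (filter (\<lambda>ys. meet (fst ` set ys) \<le> \<alpha>) (subseqs xs))"
    using filter_in_subseqs[of "\<lambda>(\<alpha>, Q). good ext Q" xs] assms(2) by simp
  then have mem: "?F ?ys \<in># ?L" unfolding set_mset_mset set_map by (rule imageI)
  have "good ext (?F ?ys)" by (rule good_tprod) auto
  moreover have "wf_test P" if P: "P \<in># ?L" for P
  proof -
    from P obtain zs where zs: "zs \<in> set (subseqs xs)" "P = ?F zs" by auto
    have "set zs \<subseteq> set xs" by (rule set_subseqs_subset[OF zs(1)])
    then show ?thesis unfolding zs(2) by (intro wf_tprod) (use assms(1) xs in fastforce)
  qed
  ultimately have "good ext (tsum ?L)" by (intro good_tsum[OF mem]) auto
  from good_step[OF tau_bar _ _ this] show ?thesis unfolding xs using assms xs by simp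
qed

lemma good_Tau_spine:
  assumes "(spine_red ext)\<^sup>*\<^sup>* M M'" "good ext (Tau \<alpha> M')" "\<alpha> \<noteq> top"
  shows "good ext (Tau \<alpha> M)"
  using assms(1)
proof (induction rule: converse_rtranclp_induct)
  case (step M1 M2)
  show ?case
    by (rule good_step[OF ctx_tau _ _ step(3)]) (use step(1) assms(3) in \<open>auto simp: spine_red_def\<close>)
qed (rule assms(2))

lemma good_Tau_conv:
  assumes "spine_conv \<alpha> M" "wf_tm M" "\<alpha> \<noteq> top"
  shows "good ext (Tau \<alpha> M)"
  using assms(1) unfolding spine_conv_def
proof (elim disjE exE conjE)
  assume "vhead M"
  then show ?thesis using assms by (intro good_head head_normal_Tau) auto
next
  fix A assume "(spine_red ext)\<^sup>*\<^sup>* M (BarSum A)" "wf_tm (BarSum A)"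
     "meet (succs (good ext) A) \<le> \<alpha>"
  then show ?thesis using good_Tau_spine good_Tau_Bar assms(3) by blast
qed

lemma spine_conv_mono: "spine_conv \<beta> M \<Longrightarrow> \<beta> \<le> \<beta>' \<Longrightarrow> spine_conv \<beta>' M"
  unfolding spine_conv_def using order_trans by blast

text \<open>After \<open>bar_app\<close>, an arrow of a good summand whose source is above \<gamma>
  gives a product of two good tests. By \<open>meet_le_arr_ext\<close> the targets of these arrows
  reach \<delta>.\<close>

lemma spine_conv_App:
  assumes M: "spine_conv (arr \<gamma> \<delta>) M" and N: "wf_tm N" "\<And>\<beta>. \<gamma> \<le> \<beta> \<Longrightarrow> good ext (tau \<beta> N)"
  shows "spine_conv \<delta> (App M N)"
proof (cases "vhead M")
  case True
  then show ?thesis by (simp add: spine_conv_def)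
next
  case False
  with M obtain A where A: "(spine_red ext)\<^sup>*\<^sup>* M (BarSum A)" "wf_tm (BarSum A)"
     "meet (succs (good ext) A) \<le> arr \<gamma> \<delta>"
    unfolding spine_conv_def by blast
  let ?X = "\<Sum>(\<alpha>, Q)\<in>#A. \<Sum>(\<beta>, \<gamma>)\<in>#mset_set (ext \<alpha>). bar \<gamma> (tprod {#Q, tau \<beta> N#})"
  let ?U = "succs (good ext) A"
  let ?V = "{\<gamma>'. \<exists>\<alpha> \<in> ?U. \<exists>\<beta>'. (\<beta>', \<gamma>') \<in> ext \<alpha> \<and> \<gamma> \<le> \<beta>'}"
  let ?Z = "succs (good ext) ?X"
  note V = meet_le_arr_ext[OF finite_succ A(3)]
  have X: "(\<gamma>', P) \<in># ?X \<longleftrightarrow> \<gamma>' \<noteq> top \<and> (\<exists>\<alpha> Q \<beta>'. (\<alpha>, Q) \<in># A \<and> (\<beta>', \<gamma>') \<in> ext \<alpha> \<and> P = tprod {#Q, tau \<beta>' N#})" for \<gamma>' P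
    by (force simp: finite_ext)
  have "spine_red ext (App (BarSum A) N) (BarSum ?X)"
    unfolding spine_red_def using A(2) N(1) by (auto intro: bar_app)
  then have red: "(spine_red ext)\<^sup>*\<^sup>* (App M N) (BarSum ?X)"
    using spine_red_App[OF A(1) N(1)] by (rule rtranclp.rtrancl_into_rtrancl[rotated])
  have "\<gamma>' \<noteq> top \<and> wf_test P" if "(\<gamma>', P) \<in># ?X" for \<gamma>' P
  proof -
    from that obtain \<alpha> Q \<beta>' where "\<gamma>' \<noteq> top" "(\<alpha>, Q) \<in># A" "P = tprod {#Q, tau \<beta>' N#}" unfolding X by blast
    then show ?thesis using A(2) N(1) by (auto intro!: wf_tprod)
  qed
  then have wf: "wf_tm (BarSum ?X)" unfolding wf_BarSum by blast
  \<comment> \<open>\<open>bar\<close> discards summands with target \<omega>, but such targets do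
    not affect a meet.\<close>
  have "meet ?Z \<le> v" if v: "v \<in> ?V" for v
  proof (cases "v = top")
    case False
    from v obtain \<alpha> Q \<beta>' where q: "(\<alpha>, Q) \<in># A" "good ext Q" "(\<beta>', v) \<in> ext \<alpha>" "\<gamma> \<le> \<beta>'" by blast
    have "good ext (tprod {#Q, tau \<beta>' N#})" by (rule good_tprod) (use q N(2) in auto)
    then have "v \<in> ?Z" using X[of v "tprod {#Q, tau \<beta>' N#}"] q False by blast
    then show ?thesis by (rule meet_lower[OF finite_succ])
  qed simp
  then have "meet ?Z \<le> meet ?V" using le_meet_iff[OF V(1)] by blast
  then have "meet ?Z \<le> \<delta>" using V(2) by (rule order_trans)
  then show ?thesis unfolding spine_conv_def using red wf by blast
qed

text \<open>The inner induction, over derivations of height \<open>k\<close>. \<open>outer\<close>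
  serves only abstractions: \<open>tau_lam\<close> asks for the arrows of
  \<open>ext \<alpha>'\<close>, and \<open>Tm_Lam_arr\<close> types the body for each of them at a
  smaller height. The substitution collects the constants that earlier \<open>tau_lam\<close> steps
  have put for bound variables. All types above \<alpha> are covered because an argument is tested
  at sources above its own type.\<close>

lemma T_good_step:
  assumes outer: "\<And>j as \<alpha> M s \<alpha>'. j < k \<Longrightarrow> Tm (enat j) as \<alpha> M \<Longrightarrow> wf_tm M \<Longrightarrow> eps_bounded as s \<Longrightarrow> \<alpha> \<le> \<alpha>' \<Longrightarrow> \<alpha>' \<noteq> top \<Longrightarrow>
      good ext (Tau \<alpha>' (subst s M))"
  shows "Tm h as \<alpha> M \<Longrightarrow> h = enat k \<Longrightarrow> wf_tm M \<Longrightarrow> eps_bounded as s \<Longrightarrow> \<alpha> \<le> \<alpha>' \<Longrightarrow> \<alpha>' \<noteq> top \<Longrightarrow>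
      good ext (Tau \<alpha>' (subst s M))"
    "Tn h as \<alpha> M \<Longrightarrow> h = enat k \<Longrightarrow> wf_tm M \<Longrightarrow> eps_bounded as s \<Longrightarrow> spine_conv \<alpha> (subst s M)"
    "Tt h as Q \<Longrightarrow> h = enat k \<Longrightarrow> wf_test Q \<Longrightarrow> eps_bounded as s \<Longrightarrow> good ext (subst_test s Q)"
proof (induction arbitrary: s \<alpha>' and s and s rule: Tm_Tn_Tt.inducts)
  case (Tm_top h as M)
  then show ?case by (simp add: top_unique)
next
  case (Tm_lam S \<alpha> h as M)
  from Tm_lam.prems(1) obtain j where j: "h = enat j" "j < k" by (cases h) (auto simp: eSuc_enat)
  have T: "Tm (eSuc h) as \<alpha> (Lam M)" by (rule Tm_Tn_Tt.Tm_lam[OF Tm_lam(1,2,3)])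
  note wf = wf_subst(1)[OF _ eps_bounded_wf[OF Tm_lam.prems(3)]]
  let ?P = "subst (up_sub s) M"
  have wf': "wf_tm (Lam ?P)" using wf[OF Tm_lam.prems(2)] by simp
  have "good ext (tau \<gamma> (subst0 (bar_eps \<beta>) ?P))" if e: "(\<beta>, \<gamma>) \<in> ext \<alpha>'" for \<beta> \<gamma>
  proof (cases "\<gamma> = top")
    case True
    then show ?thesis using good_eps by (simp add: tau_def)
  next
    case False
    have "Tm (enat j) (\<beta> # as) \<gamma> M"
      using Tm_Lam_arr[OF T order_trans[OF Tm_lam.prems(4) ext_lower[OF e]]] j(1) by simp
    from outer[OF j(2) this _ eps_bounded_Cons[OF Tm_lam.prems(3)] order_refl False] Tm_lam.prems(2) False
    show ?thesis by (simp add: tau_def subst0_up_sub)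
  qed
  then have "good ext (tprod {#tau \<gamma> (subst0 (bar_eps \<beta>) ?P). (\<beta>, \<gamma>) \<in># mset_set (ext \<alpha>')#})"
    by (intro good_tprod) (auto simp: finite_ext)
  from good_step[OF tau_lam _ _ this] show ?case using wf' Tm_lam.prems(5) by simp
next
  case (Tm_red M M' h as \<alpha>)
  note v = eps_bounded_eps_renaming[OF Tm_red.prems(3)]
  note wf = wf_subst(1)[OF Tm_red.prems(2) eps_bounded_wf[OF Tm_red.prems(3)]]
  have "good ext (Tau \<alpha>' (subst s M'))"
    by (rule Tm_red.IH(2)[OF Tm_red.prems(1) wf_head_beta[OF Tm_red.hyps(1) Tm_red.prems(2)] Tm_red.prems(3-5)])
  from good_step[OF ctx_tau[OF head_beta_hred[OF head_beta_subst[OF Tm_red.hyps(1) v]]] _ _ this]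
  show ?case using is_app_subst[OF v] Tm_red.hyps(2) Tm_red.prems(5) wf by simp
next
  case (Tm_ne h as \<alpha> M)
  show ?case
    by (rule good_Tau_conv[OF spine_conv_mono[OF Tm_ne.IH(2)[OF Tm_ne.prems(1-3)] Tm_ne.prems(4)]
       wf_subst(1)[OF Tm_ne.prems(2) eps_bounded_wf[OF Tm_ne.prems(3)]] Tm_ne.prems(5)])
next
  case (Tn_var i as \<alpha> h)
  from Tn_var.prems(3) consider j where "s i = Var j" | b where "s i = bar_eps b" "b \<le> as ! i"
    using Tn_var(1) unfolding eps_bounded_def by blast
  then show ?case
  proof cases
    case 1
    then show ?thesis by (simp add: spine_conv_def)
  next
    case 2
    have le: "meet (succs (good ext) (bar b (TProd {#}))) \<le> \<alpha>"
    proof -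
      have "succs (good ext) (bar b (TProd {#})) = (if b = top then {} else {b})"
        using good_eps by auto
      then show ?thesis using order_trans[OF 2(2) Tn_var(2)] by (simp only: split: if_split) auto
    qed
    have "wf_tm (bar_eps b)" by simp
    with le show ?thesis using 2(1) unfolding spine_conv_def bar_eps_def by auto
  qed
next
  case (Tn_bar B A \<alpha> h as)
  let ?A = "image_mset (map_prod id (subst_test s)) A"
  have wf: "wf_tm (BarSum ?A)"
    using wf_subst(1)[OF Tn_bar.prems(2) eps_bounded_wf[OF Tn_bar.prems(3)]] by simp
  have "fst ` B \<subseteq> succs (good ext) ?A"
  proof
    fix \<beta> assume "\<beta> \<in> fst ` B"
    then obtain Q where Q: "(\<beta>, Q) \<in> B" by auto
    then have QA: "(\<beta>, Q) \<in># A" using Tn_bar(2) by blast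
    then have "wf_test Q" using Tn_bar.prems(2) by auto
    from Tn_bar(5)[OF Q Tn_bar.prems(1) this Tn_bar.prems(3)] have "good ext (subst_test s Q)" .
    moreover have "(\<beta>, subst_test s Q) \<in># ?A" using QA by force
    ultimately show "\<beta> \<in> succs (good ext) ?A" by blast
  qed
  from order_trans[OF meet_antimono[OF finite_succ this] Tn_bar(3)]
  show ?case unfolding spine_conv_def subst.simps using wf by (intro disjI2 exI[of _ ?A] conjI) simp_all
next
  case (Tn_app h as \<gamma> \<delta> M N)
  have wf: "wf_tm M" "wf_tm N" using Tn_app.prems by auto
  have wfN: "wf_tm (subst s N)" by (rule wf_subst(1)[OF wf(2) eps_bounded_wf[OF Tn_app.prems(3)]])
  have "good ext (tau \<beta> (subst s N))" if "\<gamma> \<le> \<beta>" for \<beta>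
    using Tn_app.IH(4)[OF Tn_app.prems(1) wf(2) Tn_app.prems(3) that] by (simp add: tau_def good_eps)
  from spine_conv_App[OF Tn_app.IH(2)[OF Tn_app.prems(1) wf(1) Tn_app.prems(3)] wfN this]
  show ?case by simp
next
  case (Tt_sum Q A h as)
  have wf: "wf_test (subst_test s (TSum A))" by (rule wf_subst(2)[OF Tt_sum.prems(2) eps_bounded_wf[OF Tt_sum.prems(3)]])
  have g: "good ext (subst_test s Q)" using Tt_sum by auto
  have "good ext (tsum (image_mset (subst_test s) A))"
    by (rule good_tsum[OF _ g]) (use wf Tt_sum(1) in auto)
  then show ?case using tsum_TSum[of "image_mset (subst_test s) A"] wf by simp
next
  case (Tt_prod A h as)
  have wf: "wf_test (subst_test s (TProd A))" by (rule wf_subst(2)[OF Tt_prod.prems(2) eps_bounded_wf[OF Tt_prod.prems(3)]])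
  have "good ext (tprod (image_mset (subst_test s) A))"
    by (rule good_tprod) (use Tt_prod in auto)
  then show ?case using tprod_TProd[of "image_mset (subst_test s) A"] wf by simp
next
  case (Tt_tau h as \<alpha> M)
  then show ?case by simp
qed

lemma T_good:
  "Tm (enat k) as \<alpha> M \<Longrightarrow> wf_tm M \<Longrightarrow> eps_bounded as s \<Longrightarrow> \<alpha> \<le> \<alpha>' \<Longrightarrow> \<alpha>' \<noteq> top \<Longrightarrow> good ext (Tau \<alpha>' (subst s M))"
proof (induction k arbitrary: as \<alpha> M s \<alpha>' rule: less_induct)
  case (less k)
  show ?case by (rule T_good_step(1)[OF less.IH less.prems(1) refl less.prems(2-5)])
qed

lemma eps_bounded_Var: "eps_bounded as Var"
  unfolding eps_bounded_def by blast

lemma Tn_spine_conv: "Tn h as \<alpha> M \<Longrightarrow> wf_tm M \<Longrightarrow> spine_conv \<alpha> M"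
proof -
  assume a: "Tn h as \<alpha> M" "wf_tm M"
  then obtain k where "Tn (enat k) as \<alpha> M" using T_finite_height(2) by blast
  from T_good_step(2)[OF T_good this refl a(2) eps_bounded_Var] show ?thesis by (simp add: subst_Var)
qed

lemma Tt_converges: "Tt h as Q \<Longrightarrow> wf_test Q \<Longrightarrow> converges_test ext Q"
proof -
  assume a: "Tt h as Q" "wf_test Q"
  then obtain k where "Tt (enat k) as Q" using T_finite_height(3) by blast
  from T_good_step(3)[OF T_good this refl a(2) eps_bounded_Var] show ?thesis
    by (simp add: subst_Var good_resolvable resolvable_converges_test)
qed

lemma hreds_Lam: "(hred ext)\<^sup>*\<^sup>* M M' \<Longrightarrow> (hred ext)\<^sup>*\<^sup>* (Lam M) (Lam M')"
  by (induction rule: rtranclp_induct) (auto intro: rtranclp.rtrancl_into_rtrancl ctx_lam)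

text \<open>A term is reduced under its abstractions, with the bound variables left in place. It is
  therefore enough to follow one arrow whose target is not \<omega>; one exists, because otherwise
  the meet would be \<omega>.\<close>

lemma T_conv_lams:
  "Tm h as \<alpha> M \<Longrightarrow> wf_tm M \<Longrightarrow> \<alpha> \<noteq> top \<Longrightarrow> \<exists>n L. (hred ext)\<^sup>*\<^sup>* M (lams n L) \<and>
     (vhead L \<or> (\<exists>\<beta> Q A. L = BarSum (add_mset (\<beta>, Q) A) \<and> \<beta> \<noteq> top \<and> head_normal_prod Q))"
  "Tn h as \<alpha> M \<Longrightarrow> True"
  "Tt h as Q \<Longrightarrow> True"
proof (induction rule: Tm_Tn_Tt.inducts)
  case (Tm_lam S \<alpha> h as M)
  have "\<exists>\<beta> \<gamma>. (\<beta>, \<gamma>) \<in> S \<and> \<gamma> \<noteq> top"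
  proof (rule ccontr)
    assume no: "\<not> (\<exists>\<beta> \<gamma>. (\<beta>, \<gamma>) \<in> S \<and> \<gamma> \<noteq> top)"
    have "top \<le> arr \<beta> \<gamma>" if i: "(\<beta>, \<gamma>) \<in> S" for \<beta> \<gamma>
    proof -
      have "\<gamma> = top" using no i by blast
      then show ?thesis by simp
    qed
    then have "top \<le> arrows arr S" unfolding le_arrows_iff[OF Tm_lam(1)] by blast
    then show False using Tm_lam(2) Tm_lam.prems(2) by (simp add: top_unique)
  qed
  then obtain \<beta> \<gamma> where "(\<beta>, \<gamma>) \<in> S" "\<gamma> \<noteq> top" by blast
  with Tm_lam(4) Tm_lam.prems(1) obtain n L where "(hred ext)\<^sup>*\<^sup>* M (lams n L)"
     and L: "vhead L \<or> (\<exists>\<beta> Q A. L = BarSum (add_mset (\<beta>, Q) A) \<and> \<beta> \<noteq> top \<and> head_normal_prod Q)" by force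
  then have "(hred ext)\<^sup>*\<^sup>* (Lam M) (lams (Suc n) L)" using hreds_Lam by simp
  with L show ?case by blast
next
  case (Tm_red M M' h as \<alpha>)
  from Tm_red.IH(2)[OF wf_head_beta[OF Tm_red.hyps(1) Tm_red.prems(1)] Tm_red.prems(2)] obtain n L
    where L: "(hred ext)\<^sup>*\<^sup>* M' (lams n L)"
      "vhead L \<or> (\<exists>\<beta> Q A. L = BarSum (add_mset (\<beta>, Q) A) \<and> \<beta> \<noteq> top \<and> head_normal_prod Q)" by blast
  from converse_rtranclp_into_rtranclp[OF head_beta_hred[OF Tm_red.hyps(1)] L(1)] L(2) show ?case by blast
next
  case (Tm_ne h as \<alpha> M)
  from Tn_spine_conv[OF Tm_ne(1) Tm_ne.prems(1)] show ?case unfolding spine_conv_def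
  proof (elim disjE exE conjE)
    assume "vhead M"
    then show ?thesis by (intro exI[of _ 0] exI[of _ M]) simp
  next
    fix A assume A: "(spine_red ext)\<^sup>*\<^sup>* M (BarSum A)" "wf_tm (BarSum A)"
      "meet (succs (good ext) A) \<le> \<alpha>"
    have "succs (good ext) A \<noteq> {}"
    proof
      assume e: "succs (good ext) A = {}"
      show False using A(3) Tm_ne.prems(2) unfolding e by (simp add: top_unique)
    qed
    then obtain \<beta> Q where Q: "(\<beta>, Q) \<in># A" "good ext Q" by blast
    then obtain A' where A': "A = add_mset (\<beta>, Q) A'" by (metis mset_add)
    from resolvable_converges_bar[OF good_resolvable[OF Q(2)], of \<beta> A'] obtain Q' A''
      where "(hred ext)\<^sup>*\<^sup>* (BarSum A) (BarSum (add_mset (\<beta>, Q') A''))" "head_normal_prod Q'" unfolding A' by blast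
    moreover have "\<beta> \<noteq> top" using A(2) Q(1) by auto
    ultimately show ?thesis
      using rtranclp_trans[OF spine_red_hreds[OF A(1)]]
      by (intro exI[of _ 0] exI[of _ "BarSum (add_mset (\<beta>, Q') A'')"]) auto
  qed
qed auto

lemma Tm_converges: "Tm h as \<alpha> M \<Longrightarrow> wf_tm M \<Longrightarrow> \<alpha> \<noteq> top \<Longrightarrow> converges ext M"
  using T_conv_lams(1) vhead_ex unfolding converges_def mhnf_def by metis

end


section \<open>Encoding tests in pure terms\<close>

context DEFiM
begin

lemma interp_AppI:
  "(as, arr \<gamma> \<delta>) \<in> sem n M \<Longrightarrow> (as, \<gamma>) \<in> sem n N \<Longrightarrow> scoped n M \<Longrightarrow> (as, \<delta>) \<in> sem n (App M N)"
  unfolding interp_App_iff using interp_length by blast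

text \<open>All arguments are typed by \<omega>, so the head variable alone decides: it is assumed
  with \<omega> \<rightarrow> ... \<rightarrow> \<omega> \<rightarrow> \<alpha>, and every other
  variable with \<omega>.\<close>

lemma vhead_Tn: "vhead M \<Longrightarrow> scoped n M \<Longrightarrow> \<exists>as. length as = n \<and> cut_free_ne as \<alpha> M"
proof (induction M arbitrary: \<alpha> rule: vhead.induct)
  case (1 i)
  then show ?case by (intro exI[of _ "(replicate n top)[i := \<alpha>]"]) (auto intro: Tn_var)
next
  case (2 M N)
  then show ?case using Tn_app[OF _ Tm_top] by fastforce
qed auto

text \<open>Each factor succeeds in an environment of its own; the pointwise meet of these
  environments serves all factors, by monotonicity.\<close>

lemma head_normal_prod_Tt:
  assumes "head_normal_prod H" "scoped_test n H"
  shows "\<exists>as. length as = n \<and> cut_free_test as H"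
proof -
  from assms(1) obtain A where A: "H = tprod A" "\<forall>Q \<in># A. \<exists>\<alpha> i Ms. Q = Tau \<alpha> (apps (Var i) Ms)"
    unfolding head_normal_prod_def by blast
  have sc: "\<forall>Q \<in># A. scoped_test n Q" using assms(2) unfolding A(1) scoped_tprod .
  have "\<exists>as. length as = n \<and> (\<forall>Q \<in># A. cut_free_test as Q)" using A(2) sc
  proof (induction A)
    case empty
    show ?case by (intro exI[of _ "replicate n top"]) simp
  next
    case (add Q A)
    from add obtain as where as: "length as = n" "\<forall>Q \<in># A. cut_free_test as Q" by auto
    from add.prems obtain \<alpha> i Ms where Q: "Q = Tau \<alpha> (apps (Var i) Ms)" "scoped n (apps (Var i) Ms)" by fastforce
    have "vhead (apps (Var i) Ms :: 'd tm)" by (simp add: vhead_apps)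
    from vhead_Tn[OF this Q(2), of \<alpha>] obtain bs where bs: "length bs = n" "cut_free_test bs Q"
      unfolding Q(1) Tt_tau_iff by (auto intro: Tm_ne)
    then have "length as = length bs" using as(1) by simp
    note le = list_all2_inf[OF this]
    have "cut_free_test (map2 inf as bs) P" if "P \<in># add_mset Q A" for P
      using that as(2) T_mono(3)[OF bs(2) le(2)] T_mono(3)[OF _ le(1), of \<infinity> P] by auto
    then show ?case using as(1) bs(1) by (intro exI[of _ "map2 inf as bs"]) simp
  qed
  then show ?thesis unfolding A(1) Tt_tprod_iff .
qed

lemma lams_Tm:
  assumes "\<alpha> \<noteq> top" "length as = k + n" "cut_free as \<alpha> L"
  shows "\<exists>as \<alpha>. \<alpha> \<noteq> top \<and> length as = n \<and> cut_free as \<alpha> (lams k L)"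
  using assms
proof (induction k arbitrary: n)
  case (Suc k)
  from Suc.IH[of "Suc n"] Suc.prems obtain as \<alpha> where as: "\<alpha> \<noteq> top" "length as = Suc n" "cut_free as \<alpha> (lams k L)" by auto
  then obtain b bs where b: "as = b # bs" "length bs = n" by (metis length_Suc_conv)
  have "cut_free bs (arr b \<alpha>) (Lam (lams k L))"
    by (rule Tm_Lam_infI[of "{(b, \<alpha>)}"]) (use as b in auto)
  then show ?case using as(1) b(2) by (intro exI[of _ bs] exI[of _ "arr b \<alpha>"]) simp
qed auto

lemma converges_interp:
  assumes nontrivial: "ok \<noteq> (top :: 'd)" and "converges ext M" "scoped n M"
  shows "\<exists>as \<alpha>. \<alpha> \<noteq> top \<and> (as, \<alpha>) \<in> sem n M"
proof -
  from assms(2) obtain M' where M': "(hred ext)\<^sup>*\<^sup>* M M'" "mhnf M'" unfolding converges_def by blast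
  have sc: "scoped n M'" by (rule scoped_hreds[OF M'(1) assms(3)])
  have "\<exists>as \<alpha>. \<alpha> \<noteq> top \<and> length as = n \<and> cut_free as \<alpha> M'" using M'(2) unfolding mhnf_def
  proof (elim disjE exE conjE)
    fix k i Ms assume e: "M' = lams k (apps (Var i) Ms)"
    then have "scoped (k + n) (apps (Var i) Ms)" using sc by (simp add: scoped_lams)
    then obtain as where "length as = k + n" "cut_free_ne as ok (apps (Var i) Ms)"
      using vhead_Tn[of "apps (Var i) Ms"] by (auto simp: vhead_apps)
    then show ?thesis unfolding e using lams_Tm[OF nontrivial _ Tm_ne] by blast
  next
    fix k \<alpha> Q A assume e: "M' = lams k (BarSum (add_mset (\<alpha>, Q) A))" "\<alpha> \<noteq> top" "head_normal_prod Q"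
    then have "scoped_test (k + n) Q" using sc by (simp add: scoped_lams)
    then obtain as where as: "length as = k + n" "cut_free_test as Q" using head_normal_prod_Tt[OF e(3)] by blast
    have "cut_free_ne as \<alpha> (BarSum (add_mset (\<alpha>, Q) A))"
      by (rule Tn_bar[of "{(\<alpha>, Q)}"]) (use as in auto)
    then show ?thesis unfolding e(1) using lams_Tm[OF e(2) as(1) Tm_ne] by blast
  qed
  then show ?thesis using T_sound(1)[OF T_hreds[OF M'(1)]] assms(3) by blast
qed

lemma converges_test_interp:
  assumes "converges_test ext Q" "scoped_test n Q"
  shows "sem_test n Q \<noteq> {}"
proof -
  from assms(1) obtain P R where r: "(hred_test ext)\<^sup>*\<^sup>* Q (tsum {#P, R#})" "head_normal_prod P"
    unfolding converges_test_def mhnf_test_def by blast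
  have "scoped_test n (tsum {#P, R#})" by (rule scoped_hreds_test[OF r(1) assms(2)])
  then obtain as where as: "length as = n" "cut_free_test as P" using head_normal_prod_Tt[OF r(2)] by (auto simp: scoped_tsum)
  then have "cut_free_test as (tsum {#P, R#})" by (simp add: Tt_tsum_iff)
  from T_sound(3)[OF T_hreds_test[OF r(1) this]] assms(2) as(1) show ?thesis by blast
qed

end

section \<open>The encoding and the translation of cut-free derivations back\<close>

context filter_model
begin

text \<open>The type of the variable that encodes adding a summand: the sum has type $\alpha$ if the test of
  the new summand (first argument) succeeds, and every type of the old sum (second argument).\<close>

definition bar_type :: "'d \<Rightarrow> 'd \<Rightarrow> 'd set \<Rightarrow> 'd" where
  "bar_type ok \<alpha> F = arrows arr (insert (ok, arr top \<alpha>) ((\<lambda>\<beta>. (top, arr \<beta> \<beta>)) ` F))"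

lemma arr_le_arr: "arr a b \<le> arr c d \<Longrightarrow> d = top \<or> c \<le> a \<and> b \<le> d"
proof -
  assume "arr a b \<le> arr c d"
  then have "meet (snd ` {(x, y) \<in> {(a, b)}. c \<le> x}) \<le> d" using arr_ge_iff[of "{(a, b)}" c d] by simp
  moreover have "{(x, y) \<in> {(a, b)}. c \<le> x} = (if c \<le> a then {(a, b)} else {})" by auto
  ultimately show ?thesis by (auto simp: top_unique split: if_splits)
qed

text \<open>The filter model axiom is applied once per argument. In the first round only the arrow
  of the new summand depends on \<gamma>', since the other sources are \<omega>; in the second round
  only the old types depend on \<gamma>.\<close>

lemma bar_type_le:
  assumes "finite F" "bar_type ok \<alpha> F \<le> arr \<gamma>' (arr \<gamma> \<delta>)"
  shows "meet ((if \<gamma>' \<le> ok then {\<alpha>} else {}) \<union> {\<beta> \<in> F. \<gamma> \<le> \<beta>}) \<le> \<delta>"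
proof -
  let ?S = "insert (ok, arr top \<alpha>) ((\<lambda>\<beta>. (top, arr \<beta> \<beta>)) ` F)"
  let ?T = "(if \<gamma>' \<le> ok then {(top, \<alpha>)} else {}) \<union> (\<lambda>\<beta>. (\<beta>, \<beta>)) ` F"
  have fin: "finite ?S" "finite ?T" using assms(1) by auto
  have "meet (snd ` {(a, b) \<in> ?S. \<gamma>' \<le> a}) \<le> arr \<gamma> \<delta>"
    using assms(2) arr_ge_iff[OF fin(1)] unfolding bar_type_def by blast
  moreover have "{(a, b) \<in> ?S. \<gamma>' \<le> a} = (if \<gamma>' \<le> ok then {(ok, arr top \<alpha>)} else {}) \<union> (\<lambda>\<beta>. (top, arr \<beta> \<beta>)) ` F"
    by auto
  then have "snd ` {(a, b) \<in> ?S. \<gamma>' \<le> a} = (\<lambda>(\<beta>, \<gamma>). arr \<beta> \<gamma>) ` ?T"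
    by (simp add: image_Un image_image)
  ultimately have "arrows arr ?T \<le> arr \<gamma> \<delta>" unfolding arrows_def by simp
  then have "meet (snd ` {(a, b) \<in> ?T. \<gamma> \<le> a}) \<le> \<delta>" using arr_ge_iff[OF fin(2)] by blast
  moreover have "{(a, b) \<in> ?T. \<gamma> \<le> a} = (if \<gamma>' \<le> ok then {(top, \<alpha>)} else {}) \<union> (\<lambda>\<beta>. (\<beta>, \<beta>)) ` {\<beta> \<in> F. \<gamma> \<le> \<beta>}"
    by auto
  then have "snd ` {(a, b) \<in> ?T. \<gamma> \<le> a} = (if \<gamma>' \<le> ok then {\<alpha>} else {}) \<union> {\<beta> \<in> F. \<gamma> \<le> \<beta>}"
    by (simp add: image_Un image_image)
  ultimately show ?thesis by simp
qed

text \<open>The variables below \<open>c\<close> are those of the encoded term; the variable \<open>c + k\<close> is fresh and has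
  the type \<open>ws ! k\<close>.\<close>

inductive enc :: "'d list \<Rightarrow> 'd \<Rightarrow> nat \<Rightarrow> 'd tm \<Rightarrow> 'd tm \<Rightarrow> bool"
  and enc_test :: "'d list \<Rightarrow> 'd \<Rightarrow> nat \<Rightarrow> 'd test \<Rightarrow> 'd tm \<Rightarrow> bool" for ws ok where
  enc_var: "i < c \<Longrightarrow> enc ws ok c (Var i) (Var i)"
| enc_lam: "enc ws ok (Suc c) M P \<Longrightarrow> enc ws ok c (Lam M) (Lam P)"
| enc_app: "enc ws ok c M P \<Longrightarrow> enc ws ok c N R \<Longrightarrow> enc ws ok c (App M N) (App P R)"
| enc_bar0: "k < length ws \<Longrightarrow> ws ! k = top \<Longrightarrow> enc ws ok c (BarSum {#}) (Var (c + k))"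
| enc_bar: "enc_test ws ok c Q P \<Longrightarrow> enc ws ok c (BarSum A) R \<Longrightarrow> k < length ws \<Longrightarrow>
    ws ! k = bar_type ok \<alpha> (fst ` set_mset A) \<Longrightarrow>
    enc ws ok c (BarSum (add_mset (\<alpha>, Q) A)) (App (App (Var (c + k)) P) R)"
| enc_test_sum0: "k < length ws \<Longrightarrow> ws ! k = top \<Longrightarrow> enc_test ws ok c (TSum {#}) (Var (c + k))"
| enc_test_sum: "enc_test ws ok c Q P \<Longrightarrow> enc_test ws ok c (TSum A) R \<Longrightarrow> k < length ws \<Longrightarrow>
    ws ! k = bar_type ok ok {ok} \<Longrightarrow> enc_test ws ok c (TSum (add_mset Q A)) (App (App (Var (c + k)) P) R)"
| enc_test_prod0: "k < length ws \<Longrightarrow> ws ! k = ok \<Longrightarrow> enc_test ws ok c (TProd {#}) (Var (c + k))"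
| enc_test_prod: "enc_test ws ok c Q P \<Longrightarrow> enc_test ws ok c (TProd A) R \<Longrightarrow> k < length ws \<Longrightarrow>
    ws ! k = arr ok (arr ok ok) \<Longrightarrow> enc_test ws ok c (TProd (add_mset Q A)) (App (App (Var (c + k)) P) R)"
| enc_test_tau: "enc ws ok c M P \<Longrightarrow> k < length ws \<Longrightarrow> ws ! k = arr \<alpha> ok \<Longrightarrow>
    enc_test ws ok c (Tau \<alpha> M) (App (Var (c + k)) P)"

inductive_cases enc_VarE: "enc ws ok c M (Var i)"
inductive_cases enc_LamE: "enc ws ok c M (Lam P)"
inductive_cases enc_AppE: "enc ws ok c M (App P R)"
inductive_cases enc_BarE: "enc ws ok c M (BarSum A)"
inductive_cases enc_test_VarE: "enc_test ws ok c Q (Var i)"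
inductive_cases enc_test_AppE: "enc_test ws ok c Q (App P R)"

lemma enc_scoped:
  "enc ws ok c M P \<Longrightarrow> pure P \<and> scoped (c + length ws) P \<and> scoped c M"
  "enc_test ws ok c Q P \<Longrightarrow> pure P \<and> scoped (c + length ws) P \<and> scoped_test c Q"
  by (induction rule: enc_enc_test.inducts) auto

lemma enc_test_neutral: "enc_test ws ok c Q P \<Longrightarrow> neutral P"
  by (cases rule: enc_test.cases) auto

lemma enc_rename:
  "enc ws ok c M P \<Longrightarrow> (\<And>i. i < c \<Longrightarrow> r i < c') \<Longrightarrow> (\<And>k. r (c + k) = c' + k) \<Longrightarrow>
     enc ws ok c' (rename r M) (rename r P)"
  "enc_test ws ok c Q P \<Longrightarrow> (\<And>i. i < c \<Longrightarrow> r i < c') \<Longrightarrow> (\<And>k. r (c + k) = c' + k) \<Longrightarrow>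
     enc_test ws ok c' (rename_test r Q) (rename r P)"
proof (induction arbitrary: r c' and r c' rule: enc_enc_test.inducts)
  case (enc_lam c M P)
  have "enc ws ok (Suc c') (rename (up_ren r) M) (rename (up_ren r) P)"
    by (rule enc_lam.IH(2)) (use enc_lam.prems in \<open>auto split: nat.split\<close>)
  then show ?case by (auto intro: enc_enc_test.enc_lam)
next
  case (enc_bar c Q P A R k \<alpha>)
  have "fst ` set_mset (image_mset (map_prod id (rename_test r)) A) = fst ` set_mset A" by force
  then show ?case using enc_bar enc_enc_test.enc_bar[of ws ok c' "rename_test r Q" "rename r P" "image_mset (map_prod id (rename_test r)) A"]
    by simp
qed (auto intro: enc_enc_test.intros)

lemma enc_subst:
  "enc ws ok c M P \<Longrightarrow> (\<And>i. i < c \<Longrightarrow> enc ws ok c' (s i) (t i)) \<Longrightarrow> (\<And>k. t (c + k) = Var (c' + k)) \<Longrightarrow>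
     enc ws ok c' (subst s M) (subst t P)"
  "enc_test ws ok c Q P \<Longrightarrow> (\<And>i. i < c \<Longrightarrow> enc ws ok c' (s i) (t i)) \<Longrightarrow> (\<And>k. t (c + k) = Var (c' + k)) \<Longrightarrow>
     enc_test ws ok c' (subst_test s Q) (subst t P)"
proof (induction arbitrary: s t c' and s t c' rule: enc_enc_test.inducts)
  case (enc_lam c M P)
  have r: "enc ws ok (Suc c') (rename Suc (s i)) (rename Suc (t i))" if "i < c" for i
    by (rule enc_rename(1)[OF enc_lam.prems(1)[OF that]]) auto
  have "enc ws ok (Suc c') (subst (up_sub s) M) (subst (up_sub t) P)"
    by (rule enc_lam.IH(2)) (use r enc_lam.prems(2) in \<open>auto split: nat.split intro: enc_enc_test.enc_var\<close>)
  then show ?case by (auto intro: enc_enc_test.enc_lam)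
next
  case (enc_bar c Q P A R k \<alpha>)
  have "fst ` set_mset (image_mset (map_prod id (subst_test s)) A) = fst ` set_mset A" by force
  then show ?case using enc_bar enc_enc_test.enc_bar[of ws ok c' "subst_test s Q" "subst t P" "image_mset (map_prod id (subst_test s)) A"]
    by simp
qed (auto intro: enc_enc_test.intros)

lemma enc_subst0: "enc ws ok (Suc c) M P \<Longrightarrow> enc ws ok c N R \<Longrightarrow> enc ws ok c (subst0 N M) (subst0 R P)"
  unfolding subst0_def by (rule enc_subst(1)) (auto split: nat.split intro: enc_var)

text \<open>Codes of sums and tests are neutral, so a head \<beta>-step of a code contracts a redex
  that the encoded term already has. For the same reason a code that reduces is an application
  exactly when the encoded term is one.\<close>

lemma enc_head_beta:
  "head_beta P P' \<Longrightarrow> enc ws ok c M P \<Longrightarrow> \<exists>M'. head_beta M M' \<and> enc ws ok c M' P' \<and> is_app M = is_app P"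
proof (induction arbitrary: M c rule: head_beta.induct)
  case (1 P R)
  from 1 obtain M1 M2 where "M = App M1 M2" "enc ws ok c M1 (Lam P)" "enc ws ok c M2 R"
    by (auto elim: enc_AppE)
  moreover from this(2) obtain L where "M1 = Lam L" "enc ws ok (Suc c) L P" by (auto elim: enc_LamE)
  ultimately show ?case by (auto intro!: exI[of _ "subst0 M2 L"] head_beta.intros enc_subst0)
next
  case (2 P P')
  from 2(3) obtain L where L: "M = Lam L" "enc ws ok (Suc c) L P" by (auto elim: enc_LamE)
  with 2(2)[OF L(2)] show ?case by (auto intro: head_beta.intros enc_lam)
next
  case (3 P P' R)
  have nn: "\<not> neutral P" using 3(1) neutral_not_head_beta by blast
  from 3(4) obtain M1 M2 where M: "M = App M1 M2" "enc ws ok c M1 P" "enc ws ok c M2 R"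
    by (rule enc_AppE) (use nn in auto)
  from 3(3)[OF M(2)] 3(2) M show ?case by (auto intro: head_beta.intros enc_app)
qed

text \<open>The third clause for \<open>Tn\<close> concerns a fresh variable applied to the code of
  a test. As the first half of a two-argument code it encodes nothing by itself, so what its typing
  says about that test has to be recorded until the second argument arrives.\<close>

lemma T_enc:
  assumes ok: "ok \<noteq> top"
  shows "Tm h bs \<alpha> P \<Longrightarrow> bs = as @ ws \<Longrightarrow> c = length as \<Longrightarrow>
      (\<forall>M. enc ws ok c M P \<longrightarrow> cut_free as \<alpha> M) \<and> (\<forall>Q. enc_test ws ok c Q P \<longrightarrow> \<alpha> \<le> ok \<longrightarrow> cut_free_test as Q)"
    "Tn h bs \<alpha> P \<Longrightarrow> bs = as @ ws \<Longrightarrow> c = length as \<Longrightarrow>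
      (\<forall>M. enc ws ok c M P \<longrightarrow> cut_free_ne as \<alpha> M) \<and> (\<forall>Q. enc_test ws ok c Q P \<longrightarrow> \<alpha> \<le> ok \<longrightarrow> cut_free_test as Q) \<and>
      (\<forall>k Q P'. k < length ws \<longrightarrow> P = App (Var (c + k)) P' \<longrightarrow> enc_test ws ok c Q P' \<longrightarrow>
         (\<exists>\<gamma>. ws ! k \<le> arr \<gamma> \<alpha> \<and> (\<gamma> \<le> ok \<longrightarrow> cut_free_test as Q)))"
    "Tt h bs R \<Longrightarrow> True"
proof (induction arbitrary: as c and as c and rule: Tm_Tn_Tt.inducts)
  case (Tm_top h bs M)
  then show ?case using ok by (auto simp: top_unique intro: Tm_Tn_Tt.Tm_top)
next
  case (Tm_lam S \<alpha> h bs P)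
  have no: "\<not> enc_test ws ok c Q (Lam P)" for Q using enc_test_neutral by fastforce
  have "cut_free as \<alpha> M" if "enc ws ok c M (Lam P)" for M
  proof -
    from that obtain L where L: "M = Lam L" "enc ws ok (Suc c) L P" by (auto elim: enc_LamE)
    have "cut_free (\<beta> # as) \<gamma> L" if "(\<beta>, \<gamma>) \<in> S" for \<beta> \<gamma>
      using Tm_lam(4)[OF that, of "\<beta> # as" "Suc c"] Tm_lam.prems L(2) by simp
    then show ?thesis unfolding L(1) by (rule Tm_Lam_infI[OF Tm_lam(1,2)])
  qed
  then show ?case using no by blast
next
  case (Tm_red P P' h bs \<alpha>)
  have nn: "\<not> neutral P" using Tm_red.hyps(1) neutral_not_head_beta by blast
  have "cut_free as \<alpha> M" if e: "enc ws ok c M P" for M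
  proof -
    obtain M' where M': "head_beta M M'" "enc ws ok c M' P'" "is_app M"
      using enc_head_beta[OF Tm_red.hyps(1) e] Tm_red.hyps(2) by blast
    have "cut_free as \<alpha> M'" using Tm_red.IH(2)[OF Tm_red.prems] M'(2) by blast
    then show ?thesis by (rule Tm_Tn_Tt.Tm_red[OF M'(1,3)])
  qed
  then show ?case using nn enc_test_neutral by blast
next
  case (Tm_ne h bs \<alpha> P)
  from Tm_ne.IH(2)[OF Tm_ne.prems] show ?case using Tm_Tn_Tt.Tm_ne by blast
next
  case (Tn_var i bs \<alpha> h)
  have ws: "bs ! (c + k) = ws ! k" for k using Tn_var.prems by simp
  have "cut_free_ne as \<alpha> M" if "enc ws ok c M (Var i)" for M
    using that
  proof (rule enc_VarE)
    assume "M = Var i" "i < c"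
    then show ?thesis using Tn_var by (auto intro!: Tm_Tn_Tt.Tn_var simp: nth_append)
  next
    fix k assume "M = BarSum {#}" "i = c + k" "ws ! k = top"
    then show ?thesis using Tn_var(2) ws by (simp add: Tn_bar_iff)
  qed
  moreover have "cut_free_test as Q" if "enc_test ws ok c Q (Var i)" "\<alpha> \<le> ok" for Q
    using that(1)
  proof (rule enc_test_VarE)
    fix k assume "i = c + k" "ws ! k = top"
    then have "top \<le> ok" using Tn_var(2) ws that(2) order_trans by metis
    then show ?thesis using ok by (simp add: top_unique)
  next
    assume "Q = TProd {#}"
    then show ?thesis by (simp add: Tt_prod_iff)
  qed
  ultimately show ?case by simp
next
  case (Tn_bar B A \<alpha> h bs)
  have "\<not> enc ws ok c M (BarSum A)" for M by (auto elim: enc_BarE)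
  moreover have "\<not> enc_test ws ok c Q (BarSum A)" for Q using enc_scoped(2) by fastforce
  ultimately show ?case by simp
next
  case (Tn_app h bs \<gamma> \<delta> X Y)
  note X = Tn_app.IH(2)[OF Tn_app.prems] and Y = Tn_app.IH(4)[OF Tn_app.prems]
  have ws: "bs ! (c + k) = ws ! k" for k using Tn_app.prems by simp
  have v: "ws ! k \<le> arr \<gamma> \<delta>" if "X = Var (c + k)" for k
    using Tn_app(1) that ws by (auto elim: Tn_VarE)
  have two: "\<exists>\<gamma>'. ws ! k \<le> arr \<gamma>' (arr \<gamma> \<delta>) \<and> (\<gamma>' \<le> ok \<longrightarrow> cut_free_test as Q)"
    if "X = App (Var (c + k)) P" "enc_test ws ok c Q P" "k < length ws" for k P Q
    using X that by blast
  have "cut_free_ne as \<delta> M" if "enc ws ok c M (App X Y)" for M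
    using that
  proof (rule enc_AppE)
    fix M1 M2 assume "M = App M1 M2" "enc ws ok c M1 X" "enc ws ok c M2 Y"
    then show ?thesis using X Y by (blast intro: Tm_Tn_Tt.Tn_app)
  next
    fix Q P A k \<alpha> assume M: "M = BarSum (add_mset (\<alpha>, Q) A)" and a: "X = App (Var (c + k)) P" "enc_test ws ok c Q P"
      "enc ws ok c (BarSum A) Y" "k < length ws" "ws ! k = bar_type ok \<alpha> (fst ` set_mset A)"
    from two[OF a(1,2,4)] obtain \<gamma>' where \<gamma>': "bar_type ok \<alpha> (fst ` set_mset A) \<le> arr \<gamma>' (arr \<gamma> \<delta>)" "\<gamma>' \<le> ok \<Longrightarrow> cut_free_test as Q"
      unfolding a(5) by blast
    let ?Z = "succs (cut_free_test as) (add_mset (\<alpha>, Q) A)"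
    have le: "meet ((if \<gamma>' \<le> ok then {\<alpha>} else {}) \<union> {\<beta> \<in> fst ` set_mset A. \<gamma> \<le> \<beta>}) \<le> \<delta>"
      by (rule bar_type_le[OF _ \<gamma>'(1)]) simp
    have "cut_free as \<gamma> (BarSum A)" using Y a(3) by blast
    then have "meet (succs (cut_free_test as) A) \<le> \<gamma>" by (simp add: Tm_bar_iff)
    moreover have "meet ?Z \<le> meet (succs (cut_free_test as) A)"
      by (rule meet_antimono[OF finite_succ]) auto
    ultimately have Z: "meet ?Z \<le> \<gamma>" by (rule order_trans[rotated])
    \<comment> \<open>An old type counts only if it is above \<gamma>, which is a type of the old
      sum; the type of the new summand counts otherwise only if \<gamma>' is below
      \<open>ok\<close>, and then the new test succeeds.\<close>
    have "meet ?Z \<le> \<beta>" if "\<beta> \<in> (if \<gamma>' \<le> ok then {\<alpha>} else {}) \<union> {\<beta> \<in> fst ` set_mset A. \<gamma> \<le> \<beta>}" for \<beta>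
    proof (cases "\<gamma> \<le> \<beta>")
      case True
      then show ?thesis using Z order_trans by blast
    next
      case False
      then have "\<beta> = \<alpha>" "\<gamma>' \<le> ok" using that by (auto split: if_splits)
      then have "\<beta> \<in> ?Z" using \<gamma>'(2) by auto
      then show ?thesis by (rule meet_lower[OF finite_succ])
    qed
    then have "meet ?Z \<le> meet ((if \<gamma>' \<le> ok then {\<alpha>} else {}) \<union> {\<beta> \<in> fst ` set_mset A. \<gamma> \<le> \<beta>})"
      by (subst le_meet_iff) auto
    then show ?thesis unfolding M Tn_bar_iff using le by (rule order_trans)
  qed
  moreover have "cut_free_test as Q" if q: "enc_test ws ok c Q (App X Y)" "\<delta> \<le> ok" for Q
  proof -
    have \<delta>: "\<delta> \<noteq> top" using q(2) ok by (auto simp: top_unique)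
    from q(1) show ?thesis
    proof (rule enc_test_AppE)
      fix Q' P A k assume Q: "Q = TSum (add_mset Q' A)" and a: "X = App (Var (c + k)) P" "enc_test ws ok c Q' P"
        "enc_test ws ok c (TSum A) Y" "k < length ws" "ws ! k = bar_type ok ok {ok}"
      from two[OF a(1,2,4)] obtain \<gamma>' where \<gamma>': "bar_type ok ok {ok} \<le> arr \<gamma>' (arr \<gamma> \<delta>)" "\<gamma>' \<le> ok \<Longrightarrow> cut_free_test as Q'"
        unfolding a(5) by blast
      have le: "meet ((if \<gamma>' \<le> ok then {ok} else {}) \<union> {\<beta> \<in> {ok}. \<gamma> \<le> \<beta>}) \<le> \<delta>"
        by (rule bar_type_le[OF _ \<gamma>'(1)]) simp
      have "\<gamma>' \<le> ok \<or> \<gamma> \<le> ok"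
      proof (rule ccontr)
        assume "\<not> (\<gamma>' \<le> ok \<or> \<gamma> \<le> ok)"
        then have e: "(if \<gamma>' \<le> ok then {ok} else {}) \<union> {\<beta> \<in> {ok}. \<gamma> \<le> \<beta>} = {}" by auto
        show False using le \<delta> unfolding e by (simp add: top_unique)
      qed
      moreover have "\<gamma> \<le> ok \<Longrightarrow> cut_free_test as (TSum A)" using Y a(3) by blast
      ultimately show ?thesis unfolding Q using \<gamma>'(2) by (auto simp: Tt_sum_iff)
    next
      fix Q' P A k assume Q: "Q = TProd (add_mset Q' A)" and a: "X = App (Var (c + k)) P" "enc_test ws ok c Q' P"
        "enc_test ws ok c (TProd A) Y" "k < length ws" "ws ! k = arr ok (arr ok ok)"
      from two[OF a(1,2,4)] obtain \<gamma>' where \<gamma>': "arr ok (arr ok ok) \<le> arr \<gamma>' (arr \<gamma> \<delta>)" "\<gamma>' \<le> ok \<Longrightarrow> cut_free_test as Q'"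
        unfolding a(5) by blast
      have "\<gamma>' \<le> ok" "arr ok ok \<le> arr \<gamma> \<delta>" using arr_le_arr[OF \<gamma>'(1)] \<delta> by auto
      moreover from this(2) have "\<gamma> \<le> ok" using arr_le_arr[of ok ok \<gamma> \<delta>] \<delta> by auto
      then have "cut_free_test as (TProd A)" using Y a(3) by blast
      ultimately show ?thesis unfolding Q using \<gamma>'(2) by (auto simp: Tt_prod_iff)
    next
      fix M k \<alpha> assume Q: "Q = Tau \<alpha> M" and a: "X = Var (c + k)" "enc ws ok c M Y" "ws ! k = arr \<alpha> ok"
      have "arr \<alpha> ok \<le> arr \<gamma> \<delta>" using v[OF a(1)] a(3) by simp
      then have "\<gamma> \<le> \<alpha>" using arr_le_arr[of \<alpha> ok \<gamma> \<delta>] \<delta> by auto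
      moreover have "cut_free as \<gamma> M" using Y a(2) by blast
      ultimately show ?thesis unfolding Q Tt_tau_iff by (rule Tm_up[rotated])
    qed
  qed
  moreover have "\<exists>\<gamma>. ws ! k \<le> arr \<gamma> \<delta> \<and> (\<gamma> \<le> ok \<longrightarrow> cut_free_test as Q)"
    if "App X Y = App (Var (c + k)) P" "enc_test ws ok c Q P" for k P Q
    using v[of k] Y that by blast
  ultimately show ?case by blast
qed auto

end

section \<open>Codes keep the types of what they encode, and codes exist\<close>

context DEFiM
begin

lemma interp_two_args:
  assumes "ws ! k \<le> arr \<beta> (arr \<gamma> \<tau>)" "k < length ws" "length as = c"
    "(as @ ws, \<beta>) \<in> sem (c + length ws) P" "(as @ ws, \<gamma>) \<in> sem (c + length ws) R"
    "scoped (c + length ws) P"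
  shows "(as @ ws, \<tau>) \<in> sem (c + length ws) (App (App (Var (c + k)) P) R)"
  by (intro interp_AppI[OF interp_AppI[OF _ assms(4)] assms(5)]) (use assms in \<open>auto simp: nth_append\<close>)

lemma interp_enc:
  "enc ws ok c M P \<Longrightarrow> (as, \<alpha>) \<in> sem c M \<Longrightarrow> (as @ ws, \<alpha>) \<in> sem (c + length ws) P"
  "enc_test ws ok c Q P \<Longrightarrow> as \<in> sem_test c Q \<Longrightarrow> (as @ ws, ok) \<in> sem (c + length ws) P"
proof (induction arbitrary: as \<alpha> and as rule: enc_enc_test.inducts)
  case (enc_var i c)
  then show ?case by (auto simp: nth_append)
next
  case (enc_lam c M P)
  from enc_lam.prems obtain S where S: "length as = c" "finite S" "\<alpha> = arrows arr S"
    "\<And>\<beta> \<gamma>. (\<beta>, \<gamma>) \<in> S \<Longrightarrow> (\<beta> # as, \<gamma>) \<in> sem (Suc c) M"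
    unfolding interp_Lam_raw by blast
  have "scoped (Suc (c + length ws)) P" using enc_scoped(1)[OF enc_lam.IH(1)] by simp
  then show ?case
    by (rule interp_LamI[OF _ _ S(2)]) (use S enc_lam.IH(2)[OF S(4)] in auto)
next
  case (enc_app c M P N R)
  have sc: "scoped c M" "scoped (c + length ws) P" using enc_scoped(1)[OF enc_app.IH(1)] by auto
  from enc_app.prems obtain \<gamma> where "(as, arr \<gamma> \<alpha>) \<in> sem c M" "(as, \<gamma>) \<in> sem c N"
    unfolding interp_App_iff[OF sc(1)] by blast
  then show ?case by (intro interp_AppI[OF _ _ sc(2)] enc_app.IH(2) enc_app.IH(4))
next
  case (enc_bar0 k c)
  then have l: "length as = c" by (auto dest: interp_length)
  have "\<alpha> = top" using enc_bar0.prems unfolding interp_Bar_iff by (simp add: top_unique)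
  then show ?case using enc_bar0(1,2) l by simp
next
  case (enc_bar c Q P A R k \<alpha> as \<gamma>)
  note sP = enc_scoped(2)[OF enc_bar.IH(1)] and sR = enc_scoped(1)[OF enc_bar.IH(3)]
  have l: "length as = c" using enc_bar.prems interp_length by blast
  let ?n = "c + length ws" and ?w = "Var (c + k)"
  have k: "k < length ws" and wk: "ws ! k = bar_type ok \<alpha> (fst ` set_mset A)" using enc_bar by auto
  have app: "(as @ ws, \<tau>) \<in> sem ?n (App (App ?w P) R)"
    if "bar_type ok \<alpha> (fst ` set_mset A) \<le> arr \<gamma>1 (arr \<gamma>2 \<tau>)" "(as @ ws, \<gamma>1) \<in> sem ?n P" "(as @ ws, \<gamma>2) \<in> sem ?n R"
    for \<tau> \<gamma>1 \<gamma>2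
    by (rule interp_two_args[OF _ k l that(2,3)]) (use wk that(1) sP in auto)
  have tP: "(as @ ws, top) \<in> sem ?n P" "(as @ ws, top) \<in> sem ?n R"
    using sP sR l by (auto intro!: interp_top)
  let ?S = "insert (ok, arr top \<alpha>) ((\<lambda>\<beta>. (top, arr \<beta> \<beta>)) ` fst ` set_mset A)"
  have low: "bar_type ok \<alpha> (fst ` set_mset A) \<le> arr x y" if "(x, y) \<in> ?S" for x y
    unfolding bar_type_def by (rule arrows_lower[OF _ that]) simp
  \<comment> \<open>Each successful summand is treated alone, with \<omega> for the other argument:
    \<open>ok\<close> and \<omega> for the new summand, \<omega> and \<open>z\<close> for an old
    one. The meet is formed only afterwards.\<close>
  have all: "(as @ ws, z) \<in> sem ?n (App (App ?w P) R)"
    if z: "(z, Q') \<in># add_mset (\<alpha>, Q) A" "as \<in> sem_test c Q'" for z Q'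
  proof (cases "(z, Q') = (\<alpha>, Q)")
    case True
    then have "(as @ ws, ok) \<in> sem ?n P" using enc_bar.IH(2) z(2) by simp
    then show ?thesis using app[of ok top z, OF low] tP(2) True by simp
  next
    case False
    then have zA: "(z, Q') \<in># A" using z(1) by auto
    have "(as, z) \<in> sem c (BarSum A)"
      by (rule interp_BarI[OF l, of "{z}"]) (use zA z(2) in auto)
    then have "(as @ ws, z) \<in> sem ?n R" by (rule enc_bar.IH(4))
    moreover have "(top, arr z z) \<in> ?S" using zA by force
    ultimately show ?thesis using app[of top z z, OF low] tP(1) by simp
  qed
  have "meet (succs (\<lambda>Q. as \<in> sem_test c Q) (add_mset (\<alpha>, Q) A)) \<le> \<gamma>"
    using enc_bar.prems unfolding interp_Bar_iff by blast
  note le = this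
  show ?case
  proof (rule interp_le_meet[OF _ _ finite_succ _ le])
    show "scoped ?n (App (App ?w P) R)" using sP sR k by simp
    show "length (as @ ws) = ?n" using l by simp
  qed (use all in blast)
next
  case (enc_test_sum c Q P A R k)
  note sP = enc_scoped(2)[OF enc_test_sum.IH(1)] and sR = enc_scoped(2)[OF enc_test_sum.IH(3)]
  have l: "length as = c" using enc_test_sum.prems interp_test_length by blast
  have k: "k < length ws" and wk: "ws ! k = bar_type ok ok {ok}" using enc_test_sum by auto
  have tP: "(as @ ws, top) \<in> sem (c + length ws) P" "(as @ ws, top) \<in> sem (c + length ws) R"
    using sP sR l by (auto intro!: interp_top)
  have low: "bar_type ok ok {ok} \<le> arr ok (arr top ok)" "bar_type ok ok {ok} \<le> arr top (arr ok ok)"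
    unfolding bar_type_def by (rule arrows_lower; simp)+
  from enc_test_sum.prems consider "as \<in> sem_test c Q" | "as \<in> sem_test c (TSum A)" by auto
  then show ?case
  proof cases
    case 1
    show ?thesis by (rule interp_two_args[OF _ k l enc_test_sum.IH(2)[OF 1] tP(2)]) (use wk low sP in auto)
  next
    case 2
    show ?thesis by (rule interp_two_args[OF _ k l tP(1) enc_test_sum.IH(4)[OF 2]]) (use wk low sP in auto)
  qed
next
  case (enc_test_prod0 k c)
  then show ?case by (auto dest: interp_test_length)
next
  case (enc_test_prod c Q P A R k)
  note sP = enc_scoped(2)[OF enc_test_prod.IH(1)]
  have l: "length as = c" using enc_test_prod.prems interp_test_length by blast
  have k: "k < length ws" and wk: "ws ! k = arr ok (arr ok ok)" using enc_test_prod by auto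
  have q: "as \<in> sem_test c Q" "as \<in> sem_test c (TProd A)" using enc_test_prod.prems by auto
  show ?case
    by (rule interp_two_args[OF _ k l enc_test_prod.IH(2)[OF q(1)] enc_test_prod.IH(4)[OF q(2)]]) (use wk sP in auto)
next
  case (enc_test_tau c M P k \<alpha>)
  have l: "length as = c" using enc_test_tau.prems interp_test_length by blast
  have "(as, \<alpha>) \<in> sem c M" using enc_test_tau.prems by simp
  have k: "k < length ws" "ws ! k = arr \<alpha> ok" using enc_test_tau by auto
  show ?case
    by (rule interp_AppI[OF _ enc_test_tau.IH(2)[OF \<open>(as, \<alpha>) \<in> sem c M\<close>]]) (use k l in auto)
qed auto

text \<open>\<open>R\<close> collects the types that fresh variables must offer. Asking for every
  list that contains them makes the demand monotone, so that parts can share one list; quantifying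
  over \<open>c\<close> inside lets the same \<open>R\<close> serve below an abstraction.\<close>

definition encodable :: "('d list \<Rightarrow> nat \<Rightarrow> 'd tm \<Rightarrow> bool) \<Rightarrow> (nat \<Rightarrow> bool) \<Rightarrow> bool" where
  "encodable E sc \<longleftrightarrow> (\<exists>R. finite R \<and> (\<forall>ws c. R \<subseteq> set ws \<longrightarrow> sc c \<longrightarrow> (\<exists>P. E ws c P)))"

lemma encodable_const:
  assumes "\<And>ws c k. k < length ws \<Longrightarrow> ws ! k = \<tau> \<Longrightarrow> \<exists>P. E ws c P"
  shows "encodable E sc"
  unfolding encodable_def using assms by (intro exI[of _ "{\<tau>}"]) (auto simp: in_set_conv_nth)

lemma encodable_imp:
  assumes "encodable E sc" "\<And>c. sc' c \<Longrightarrow> sc c" "\<And>ws c P. E ws c P \<Longrightarrow> \<exists>P'. E' ws c P'"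
  shows "encodable E' sc'"
  using assms unfolding encodable_def by meson

text \<open>The combined relation leaves its last argument free: it records only that both parts
  have codes over the same list, which is what the rules of \<open>enc\<close> consume.\<close>

lemma encodable_conj:
  assumes "encodable E sc" "encodable E' sc'"
  shows "encodable (\<lambda>ws c P. \<exists>Q R. E ws c Q \<and> E' ws c R) (\<lambda>c. sc c \<and> sc' c)"
proof -
  from assms obtain R R' where "finite R" "\<And>ws c. R \<subseteq> set ws \<Longrightarrow> sc c \<Longrightarrow> \<exists>P. E ws c P"
    "finite R'" "\<And>ws c. R' \<subseteq> set ws \<Longrightarrow> sc' c \<Longrightarrow> \<exists>P. E' ws c P"
    unfolding encodable_def by meson
  then show ?thesis unfolding encodable_def by (intro exI[of _ "R \<union> R'"]) simp
qed

lemma encodable_arg: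
  assumes "encodable E sc"
    "\<And>ws c k P. E ws c P \<Longrightarrow> k < length ws \<Longrightarrow> ws ! k = \<tau> \<Longrightarrow> \<exists>P'. E' ws c P'"
  shows "encodable E' sc"
proof -
  from assms(1) obtain R where R: "finite R" "\<And>ws c. R \<subseteq> set ws \<Longrightarrow> sc c \<Longrightarrow> \<exists>P. E ws c P"
    unfolding encodable_def by meson
  have "\<exists>P. E' ws c P" if "insert \<tau> R \<subseteq> set ws" "sc c" for ws c
    using R(2)[of ws c] that assms(2)[of ws c] by (auto simp: in_set_conv_nth)
  then show ?thesis unfolding encodable_def using R(1) by (intro exI[of _ "insert \<tau> R"]) simp
qed

lemma wf_encodable:
  "wf_tm M \<Longrightarrow> encodable (\<lambda>ws c. enc ws ok c M) (\<lambda>c. scoped c M)" (is "_ \<Longrightarrow> ?E M")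
  "wf_test Q \<Longrightarrow> encodable (\<lambda>ws c. enc_test ws ok c Q) (\<lambda>c. scoped_test c Q)" (is "_ \<Longrightarrow> ?T Q")
proof (induction M and Q)
  case (Var i)
  show ?case unfolding encodable_def by (intro exI[of _ "{}"]) (auto intro: enc_var)
next
  case (Lam M)
  then have "?E M" by simp
  then obtain R where "finite R \<and> (\<forall>ws c. R \<subseteq> set ws \<longrightarrow> scoped (Suc c) M \<longrightarrow> (\<exists>P. enc ws ok (Suc c) M P))"
    unfolding encodable_def by meson
  then show ?case unfolding encodable_def scoped.simps using enc_lam by meson
next
  case (App M N)
  show ?case
    by (rule encodable_imp[OF encodable_conj[OF App.IH]]) (use App.prems in \<open>auto intro: enc_app\<close>)
next
  case (BarSum A)
  have "(\<And>\<alpha> Q. (\<alpha>, Q) \<in># A \<Longrightarrow> ?T Q) \<Longrightarrow>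
     ?E (BarSum A)"
  proof (induction A)
    case empty
    show ?case by (rule encodable_const[of top]) (blast intro: enc_bar0)
  next
    case (add x A)
    obtain \<alpha> Q where x: "x = (\<alpha>, Q)" by force
    have "?T Q"
      "?E (BarSum A)" using add x by auto
    from encodable_arg[OF encodable_conj[OF this], of "bar_type ok \<alpha> (fst ` set_mset A)" "\<lambda>ws c. enc ws ok c (BarSum (add_mset x A))"]
    show ?case by (rule encodable_imp) (auto simp: x intro: enc_bar)
  qed
  then show ?case using BarSum by fastforce
next
  case (TSum A)
  have "(\<And>Q. Q \<in># A \<Longrightarrow> ?T Q) \<Longrightarrow>
     ?T (TSum A)"
  proof (induction A)
    case empty
    show ?case by (rule encodable_const[of top]) (blast intro: enc_test_sum0)
  next
    case (add Q A)
    have "?T Q"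
      "?T (TSum A)" using add by auto
    from encodable_arg[OF encodable_conj[OF this], of "bar_type ok ok {ok}" "\<lambda>ws c. enc_test ws ok c (TSum (add_mset Q A))"]
    show ?case by (rule encodable_imp) (auto intro: enc_test_sum)
  qed
  then show ?case using TSum by simp
next
  case (TProd A)
  have "(\<And>Q. Q \<in># A \<Longrightarrow> ?T Q) \<Longrightarrow>
     ?T (TProd A)"
  proof (induction A)
    case empty
    show ?case by (rule encodable_const[of ok]) (blast intro: enc_test_prod0)
  next
    case (add Q A)
    have "?T Q"
      "?T (TProd A)" using add by auto
    from encodable_arg[OF encodable_conj[OF this], of "arr ok (arr ok ok)" "\<lambda>ws c. enc_test ws ok c (TProd (add_mset Q A))"]
    show ?case by (rule encodable_imp) (auto intro: enc_test_prod)
  qed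
  then show ?case using TProd by simp
next
  case (Tau \<alpha> M)
  then have "?E M" by simp
  from encodable_arg[OF this, of "arr \<alpha> ok" "\<lambda>ws c. enc_test ws ok c (Tau \<alpha> M)"]
  show ?case by (auto intro: enc_test_tau)
qed auto

lemma approximable_T:
  assumes "approximable arr" and ok: "ok \<noteq> (top :: 'd)"
  shows "wf_tm M \<Longrightarrow> scoped n M \<Longrightarrow> (as, \<alpha>) \<in> sem n M \<Longrightarrow> cut_free as \<alpha> M"
    "wf_test Q \<Longrightarrow> scoped_test n Q \<Longrightarrow> as \<in> sem_test n Q \<Longrightarrow> cut_free_test as Q"
proof -
  note pure_T = assms(1)[unfolded approximable_iff_Tm, rule_format]
  {
    assume a: "wf_tm M" "scoped n M" "(as, \<alpha>) \<in> sem n M"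
    obtain ws P where P: "enc ws ok n M P"
      using wf_encodable(1)[OF a(1), of ok] a(2) unfolding encodable_def by (metis finite_list order_refl)
    have "cut_free (as @ ws) \<alpha> P" using pure_T interp_enc(1)[OF P a(3)] enc_scoped(1)[OF P] by blast
    from T_enc(1)[OF ok this refl interp_length[OF a(3), symmetric]] P show "cut_free as \<alpha> M" by blast
  }
  {
    assume a: "wf_test Q" "scoped_test n Q" "as \<in> sem_test n Q"
    obtain ws P where P: "enc_test ws ok n Q P"
      using wf_encodable(2)[OF a(1), of ok] a(2) unfolding encodable_def by (metis finite_list order_refl)
    have "cut_free (as @ ws) ok P" using pure_T interp_enc(2)[OF P a(3)] enc_scoped(2)[OF P] by blast
    from T_enc(1)[OF ok this refl interp_test_length[OF a(3), symmetric]] P show "cut_free_test as Q" by blast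
  }
qed

lemma approximable_iff_sensible:
  assumes ok: "ok \<noteq> (top :: 'd)"
  shows "approximable arr \<longleftrightarrow> sensible arr ext"
proof
  assume s: "sensible arr ext"
  show "approximable arr" unfolding approximable_iff_Tm
  proof (intro allI impI)
    fix n M as \<alpha> assume a: "pure M" "scoped n M" "(as, \<alpha>) \<in> sem n M"
    have n: "n = length as" using interp_length[OF a(3)] by simp
    show "cut_free as \<alpha> M" using sensible_Tm[OF s] a unfolding n by blast
  qed
next
  assume ap: "approximable arr"
  show "sensible arr ext" unfolding sensible_def
  proof (intro conjI allI impI)
    fix n and M :: "'d tm" assume a: "wf_tm M" "scoped n M"
    show "\<not> converges ext M \<longleftrightarrow> sem n M = {(as, top) |as. length as = n}"
    proof
      assume nc: "\<not> converges ext M"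
      have "\<alpha> = top" if "(as, \<alpha>) \<in> sem n M" for as \<alpha>
        using Tm_converges[OF approximable_T(1)[OF ap ok a that] a(1)] nc by blast
      moreover have "(as, top) \<in> sem n M" if "length as = n" for as
        by (rule interp_top[OF a(2) that])
      ultimately show "sem n M = {(as, top) |as. length as = n}"
        using interp_length[of _ _ n M] by fastforce
    next
      assume e: "sem n M = {(as, top) |as. length as = n}"
      show "\<not> converges ext M"
      proof
        assume "converges ext M"
        from converges_interp[OF ok this a(2)] show False unfolding e by blast
      qed
    qed
  next
    fix n and Q :: "'d test" assume a: "wf_test Q" "scoped_test n Q"
    show "\<not> converges_test ext Q \<longleftrightarrow> sem_test n Q = {}"
      using Tt_converges[OF approximable_T(2)[OF ap ok a] a(1)] converges_test_interp[OF _ a(2)] by blast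
  qed
qed

end


text \<open>The one-point model shows why \<open>nontrivial\<close> is assumed. There everything in
  scope has just the type \<omega>, so the model is approximable, but a variable converges and has
  the interpretation reserved for divergent terms, so it is not sensible.\<close>

theorem mainTheorem2:
  fixes arr :: "'d::bounded_semilattice_inf_top \<Rightarrow> 'd \<Rightarrow> 'd"
    and ext :: "'d \<Rightarrow> ('d \<times> 'd) set"
  assumes "DEFiM arr ext"
    and nontrivial: "\<exists>\<alpha>::'d. \<alpha> \<noteq> top"
  shows "approximable arr \<longleftrightarrow> sensible arr ext"
  using DEFiM.approximable_iff_sensible[OF assms(1)] nontrivial by blast

end
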